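(* Consider the anti-lock braking system with relay control and parameters $F_0,k,\lambda_0,\Delta\lambda$ defined in the context, and assume $F_0k\neq0$. Fix $\lambda_0\in\mathbb{R}$ and put $$a=4\frac{F'(\lambda_0)}{k},\qquad b=-4\frac{k}{F_0}.$$ If $F'(\lambda_0)>0$, then for any $m>|a|/|b|$ and for $\Delta\lambda$ sufficiently close to zero with $\Delta\lambda\cdot k>0$, the anti-lock braking system admits, in the shifted coordinates $(\lambda-\lambda_0,\ T_b-F_0^{-1}F(\lambda_0))$, a unique limit cycle with initial condition $(x,y(x))$, $x=\Delta\lambda$, such that $(x,y(x))\to0$ as $x\to0$ and $|x|/|y(x)|^3\le m$. The limit cycle is orbitally stable.
   Context: The system for the wheel slip $\lambda(t)$ and braking torque $T_b(t)$ is $$\dot\lambda(t)=-F(\lambda(t))+F_0T_b(t),\qquad \dot T_b(t)=u(t),$$ with $$F(\lambda)=\frac1\nu\left(\frac{1-\lambda}{m_q}+\frac{r^2}{J}\right)F_z\,\mu(\lambda),\quad \mu(\lambda)=\theta_{r1}\left(1-e^{-\lambda\theta_{r2}}\right)-\lambda\theta_{r3},\quad F_0=\frac{r}{\nu J},$$ where $\nu$ (vehicle speed), $r$ (wheel radius), $J$ (moment of inertia), $m_q$ (mass of the quarter-car), $F_z$ (vertical force) and $\theta_{r1},\theta_{r2},\theta_{r3}$ are positive constants. The control $u$ takes the two values $-k$ and $k$ by the relay rule: whenever $\lambda(t)$ hits $\lambda_0+\Delta\lambda$, $u$ is set to $-k$; whenever $\lambda(t)$ hits $\lambda_0-\Delta\lambda$,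 $u$ is set to $k$; otherwise $u$ keeps its current value. A solution starting on the line $\lambda=\lambda_0+\Delta\lambda$ starts with $u=-k$. Only solutions that intersect the switching lines transversally are considered. A limit cycle is the closed orbit of a nonconstant periodic solution of this switched system. *)

theory Defs
  imports "HOL-Analysis.Analysis"
begin

definition tyre_friction :: "real \<Rightarrow> real \<Rightarrow> real \<Rightarrow> real \<Rightarrow> real" where
  "tyre_friction \<theta>1 \<theta>2 \<theta>3 l = \<theta>1 * (1 - exp (- l * \<theta>2)) - l * \<theta>3"

definition slip_drag ::
  "real \<Rightarrow> real \<Rightarrow> real \<Rightarrow> real \<Rightarrow> real \<Rightarrow> real \<Rightarrow> real \<Rightarrow> real \<Rightarrow> real \<Rightarrow> real" where
  "slip_drag \<nu> r J m\<^sub>q F\<^sub>z \<theta>1 \<theta>2 \<theta>3 l =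
     1 / \<nu> * ((1 - l) / m\<^sub>q + r\<^sup>2 / J) * F\<^sub>z * tyre_friction \<theta>1 \<theta>2 \<theta>3 l"

(* In all definitions below: l = wheel slip, T = braking torque, u = control, \<Delta> = half-width
   of the relay (its sign is that of k in the application); I is a time interval. *)

(* The last clause says that u keeps its value as long as no switching line is hit. *)
definition relay_rule ::
  "real \<Rightarrow> real \<Rightarrow> real \<Rightarrow> real set \<Rightarrow> (real \<Rightarrow> real) \<Rightarrow> (real \<Rightarrow> real) \<Rightarrow> bool" where
  "relay_rule k l0 \<Delta> I l u \<longleftrightarrow>
     (\<forall>t\<in>I. u t \<in> {- k, k}) \<and>
     (\<forall>t\<in>I. l t = l0 + \<Delta> \<longrightarrow> u t = - k) \<and>
     (\<forall>t\<in>I. l t = l0 - \<Delta> \<longrightarrow> u t = k) \<and>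
     (\<forall>s\<in>I. \<forall>t\<in>I. s < t \<and> (\<forall>q\<in>{s<..t}. l q \<notin> {l0 + \<Delta>, l0 - \<Delta>}) \<longrightarrow> u t = u s)"

(* Since u jumps at switching times and already has its new value there, the equation T' = u
   is imposed on the right derivative of the continuous function T.
   The last clause is transversality to the switching lines. *)
definition abs_solution ::
  "(real \<Rightarrow> real) \<Rightarrow> real \<Rightarrow> real \<Rightarrow> real \<Rightarrow> real \<Rightarrow> real set \<Rightarrow>
   (real \<Rightarrow> real) \<Rightarrow> (real \<Rightarrow> real) \<Rightarrow> (real \<Rightarrow> real) \<Rightarrow> bool" where
  "abs_solution F F0 k l0 \<Delta> I l T u \<longleftrightarrow>
     (\<forall>t\<in>I. (l has_real_derivative (- F (l t) + F0 * T t)) (at t within I)) \<and>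
     continuous_on I T \<and>
     (\<forall>t\<in>I. (T has_real_derivative u t) (at t within (I \<inter> {t..}))) \<and>
     relay_rule k l0 \<Delta> I l u \<and>
     (\<forall>t\<in>I. l t \<in> {l0 + \<Delta>, l0 - \<Delta>} \<longrightarrow> - F (l t) + F0 * T t \<noteq> 0)"

(* The state of the switched system comprises the current relay value, because for slips
   strictly between the switching lines (l, T) alone does not determine the motion. *)
definition shifted_state ::
  "(real \<Rightarrow> real) \<Rightarrow> real \<Rightarrow> real \<Rightarrow> real \<times> real \<times> real \<Rightarrow> real \<times> real \<times> real" where
  "shifted_state F F0 l0 = (\<lambda>(l, T, u). (l - l0, T - F l0 / F0, u))"

definition limit_cycle_from ::
  "(real \<Rightarrow> real) \<Rightarrow> real \<Rightarrow> real \<Rightarrow> real \<Rightarrow> real \<Rightarrow> real \<times> real \<Rightarrow>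
   (real \<times> real \<times> real) set \<Rightarrow> bool" where
  "limit_cycle_from F F0 k l0 \<Delta> p \<Gamma> \<longleftrightarrow>
     (\<exists>l T u P. abs_solution F F0 k l0 \<Delta> {0..} l T u \<and>
        (l 0 - l0, T 0 - F l0 / F0) = p \<and>
        P > 0 \<and> (\<forall>t\<ge>0. l (t + P) = l t \<and> T (t + P) = T t \<and> u (t + P) = u t) \<and>
        (\<exists>t\<ge>0. (l t, T t) \<noteq> (l 0, T 0)) \<and>
        \<Gamma> = (\<lambda>t. shifted_state F F0 l0 (l t, T t, u t)) ` {0..})"

(* Beyond a switching line the relay has the value set on that line. A state violating this
   cannot occur on a solution that starts on the line l = l0 + \<Delta>. Multiplying
   by \<Delta> covers both signs of \<Delta>. *)
definition relay_consistent :: "real \<Rightarrow> real \<Rightarrow> real \<Rightarrow> real \<Rightarrow> real \<Rightarrow> bool" where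
  "relay_consistent k l0 \<Delta> l u \<longleftrightarrow>
     ((l - l0) * \<Delta> > \<Delta>\<^sup>2 \<longrightarrow> u = - k) \<and>
     ((l - l0) * \<Delta> < - \<Delta>\<^sup>2 \<longrightarrow> u = k)"

(* Quantifying over solutions on all compact intervals [0, \<tau>] makes the condition apply to
   every initial piece of a solution, whatever happens (loss of transversality, blow-up)
   at later times. *)
definition orbitally_stable ::
  "(real \<Rightarrow> real) \<Rightarrow> real \<Rightarrow> real \<Rightarrow> real \<Rightarrow> real \<Rightarrow>
   (real \<times> real \<times> real) set \<Rightarrow> bool" where
  "orbitally_stable F F0 k l0 \<Delta> \<Gamma> \<longleftrightarrow>
     (\<forall>\<epsilon>>0. \<exists>\<delta>>0. \<forall>\<tau>>0. \<forall>l T u.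
        abs_solution F F0 k l0 \<Delta> {0..\<tau>} l T u \<and>
        relay_consistent k l0 \<Delta> (l 0) (u 0) \<and>
        infdist (shifted_state F F0 l0 (l 0, T 0, u 0)) \<Gamma> < \<delta> \<longrightarrow>
        (\<forall>t\<in>{0..\<tau>}. infdist (shifted_state F F0 l0 (l t, T t, u t)) \<Gamma> < \<epsilon>))"

end

theory Submission
  imports Defs
begin

text \<open>
  After an affine change of coordinates and of time (which for \<open>k < 0\<close> also reflects the plane) one has
  \<open>k = F0 = 1\<close>, the equilibrium is the origin, the drag \<open>f\<close> has slope \<open>1\<close> at \<open>0\<close>, the relay has
  half-width \<open>D > 0\<close>, and the bound \<open>\<bar>\<Delta>\<bar> / \<bar>y\<bar>^3 \<le> m\<close> becomes \<open>D \<le> \<mu> * \<bar>y\<bar>^3\<close> with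
  \<open>\<mu> > 1\<close>.  Between two switchings the torque is linear in time, so it can replace time: in the phase
  \<open>u = -1\<close>, with \<open>s = - y\<close>, the slip obeys the scalar equation \<open>z' = - s - g z\<close>, where \<open>g\<close> is an extension of
  \<open>f\<close> from a neighbourhood of \<open>0\<close>.  The phase \<open>u = 1\<close> is the same equation for the mirrored drag
  \<open>- g (- x)\<close>.

  A half-turn starts on the line \<open>z = D\<close> with torque \<open>\<sigma>\<close> and ends on \<open>z = - D\<close> with torque \<open>- \<sigma>'\<close>.  Without drag
  \<open>z + s^2/2\<close> is conserved, so a half-turn gains \<open>2 D\<close>; the drag takes away about \<open>2/3 \<sigma>^3\<close>.
  The two balance near \<open>D = \<sigma>^3/3\<close>.  Explicit barriers with cruder constants are enough: at
  the lower end of the window, where \<open>D = \<mu> \<sigma>^3\<close>, half-turns gain torque (\<open>half_map_start\<close>).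

  The decisive fact is \<open>half_map_contract\<close>: \<open>\<sigma> \<mapsto> \<sigma>'\<close> is increasing and contracts distances by the factor
  \<open>1 - 3/10 \<sigma>\<close>.  Since \<open>g\<close> is increasing, the slip difference of two arcs decays; over a half-turn, which takes
  the time \<open>\<sigma> + \<sigma>'\<close>, it loses a fraction of about \<open>2 \<sigma>\<close>.  Slip differences turn into torque differences through
  the crossing speeds, which are about \<open>\<sigma>\<close> and \<open>\<sigma>'\<close>, and \<open>\<sigma>'\<close> is smaller than \<open>\<sigma>\<close> by a fraction of about \<open>\<sigma>\<close>
  at most.  The decay wins, which needs no derivative with respect to initial values.

  Consequently the composition of the half-turn maps of \<open>g\<close> and of the mirrored drag has a fixed point by
  Banach's theorem, and gluing the two arcs gives the periodic solution (\<open>cycle_solution\<close>).  Any solution has to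
  follow the arcs (\<open>solution_follows_arc\<close>).  A periodic solution in the window therefore returns to the
  line \<open>z = D\<close> closer and closer to the fixed point while also coming back to its first crossing, so it
  crosses at the fixed point (\<open>periodic_start_unique\<close>); one that starts downwards is first followed to its
  next upward crossing.  Orbital stability holds because the return map does not increase distances and
  because an arc that starts near a reference arc stays near it and ends near its end
  (\<open>half_turn_shadow\<close>).
\<close>

section \<open>Comparison for scalar differential inequalities\<close>

text \<open>
  The comparison arguments start from the last zero of a function that has become positive: after it the
  sign is known.
\<close>

lemma last_nonpos_time:
  fixes w :: "real \<Rightarrow> real"
  assumes "a \<le> b" "continuous_on {a..b} w" "w a \<le> 0" "w b > 0"
  obtains q where "a \<le> q" "q < b" "w q = 0" "\<And>t. q < t \<Longrightarrow> t \<le> b \<Longrightarrow> w t > 0"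
proof -
  let ?S = "{a..b} \<inter> w -` {..0}"
  have cl: "closed ?S"
    using assms(2) by (intro continuous_closed_preimage) auto
  have cS: "compact ?S"
    using cl by (simp add: compact_eq_bounded_closed bounded_Int)
  have "a \<in> ?S" using assms by auto
  then have "?S \<noteq> {}" by blast
  then obtain q where q: "q \<in> ?S" "\<forall>t\<in>?S. t \<le> q"
    using compact_attains_sup[OF cS] by metis
  have pos: "w t > 0" if "q < t" "t \<le> b" for t
  proof (rule ccontr)
    assume "\<not> w t > 0"
    then have "t \<in> ?S" using that q(1) by auto
    with q(2) have "t \<le> q" by blast
    with that show False by simp
  qed
  have "q < b" using q(1) assms(4) by (cases "q = b") auto
  have "w q = 0"
  proof (rule ccontr)
    assume "w q \<noteq> 0"
    then have "w q < 0" using q(1) by auto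
    have "continuous_on {q..b} w" using q(1) by (intro continuous_on_subset[OF assms(2)]) auto
    then obtain t where "q \<le> t" "t \<le> b" "w t = 0"
      using IVT'[of w q 0 b] \<open>w q < 0\<close> \<open>q < b\<close> assms(4) by auto
    then show False using pos[of t] \<open>w q < 0\<close> by (cases "t = q") auto
  qed
  show ?thesis
    by (rule that[of q]) (use q(1) pos \<open>q < b\<close> \<open>w q = 0\<close> in auto)
qed

lemma first_hit:
  fixes z :: "real \<Rightarrow> real"
  assumes "a \<le> b" "continuous_on {a..b} z" "z a > c" "z b \<le> c"
  obtains e where "a < e" "e \<le> b" "z e = c" "\<And>s. a \<le> s \<Longrightarrow> s < e \<Longrightarrow> z s > c"
proof -
  have 1: "continuous_on {-b..-a} (\<lambda>s. z (-s) - c)"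
    by (intro continuous_intros continuous_on_compose2[OF assms(2)]) auto
  obtain q where "-b \<le> q" "q < -a" "z (-q) - c = 0" "\<And>t. q < t \<Longrightarrow> t \<le> -a \<Longrightarrow> z (-t) - c > 0"
    using last_nonpos_time[OF _ 1] assms by auto
  then show ?thesis
  proof (intro that[of "-q"])
    show "z s > c" if "a \<le> s" "s < -q" for s
      using \<open>\<And>t. q < t \<Longrightarrow> t \<le> -a \<Longrightarrow> z (-t) - c > 0\<close>[of "-s"] that by simp
  qed auto
qed

text \<open>
  The sign of the derivative matters only where \<open>w\<close> is positive: after its last zero \<open>w\<close> would have to decrease.
\<close>

lemma barrier:
  fixes w :: "real \<Rightarrow> real"
  assumes "a \<le> b" "\<And>s. a \<le> s \<Longrightarrow> s \<le> b \<Longrightarrow> (w has_real_derivative w' s) (at s)"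
    and "\<And>s. a \<le> s \<Longrightarrow> s \<le> b \<Longrightarrow> w s > 0 \<Longrightarrow> w' s \<le> 0"
    and "w a \<le> 0"
  shows "w b \<le> 0"
proof (rule ccontr)
  assume "\<not> w b \<le> 0"
  have cont: "continuous_on {a..b} w"
    using assms(2) by (intro DERIV_continuous_on[of _ _ w'])
      (auto intro: has_field_derivative_at_within)
  obtain q where q: "a \<le> q" "q < b" "w q = 0" "\<And>t. q < t \<Longrightarrow> t \<le> b \<Longrightarrow> w t > 0"
    using last_nonpos_time[OF assms(1) cont assms(4)] \<open>\<not> w b \<le> 0\<close> by auto
  have "w b \<le> w q"
  proof (rule DERIV_nonpos_imp_decreasing_open[of q b w])
    fix x assume "q < x" "x < b"
    then show "\<exists>y. DERIV w x :> y \<and> y \<le> 0"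
      using assms(2)[of x] assms(3)[of x] q by (intro exI[of _ "w' x"]) auto
    next
    show "continuous_on {q..b} w"
      using cont by (rule continuous_on_subset) (use q in auto)
  qed (use q(2) in simp)
  then show False using q \<open>\<not> w b \<le> 0\<close> by auto
qed

section \<open>The slip equation with the torque as clock\<close>

text \<open>
  The drag has slope \<open>1\<close> at \<open>0\<close> after normalisation; the margins \<open>9/10\<close> and \<open>11/10\<close> hold near \<open>0\<close> and are
  enough for every estimate below.  They are imposed on the whole line so that all arcs can be compared;
  \<open>local_drag_extends\<close> provides such an extension of a local drag.
\<close>

definition drag :: "(real \<Rightarrow> real) \<Rightarrow> bool" where
  "drag g \<longleftrightarrow> g 0 = 0 \<and>
     (\<forall>x y. x \<le> y \<longrightarrow> 9/10 * (y - x) \<le> g y - g x \<and> g y - g x \<le> 11/10 * (y - x))"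

text \<open>
  Reflecting slip, torque and control turns the phase \<open>u = 1\<close> into the phase \<open>u = -1\<close> for this drag.
\<close>

definition mirror :: "(real \<Rightarrow> real) \<Rightarrow> real \<Rightarrow> real" where
  "mirror g x = - g (- x)"

lemma mirror_mirror [simp]: "mirror (mirror g) = g"
  by (auto simp: mirror_def)

lemma drag_mirror: "drag g \<Longrightarrow> drag (mirror g)"
  unfolding drag_def mirror_def
proof (elim conjE, intro conjI allI impI)
  fix x y :: real
  assume *: "\<forall>x y. x \<le> y \<longrightarrow> 9/10 * (y - x) \<le> g y - g x \<and> g y - g x \<le> 11/10 * (y - x)"
    and "x \<le> y"
  then have "9/10 * (- x - - y) \<le> g (- x) - g (- y) \<and> g (- x) - g (- y) \<le> 11/10 * (- x - - y)"
    by (meson neg_le_iff_le)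
  then show "9/10 * (y - x) \<le> - g (- y) - - g (- x)" "- g (- y) - - g (- x) \<le> 11/10 * (y - x)"
    by (auto simp: algebra_simps)
qed auto

lemma drag_mono: "drag g \<Longrightarrow> x \<le> y \<Longrightarrow> 9/10 * (y - x) \<le> g y - g x"
  unfolding drag_def by blast

lemma drag_upper: "drag g \<Longrightarrow> x \<le> y \<Longrightarrow> g y - g x \<le> 11/10 * (y - x)"
  unfolding drag_def by blast

lemma drag_lipschitz:
  assumes "drag g"
  shows "\<bar>g x - g y\<bar> \<le> 11/10 * \<bar>x - y\<bar>"
proof -
  have *: "\<bar>g v - g u\<bar> \<le> 11/10 * \<bar>v - u\<bar>" if "u \<le> v" for u v
    using drag_mono[OF assms that] drag_upper[OF assms that] that by (simp add: abs_of_nonneg)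
  show ?thesis
    using *[of x y] *[of y x] by (metis abs_minus_commute linear)
qed

lemma drag_zero: "drag g \<Longrightarrow> g 0 = 0"
  unfolding drag_def by blast

lemma drag_continuous: "drag g \<Longrightarrow> continuous_on S g"
  by (intro lipschitz_on_continuous_on[of "11/10"] lipschitz_onI)
     (simp_all only: dist_real_def drag_lipschitz)

text \<open>
  In the phase \<open>u = -1\<close> the torque \<open>y\<close> decreases at unit speed, so \<open>s = - y\<close> can serve as time and
  \<open>x' = y - g x\<close> becomes this equation.  The window \<open>\<bar>s\<bar> < 1/5\<close> contains every arc that is needed and is
  short enough for Picard's operator on the whole window to be a contraction.
\<close>

definition slip_arc :: "(real \<Rightarrow> real) \<Rightarrow> (real \<Rightarrow> real) \<Rightarrow> bool" where
  "slip_arc g z \<longleftrightarrow> (\<forall>s. \<bar>s\<bar> < 1/5 \<longrightarrow> (z has_real_derivative (- s - g (z s))) (at s))"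

lemma slip_arc_deriv:
  "slip_arc g z \<Longrightarrow> \<bar>s\<bar> < 1/5 \<Longrightarrow> (z has_real_derivative (- s - g (z s))) (at s)"
  unfolding slip_arc_def by blast

lemma slip_arc_continuous:
  assumes "slip_arc g z" "-1/5 < a" "b < 1/5"
  shows "continuous_on {a..b} z"
proof (rule DERIV_continuous_on)
  fix s assume "s \<in> {a..b}"
  then have "\<bar>s\<bar> < 1/5" using assms(2,3) by auto
  then show "(z has_real_derivative (- s - g (z s))) (at s within {a..b})"
    by (rule has_field_derivative_at_within[OF slip_arc_deriv[OF assms(1)]])
qed

text \<open>
  Picard iteration.  Two times in the window differ by at most \<open>2/5\<close> and \<open>g\<close> has Lipschitz constant \<open>11/10\<close>,
  which gives the contraction factor \<open>44/100\<close>.  Clamping the time to the window makes the iterates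
  bounded continuous functions on the line.
\<close>

lemma slip_arc_exists:
  assumes g: "drag g" and s0: "\<bar>s0\<bar> < 1/5"
  obtains z where "slip_arc g z" "z s0 = x0"
proof -
  define cl :: "real \<Rightarrow> real" where "cl s = max (-1/5) (min (1/5) s)" for s
  have cl: "cl s \<in> {-1/5..1/5}" for s by (auto simp: cl_def)
  have cl_id: "cl s = s" if "s \<in> {-1/5..1/5}" for s using that by (auto simp: cl_def)
  have cl_cont: "continuous_on UNIV cl" unfolding cl_def by (intro continuous_intros)
  define rhs where "rhs = (\<lambda>(\<phi>::real \<Rightarrow>\<^sub>C real) s. - s - g (apply_bcontfun \<phi> s))"
  define I where "I = (\<lambda>\<phi> s. x0 + integral {-1/5..s} (rhs \<phi>) - integral {-1/5..s0} (rhs \<phi>))"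
  have rhs_cont: "continuous_on {-1/5..1/5} (rhs \<phi>)" for \<phi>
    unfolding rhs_def
    by (intro continuous_intros continuous_on_compose2[OF drag_continuous[OF g, of UNIV]]) auto
  have I_deriv: "(I \<phi> has_real_derivative rhs \<phi> s) (at s within {-1/5..1/5})"
    if "s \<in> {-1/5..1/5}" for \<phi> s
    unfolding I_def
    by (rule derivative_eq_intros integral_has_real_derivative[OF rhs_cont that] refl | simp)+
  have I_cont: "continuous_on {-1/5..1/5} (I \<phi>)" for \<phi>
    using I_deriv by (rule DERIV_continuous_on)
  have cont: "continuous_on UNIV (\<lambda>s. I \<phi> (cl s))" for \<phi>
    by (rule continuous_on_compose2[OF I_cont cl_cont]) (use cl in auto)
  have "compact (I \<phi> ` {-1/5..1/5})" for \<phi>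
    by (intro compact_continuous_image I_cont) auto
  moreover have "range (\<lambda>s. I \<phi> (cl s)) \<subseteq> I \<phi> ` {-1/5..1/5}" for \<phi>
    using cl by (intro image_subsetI imageI)
  ultimately have "bounded (range (\<lambda>s. I \<phi> (cl s)))" for \<phi>
    by (meson bounded_subset compact_imp_bounded)
  then have bc: "(\<lambda>s. I \<phi> (cl s)) \<in> bcontfun" for \<phi>
    using cont by (auto simp: bcontfun_def)
  define \<Phi> where "\<Phi> \<phi> = Bcontfun (\<lambda>s. I \<phi> (cl s))" for \<phi>
  have \<Phi>: "apply_bcontfun (\<Phi> \<phi>) s = I \<phi> (cl s)" for \<phi> s
    unfolding \<Phi>_def using Bcontfun_inverse[OF bc] by simp
  have contr: "dist (\<Phi> \<phi>) (\<Phi> \<psi>) \<le> 44/100 * dist \<phi> \<psi>" for \<phi> \<psi>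
  proof (rule dist_bound)
    fix s
    have d: "((\<lambda>s. I \<phi> s - I \<psi> s) has_field_derivative (rhs \<phi> r - rhs \<psi> r)) (at r within {-1/5..1/5})"
      if "r \<in> {-1/5..1/5}" for r
      using I_deriv[OF that] by (intro derivative_intros)
    have b: "norm (rhs \<phi> r - rhs \<psi> r) \<le> 11/10 * dist \<phi> \<psi>" for r
    proof -
      have "norm (rhs \<phi> r - rhs \<psi> r) \<le> 11/10 * \<bar>apply_bcontfun \<psi> r - apply_bcontfun \<phi> r\<bar>"
        using drag_lipschitz[OF g, of "apply_bcontfun \<psi> r" "apply_bcontfun \<phi> r"]
        unfolding rhs_def by auto
      also have "\<bar>apply_bcontfun \<psi> r - apply_bcontfun \<phi> r\<bar> \<le> dist \<phi> \<psi>"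
        using dist_bounded[of \<phi> r \<psi>] by (simp add: dist_real_def abs_minus_commute)
      finally show ?thesis by simp
    qed
    have "norm ((I \<phi> (cl s) - I \<psi> (cl s)) - (I \<phi> s0 - I \<psi> s0)) \<le> 11/10 * dist \<phi> \<psi> * norm (cl s - s0)"
      by (rule field_differentiable_bound[OF _ d b]) (use cl s0 in auto)
    moreover have "I \<phi> s0 = I \<psi> s0" by (simp add: I_def)
    moreover have "norm (cl s - s0) \<le> 4/10" using cl[of s] s0 unfolding real_norm_def atLeastAtMost_iff by linarith
    then have "11/10 * dist \<phi> \<psi> * norm (cl s - s0) \<le> 11/10 * dist \<phi> \<psi> * (4/10)"
      by (intro mult_left_mono) auto
    ultimately show "dist (apply_bcontfun (\<Phi> \<phi>) s) (apply_bcontfun (\<Phi> \<psi>) s) \<le> 44/100 * dist \<phi> \<psi>"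
      by (simp add: \<Phi> dist_real_def)
  qed
  have "\<exists>!\<phi>. \<Phi> \<phi> = \<phi>"
    by (rule banach_fix_type[of "44/100"]) (simp, simp, intro allI contr)
  then obtain \<phi> where \<phi>: "\<Phi> \<phi> = \<phi>"
    by blast
  have val: "apply_bcontfun \<phi> s = I \<phi> s" if "s \<in> {-1/5..1/5}" for s
    using \<Phi>[of \<phi> s] cl_id[OF that] by (simp add: \<phi>)
  have "slip_arc g \<phi>"
    unfolding slip_arc_def
  proof (intro allI impI)
    fix s :: real assume s: "\<bar>s\<bar> < 1/5"
    then have "(I \<phi> has_real_derivative rhs \<phi> s) (at s within {-1/5<..<1/5})"
      by (intro has_field_derivative_subset[OF I_deriv]) auto
    then have "(I \<phi> has_real_derivative rhs \<phi> s) (at s)"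
      using s by (subst (asm) at_within_open) auto
    then show "(apply_bcontfun \<phi> has_real_derivative - s - g (apply_bcontfun \<phi> s)) (at s)"
      unfolding rhs_def
      by (rule has_field_derivative_transform_within_open[of _ _ _ "{-1/5<..<1/5}"])
         (use s val in auto)
  qed
  moreover have "apply_bcontfun \<phi> s0 = x0"
    by (subst val) (use s0 in \<open>simp_all add: I_def abs_if split: if_splits\<close>)
  ultimately show ?thesis using that by blast
qed

text \<open>
  \<open>g\<close> is increasing, so the difference of two arcs cannot grow forward in time.
\<close>

lemma slip_arc_order:
  assumes "drag g" "slip_arc g z1" "slip_arc g z2" "-1/5 < a" "a \<le> b" "b < 1/5" "z1 a - z2 a \<le> \<omega>" "\<omega> \<ge> 0"
  shows "z1 b - z2 b \<le> \<omega>"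
proof -
  have "z1 b - z2 b - \<omega> \<le> 0"
  proof (rule barrier[OF assms(5)])
    fix s assume s: "a \<le> s" "s \<le> b"
    then have s': "\<bar>s\<bar> < 1/5" using assms by auto
    show "((\<lambda>s. z1 s - z2 s - \<omega>) has_real_derivative (- s - g (z1 s)) - (- s - g (z2 s)) - 0) (at s)"
      by (intro derivative_intros slip_arc_deriv assms s')
    show "(- s - g (z1 s)) - (- s - g (z2 s)) - 0 \<le> 0" if "z1 s - z2 s - \<omega> > 0"
      using drag_mono[OF assms(1), of "z2 s" "z1 s"] that assms(8) by auto
  qed (use assms in auto)
  then show ?thesis by simp
qed

lemma slip_arc_close:
  assumes "drag g" "slip_arc g z1" "slip_arc g z2" "-1/5 < a" "a \<le> b" "b < 1/5" "\<bar>z1 a - z2 a\<bar> \<le> \<omega>"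
  shows "\<bar>z1 b - z2 b\<bar> \<le> \<omega>"
proof -
  have "\<omega> \<ge> 0" "z1 a - z2 a \<le> \<omega>" "z2 a - z1 a \<le> \<omega>" using assms(7) by auto
  then have "z1 b - z2 b \<le> \<omega>" "z2 b - z1 b \<le> \<omega>"
    using assms by (blast intro: slip_arc_order)+
  then show ?thesis by auto
qed

section \<open>Half-turns between the switching lines\<close>

text \<open>
  The torque \<open>\<sigma>\<close> is small, so the drag is a perturbation during one half-turn, and the relay is narrow
  compared with the height \<open>\<sigma>^2/2\<close> that an arc reaches.
\<close>

definition admissible :: "real \<Rightarrow> real \<Rightarrow> bool" where
  "admissible D \<sigma> \<longleftrightarrow> 0 < D \<and> 0 < \<sigma> \<and> \<sigma> \<le> 1/100 \<and> 100 * D \<le> \<sigma>\<^sup>2"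

definition half_turn ::
  "(real \<Rightarrow> real) \<Rightarrow> real \<Rightarrow> real \<Rightarrow> (real \<Rightarrow> real) \<Rightarrow> real \<Rightarrow> bool" where
  "half_turn g D \<sigma> z \<sigma>' \<longleftrightarrow> slip_arc g z \<and> z (-\<sigma>) = D \<and> z \<sigma>' = - D \<and> -\<sigma> < \<sigma>' \<and>
     \<sigma>' < 1/10 \<and> (\<forall>s. -\<sigma> \<le> s \<and> s < \<sigma>' \<longrightarrow> z s > - D)"

lemma admissible_square:
  assumes "admissible D \<sigma>"
  shows "\<sigma>\<^sup>2 \<le> \<sigma> / 100" "D \<le> \<sigma>\<^sup>2 / 100" "D \<le> \<sigma> / 10000" "0 < D" "0 < \<sigma>" "\<sigma> \<le> 1/100"
proof -
  show 1: "\<sigma>\<^sup>2 \<le> \<sigma> / 100"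
    using assms mult_left_mono[of \<sigma> "1/100" \<sigma>] by (auto simp: admissible_def power2_eq_square)
  show "D \<le> \<sigma>\<^sup>2 / 100" "D \<le> \<sigma> / 10000" "0 < D" "0 < \<sigma>" "\<sigma> \<le> 1/100"
    using assms 1 by (auto simp: admissible_def)
qed

lemma drag_nonneg: "drag g \<Longrightarrow> 0 \<le> x \<Longrightarrow> 0 \<le> g x"
  using drag_mono[of g 0 x] drag_zero[of g] by simp

text \<open>
  The energy \<open>z + s^2/2\<close> changes at the rate \<open>- g z\<close>, which is at most \<open>11/10 D\<close> as long as \<open>z \<ge> - D\<close>.
\<close>

lemma slip_arc_fall:
  assumes g: "drag g" and z: "slip_arc g z" and "-1/5 < a" "a \<le> b" "b < 1/5"
    and above: "\<And>s. a \<le> s \<Longrightarrow> s \<le> b \<Longrightarrow> z s \<ge> - D" and "D \<ge> 0"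
  shows "z b + b\<^sup>2/2 - 11/10 * D * b \<le> z a + a\<^sup>2/2 - 11/10 * D * a"
proof -
  let ?w = "\<lambda>s. z s + s\<^sup>2/2 - 11/10 * D * s - (z a + a\<^sup>2/2 - 11/10 * D * a)"
  have "?w b \<le> 0"
  proof (rule barrier[OF \<open>a \<le> b\<close>])
    fix s assume s: "a \<le> s" "s \<le> b"
    then have "\<bar>s\<bar> < 1/5" using assms by auto
    then show "(?w has_real_derivative (- s - g (z s)) + s - 11/10 * D) (at s)"
      by (auto intro!: derivative_eq_intros slip_arc_deriv[OF z])
    have "g 0 - g (- D) \<le> 11/10 * D" "0 \<le> g (z s) - g (-D)"
      using drag_upper[OF g, of "-D" 0] drag_mono[OF g above[OF s]] above[OF s] \<open>D \<ge> 0\<close> by auto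
    then show "(- s - g (z s)) + s - 11/10 * D \<le> 0"
      using drag_zero[OF g] by linarith
  qed auto
  then show ?thesis by simp
qed

text \<open>
  The drag takes energy away while the slip is positive, so the arc stays below the drag-free parabola.
\<close>

lemma slip_arc_rise_bound:
  assumes g: "drag g" and z: "slip_arc g z" and D: "admissible D \<sigma>" "z (-\<sigma>) = D"
    and s: "-\<sigma> \<le> s" "s \<le> 0"
  shows "z s \<le> D + (\<sigma>\<^sup>2 - s\<^sup>2) / 2"
proof -
  let ?w = "\<lambda>s. z s - (D + (\<sigma>\<^sup>2 - s\<^sup>2) / 2)"
  note adm = admissible_square[OF D(1)]
  have "?w s \<le> 0"
  proof (rule barrier[OF s(1)])
    fix r assume r: "-\<sigma> \<le> r" "r \<le> s"
    then have "\<bar>r\<bar> < 1/5" using adm s by auto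
    then show "(?w has_real_derivative (- r - g (z r)) + r) (at r)"
      by (auto intro!: derivative_eq_intros slip_arc_deriv[OF z])
    have "r\<^sup>2 \<le> \<sigma>\<^sup>2" using r s adm by (intro abs_le_square_iff[THEN iffD1]) auto
    show "(- r - g (z r)) + r \<le> 0" if "?w r > 0"
    proof -
      have "0 \<le> z r" using that \<open>r\<^sup>2 \<le> \<sigma>\<^sup>2\<close> adm by argo
      then show ?thesis using drag_nonneg[OF g] by fastforce
    qed
  qed (use D in auto)
  then show ?thesis by simp
qed

lemma slip_arc_max:
  assumes g: "drag g" and z: "slip_arc g z" and D: "admissible D \<sigma>" "z (-\<sigma>) = D"
    and s: "-\<sigma> \<le> s" "s \<le> 1/10"
  shows "z s \<le> D + \<sigma>\<^sup>2 / 2"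
proof (cases "s \<le> 0")
  case True
  then have "z s \<le> D + (\<sigma>\<^sup>2 - s\<^sup>2) / 2" by (rule slip_arc_rise_bound[OF g z D s(1)])
  then show ?thesis using zero_le_power2[of s] by argo
next
  case False
  note adm = admissible_square[OF D(1)]
  let ?w = "\<lambda>s. z s - (D + \<sigma>\<^sup>2 / 2)"
  have "?w s \<le> 0"
  proof (rule barrier[of 0 s])
    fix r assume r: "0 \<le> r" "r \<le> s"
    then have "\<bar>r\<bar> < 1/5" using s by auto
    then show "(?w has_real_derivative (- r - g (z r))) (at r)"
      by (auto intro!: derivative_eq_intros slip_arc_deriv[OF z])
    show "(- r - g (z r)) \<le> 0" if "?w r > 0"
    proof -
      have "0 \<le> z r" using that zero_le_power2[of \<sigma>] adm by argo
      then show ?thesis using drag_nonneg[OF g, of "z r"] r by linarith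
    qed
  qed (use False slip_arc_rise_bound[OF g z D, of 0] adm in auto)
  then show ?thesis by simp
qed

text \<open>
  The drag never exceeds its value at the greatest possible height \<open>D + \<sigma>^2/2\<close>; with this constant drag the
  equation can be integrated explicitly.
\<close>

lemma slip_arc_lower:
  assumes g: "drag g" and z: "slip_arc g z" and D: "admissible D \<sigma>" "z (-\<sigma>) = D"
    and s: "-\<sigma> \<le> s" "s \<le> 1/10"
  shows "D + (s + \<sigma>) * ((\<sigma> - s) / 2 - 11/10 * (D + \<sigma>\<^sup>2 / 2)) \<le> z s"
proof -
  note adm = admissible_square[OF D(1)]
  define X where "X = D + \<sigma>\<^sup>2 / 2"
  have X: "0 \<le> X" using adm by (auto simp: X_def)
  let ?w = "\<lambda>s. D + (s + \<sigma>) * ((\<sigma> - s) / 2 - 11/10 * X) - z s"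
  have "?w s \<le> 0"
  proof (rule barrier[OF s(1)])
    fix r assume r: "-\<sigma> \<le> r" "r \<le> s"
    then have "\<bar>r\<bar> < 1/5" using s adm by auto
    then show "(?w has_real_derivative (- r - 11/10 * X) - (- r - g (z r))) (at r)"
      by (auto intro!: derivative_eq_intros slip_arc_deriv[OF z] simp: field_simps)
    have "z r \<le> X" unfolding X_def using r s by (intro slip_arc_max[OF g z D]) auto
    then show "(- r - 11/10 * X) - (- r - g (z r)) \<le> 0"
      using drag_upper[OF g X] drag_mono[OF g, of "z r" X] drag_zero[OF g] by auto
  qed (use D in auto)
  then show ?thesis unfolding X_def by simp
qed

lemma slip_arc_early:
  assumes g: "drag g" and z: "slip_arc g z" and D: "admissible D \<sigma>" "z (-\<sigma>) = D"
    and s: "-\<sigma> < s" "s \<le> \<sigma> / 2"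
  shows "z s > D"
proof -
  note adm = admissible_square[OF D(1)]
  have "(\<sigma> - s) / 2 - 11/10 * (D + \<sigma>\<^sup>2 / 2) > 0" using adm s by argo
  then have "(s + \<sigma>) * ((\<sigma> - s) / 2 - 11/10 * (D + \<sigma>\<^sup>2 / 2)) > 0" using s by simp
  moreover have "D + (s + \<sigma>) * ((\<sigma> - s) / 2 - 11/10 * (D + \<sigma>\<^sup>2 / 2)) \<le> z s"
    using adm s by (intro slip_arc_lower[OF g z D]) auto
  ultimately show ?thesis by argo
qed

lemma half_turn_exists:
  assumes g: "drag g" and D: "admissible D \<sigma>"
  obtains z \<sigma>' where "half_turn g D \<sigma> z \<sigma>'"
proof -
  note adm = admissible_square[OF D]
  have "\<bar>-\<sigma>\<bar> < 1/5" using adm by auto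
  then obtain z where z: "slip_arc g z" "z (-\<sigma>) = D"
    using slip_arc_exists[OF g, of "-\<sigma>" D] by metis
  \<comment> \<open>At \<open>s = 2 \<sigma>\<close> the energy bound would already force \<open>z < - D\<close>.\<close>
  have "\<exists>s. -\<sigma> \<le> s \<and> s \<le> 2 * \<sigma> \<and> z s \<le> - D"
  proof (rule ccontr)
    assume "\<not> ?thesis"
    then have above: "z s \<ge> - D" if "-\<sigma> \<le> s" "s \<le> 2 * \<sigma>" for s
      using that by (meson less_imp_le not_le)
    have "z (2*\<sigma>) + (2*\<sigma>)\<^sup>2/2 - 11/10 * D * (2*\<sigma>) \<le> z (-\<sigma>) + (-\<sigma>)\<^sup>2/2 - 11/10 * D * (-\<sigma>)"
      using adm by (intro slip_arc_fall[OF g z(1)] above) auto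
    then have "z (2*\<sigma>) \<le> D - 3/2 * \<sigma>\<^sup>2 + 33/10 * (D * \<sigma>)"
      using z(2) by (simp add: power_mult_distrib)
    moreover have "D * \<sigma> \<le> D * 1" using adm by (intro mult_left_mono) auto
    moreover have "z (2 * \<sigma>) \<ge> - D" using adm by (intro above) auto
    ultimately show False using adm by argo
  qed
  then obtain b where b: "-\<sigma> \<le> b" "b \<le> 2 * \<sigma>" "z b \<le> - D" by auto
  have cont: "continuous_on {-\<sigma>..b} z"
    using adm b by (intro slip_arc_continuous[OF z(1)]) auto
  have "z (-\<sigma>) > - D" using z(2) adm by simp
  then obtain e where e: "-\<sigma> < e" "e \<le> b" "z e = - D" "\<And>s. -\<sigma> \<le> s \<Longrightarrow> s < e \<Longrightarrow> z s > - D"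
    by (rule first_hit[OF b(1) cont _ b(3)]) blast
  have "half_turn g D \<sigma> z e"
    unfolding half_turn_def using e z b adm by auto
  then show ?thesis by (rule that)
qed

text \<open>
  The third and fourth claims are the two sides of the energy balance of a half-turn: at least \<open>2 D\<close> minus the
  greatest possible dissipation, and at most \<open>2 D\<close> plus what the drag returns below the axis.  The
  last claim drops the gain \<open>2 D\<close> and keeps only the loss.
\<close>

lemma half_turn_bounds:
  assumes g: "drag g" and D: "admissible D \<sigma>" and h: "half_turn g D \<sigma> z \<sigma>'"
  shows "\<sigma> / 2 < \<sigma>'" "\<sigma>' < 2 * \<sigma>"
    and "2 * D \<le> (\<sigma>' + \<sigma>) * ((\<sigma>' - \<sigma>) / 2 + 11/10 * (D + \<sigma>\<^sup>2 / 2))"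
    and "(\<sigma>' + \<sigma>) * ((\<sigma>' - \<sigma>) / 2 - 11/10 * D) \<le> 2 * D"
    and "\<sigma> - 1122/1000 * \<sigma>\<^sup>2 \<le> \<sigma>'"
proof -
  note adm = admissible_square[OF D]
  have z: "slip_arc g z" "z (-\<sigma>) = D" "z \<sigma>' = - D" "-\<sigma> < \<sigma>'" "\<sigma>' < 1/10"
    and above: "\<And>s. -\<sigma> \<le> s \<Longrightarrow> s < \<sigma>' \<Longrightarrow> z s > - D"
    using h by (auto simp: half_turn_def)
  show 1: "\<sigma> / 2 < \<sigma>'"
    using slip_arc_early[OF g z(1) D z(2,4)] z(3) adm by force
  have above': "z s \<ge> - D" if "-\<sigma> \<le> s" "s \<le> \<sigma>'" for s
    using above[of s] z(3) that by (cases "s = \<sigma>'") auto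
  show 2: "2 * D \<le> (\<sigma>' + \<sigma>) * ((\<sigma>' - \<sigma>) / 2 + 11/10 * (D + \<sigma>\<^sup>2 / 2))"
  proof -
    have "D + (\<sigma>' + \<sigma>) * ((\<sigma> - \<sigma>') / 2 - 11/10 * (D + \<sigma>\<^sup>2 / 2)) \<le> - D"
      using slip_arc_lower[OF g z(1) D z(2), of \<sigma>'] z by auto
    then show ?thesis by (simp add: field_simps)
  qed
  have "z \<sigma>' + \<sigma>'\<^sup>2/2 - 11/10 * D * \<sigma>' \<le> z (-\<sigma>) + (-\<sigma>)\<^sup>2/2 - 11/10 * D * (-\<sigma>)"
    using adm z by (intro slip_arc_fall[OF g z(1)] above') auto
  then show 3: "(\<sigma>' + \<sigma>) * ((\<sigma>' - \<sigma>) / 2 - 11/10 * D) \<le> 2 * D"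
    using z by (simp add: field_simps power2_eq_square)
  show "\<sigma>' < 2 * \<sigma>"
  proof (rule ccontr)
    assume "\<not> ?thesis"
    then have "(2*\<sigma> + \<sigma>) * ((2*\<sigma> - \<sigma>) / 2 - 11/10 * D) \<le> (\<sigma>' + \<sigma>) * ((\<sigma>' - \<sigma>) / 2 - 11/10 * D)"
      using adm by (intro mult_mono) auto
    moreover have "(2*\<sigma> + \<sigma>) * ((2*\<sigma> - \<sigma>) / 2 - 11/10 * D) = 3/2 * \<sigma>\<^sup>2 - 33/10 * (D * \<sigma>)"
      by (simp add: field_simps power2_eq_square)
    ultimately have "3/2 * \<sigma>\<^sup>2 - 33/10 * (D * \<sigma>) \<le> 2 * D" using 3 by argo
    moreover have "D * \<sigma> \<le> D * 1" using adm by (intro mult_left_mono) auto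
    ultimately show False using adm by argo
  qed
  show "\<sigma> - 1122/1000 * \<sigma>\<^sup>2 \<le> \<sigma>'"
  proof -
    have "0 < (\<sigma>' + \<sigma>) * ((\<sigma>' - \<sigma>) / 2 + 11/10 * (D + \<sigma>\<^sup>2 / 2))" using 2 adm by simp
    then have "0 < (\<sigma>' - \<sigma>) / 2 + 11/10 * (D + \<sigma>\<^sup>2 / 2)"
      using z(4) by (simp add: zero_less_mult_iff)
    then show ?thesis using adm by argo
  qed
qed

text \<open>
  An arc that crosses the upper line downwards passes directly to the lower line: its slip decreases at a
  rate of about \<open>a\<close>, so this takes less than the time \<open>a\<close>.  It serves for limit cycles whose initial torque is
  negative.
\<close>

lemma slip_arc_drop:
  assumes g: "drag g" and z: "slip_arc g z" and D: "admissible D a" and za: "z a = D"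
  obtains e where "a < e" "e < 2 * a" "z e = - D" "\<And>s. a \<le> s \<Longrightarrow> s < e \<Longrightarrow> z s > - D"
    "\<And>s. a \<le> s \<Longrightarrow> s \<le> e \<Longrightarrow> z s \<le> D"
proof -
  note adm = admissible_square[OF D]
  have mul: "D * a \<le> D * 1" using adm by (intro mult_left_mono) auto
  have "\<exists>s. a \<le> s \<and> s < 2 * a \<and> z s \<le> - D"
  proof (rule ccontr)
    assume no: "\<not> ?thesis"
    have above: "z s \<ge> - D" if "a \<le> s" "s \<le> 3/2 * a" for s
    proof (rule ccontr)
      assume "\<not> z s \<ge> - D"
      then have "z s \<le> - D" "s < 2 * a" using that adm by auto
      then show False using no that by blast
    qed
    have "z (3/2*a) + (3/2*a)\<^sup>2/2 - 11/10 * D * (3/2*a) \<le> z a + a\<^sup>2/2 - 11/10 * D * a"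
      using adm by (intro slip_arc_fall[OF g z(1)] above) auto
    then have "z (3/2*a) \<le> D - 5/8 * a\<^sup>2 + 11/20 * (D * a)"
      using za by (simp add: power_mult_distrib power_divide)
    moreover have "z (3/2 * a) \<ge> - D" using adm by (intro above) auto
    ultimately show False using adm mul by argo
  qed
  then obtain b where b: "a \<le> b" "b < 2 * a" "z b \<le> - D" by auto
  have cont: "continuous_on {a..b} z" using adm b by (intro slip_arc_continuous[OF z(1)]) auto
  have "z a > - D" using za adm by simp
  then obtain e where e: "a < e" "e \<le> b" "z e = - D" "\<And>s. a \<le> s \<Longrightarrow> s < e \<Longrightarrow> z s > - D"
    by (rule first_hit[OF b(1) cont _ b(3)]) blast
  have "z s \<le> D" if s: "a \<le> s" "s \<le> e" for s
  proof -
    have "z r \<ge> - D" if "a \<le> r" "r \<le> s" for r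
      using e(3) e(4)[of r] that s by (cases "r = e") auto
    then have "z s + s\<^sup>2/2 - 11/10 * D * s \<le> z a + a\<^sup>2/2 - 11/10 * D * a"
      using adm s b e by (intro slip_arc_fall[OF g z(1)]) auto
    then have "z s \<le> D - (s - a) * ((s + a) / 2 - 11/10 * D)"
      using za by (simp add: field_simps power2_eq_square)
    moreover have "(s - a) * ((s + a) / 2 - 11/10 * D) \<ge> 0"
      using adm s by (intro mult_nonneg_nonneg) auto
    ultimately show ?thesis by simp
  qed
  then show ?thesis using that e b by (metis le_less_trans)
qed

section \<open>The half-turn map is a contraction\<close>

text \<open>
  The gap \<open>w\<close> between the arcs is at most \<open>(\<tau> - \<sigma>) (\<tau> + \<sigma>)/2\<close> when the lower one starts, because the upper one
  lies below the drag-free parabola.  It then decays at relative rate \<open>9/10\<close>.  When the lower arc ends, the gap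
  bounds \<open>(\<tau>' - \<sigma>') ((\<tau>' + \<sigma>')/2 - 11/10 D)\<close>, because the upper arc still falls by that much.  So the
  decay factor \<open>1 + 9/10 (\<sigma> + \<sigma>')\<close>, about \<open>1 + 178/100 \<sigma>\<close>, competes with the loss of mean speed, which is at most
  a factor \<open>1 - 12/10 \<sigma>\<close> as long as \<open>\<tau>\<close> is not much larger than \<open>\<sigma>\<close>.
\<close>

lemma half_turn_contract_local:
  assumes g: "drag g" and D: "admissible D \<sigma>" "admissible D \<tau>"
    and h1: "half_turn g D \<sigma> z1 \<sigma>'" and h2: "half_turn g D \<tau> z2 \<tau>'"
    and le: "\<sigma> \<le> \<tau>" "\<tau> \<le> 21/20 * \<sigma>"
  shows "\<sigma>' \<le> \<tau>'" "\<tau>' - \<sigma>' \<le> (1 - 3/10 * \<sigma>) * (\<tau> - \<sigma>)"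
proof -
  note adm = admissible_square[OF D(1)] note adm2 = admissible_square[OF D(2)]
  note b1 = half_turn_bounds[OF g D(1) h1] note b2 = half_turn_bounds[OF g D(2) h2]
  have z1: "slip_arc g z1" "z1 (-\<sigma>) = D" "z1 \<sigma>' = - D" "-\<sigma> < \<sigma>'" "\<sigma>' < 1/10"
    and above1: "\<And>s. -\<sigma> \<le> s \<Longrightarrow> s < \<sigma>' \<Longrightarrow> z1 s > - D"
    using h1 by (auto simp: half_turn_def)
  have z2: "slip_arc g z2" "z2 (-\<tau>) = D" "z2 \<tau>' = - D" "-\<tau> < \<tau>'" "\<tau>' < 1/10"
    and above2: "\<And>s. -\<tau> \<le> s \<Longrightarrow> s < \<tau>' \<Longrightarrow> z2 s > - D"
    using h2 by (auto simp: half_turn_def)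
  have early2: "z2 s \<ge> D" if "-\<tau> \<le> s" "s \<le> -\<sigma>" for s
    using slip_arc_early[OF g z2(1) D(2) z2(2), of s] that adm adm2 z2(2) by (cases "s = -\<tau>") auto
  have order: "z1 s \<le> z2 s" if "-\<sigma> \<le> s" "s \<le> 1/10" for s
    using slip_arc_order[OF g z1(1) z2(1), of "-\<sigma>" s 0] early2[of "-\<sigma>"] that adm z1(2) le by auto
  have pos: "z2 s > - D" if "-\<tau> \<le> s" "s < \<sigma>'" for s
  proof (cases "s \<le> -\<sigma>")
    case True then show ?thesis using early2[OF that(1) True] adm by linarith
  next
    case False then show ?thesis using above1[of s] order[of s] that z1(5) by force
  qed
  show mono: "\<sigma>' \<le> \<tau>'"
    using pos[of \<tau>'] z2(3,4) by force
  define w0 where "w0 = z2 (-\<sigma>) - D"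
  define w1 where "w1 = z2 \<sigma>' + D"
  have w0: "w0 \<le> (\<tau> - \<sigma>) * (\<tau> + \<sigma>) / 2"
    using slip_arc_rise_bound[OF g z2(1) D(2) z2(2), of "-\<sigma>"] le adm
    unfolding w0_def by (simp add: field_simps power2_eq_square)
  \<comment> \<open>The gap between the two arcs shrinks at relative rate at least \<open>9/10\<close>.\<close>
  have w1: "w1 * (1 + 9/10 * (\<sigma> + \<sigma>')) \<le> w0"
  proof -
    let ?w = "\<lambda>s. (z2 s - z1 s) * (1 + 9/10 * (s + \<sigma>)) - w0"
    have "?w \<sigma>' \<le> 0"
    proof (rule barrier[of "-\<sigma>" \<sigma>'])
      fix s assume s: "-\<sigma> \<le> s" "s \<le> \<sigma>'"
      then have "\<bar>s\<bar> < 1/5" using adm z1 by auto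
      then show "(?w has_real_derivative ((- s - g (z2 s)) - (- s - g (z1 s))) * (1 + 9/10 * (s + \<sigma>)) + (z2 s - z1 s) * (9/10)) (at s)"
        by (auto intro!: derivative_eq_intros slip_arc_deriv[OF z1(1)] slip_arc_deriv[OF z2(1)])
      have o: "z1 s \<le> z2 s" using order s z1(5) by auto
      have "9/10 * (z2 s - z1 s) * 1 \<le> (g (z2 s) - g (z1 s)) * (1 + 9/10 * (s + \<sigma>))"
        using drag_mono[OF g o] o s by (intro mult_mono) auto
      then show "((- s - g (z2 s)) - (- s - g (z1 s))) * (1 + 9/10 * (s + \<sigma>)) + (z2 s - z1 s) * (9/10) \<le> 0"
        by (simp add: field_simps)
    qed (use z1 w0_def in auto)
    then show ?thesis using z1(3) by (simp add: w1_def algebra_simps)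
  qed
  have above2': "z2 s \<ge> - D" if "\<sigma>' \<le> s" "s \<le> \<tau>'" for s
    using above2[of s] z2(3) that z1(4) le by (cases "s = \<tau>'") auto
  have "z2 \<tau>' + \<tau>'\<^sup>2/2 - 11/10 * D * \<tau>' \<le> z2 \<sigma>' + \<sigma>'\<^sup>2/2 - 11/10 * D * \<sigma>'"
    using adm z2 z1 mono by (intro slip_arc_fall[OF g z2(1)] above2') auto
  then have fall: "(\<tau>' - \<sigma>') * ((\<tau>' + \<sigma>') / 2 - 11/10 * D) \<le> w1"
    using z2(3) unfolding w1_def by (simp add: field_simps power2_eq_square)
  define S where "S = (\<tau> + \<sigma>) / 2"
  have S: "\<sigma> \<le> S" "S > 0" using le adm by (auto simp: S_def)
  have "\<sigma>\<^sup>2 \<le> \<sigma> * S" using S adm by (simp add: power2_eq_square)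
  moreover have "\<tau>\<^sup>2 \<le> (21/20)\<^sup>2 * \<sigma>\<^sup>2"
    unfolding power_mult_distrib[symmetric] using le adm by (intro power_mono) auto
  ultimately have mid: "S * (1 - 12/10 * \<sigma>) \<le> (\<tau>' + \<sigma>') / 2 - 11/10 * D"
  proof -
    assume 1: "\<sigma>\<^sup>2 \<le> \<sigma> * S" and 2: "\<tau>\<^sup>2 \<le> (21/20)\<^sup>2 * \<sigma>\<^sup>2"
    have "S * (1 - 12/10 * \<sigma>) = S - 12/10 * (\<sigma> * S)" by (simp add: field_simps)
    moreover have "\<tau>\<^sup>2 \<le> 441/400 * \<sigma>\<^sup>2" using 2 by (simp add: power2_eq_square)
    moreover have "2 * S = \<tau> + \<sigma>" by (simp add: S_def)
    ultimately show ?thesis using 1 b1(5) b2(5) adm by argo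
  qed
  have "1 + 178/100 * \<sigma> \<le> 1 + 9/10 * (\<sigma> + \<sigma>')" using b1(5) adm by argo
  then have "(1 + 178/100 * \<sigma>) * (S * (1 - 12/10 * \<sigma>)) \<le> (1 + 9/10 * (\<sigma> + \<sigma>')) * ((\<tau>' + \<sigma>') / 2 - 11/10 * D)"
    using mid S adm by (intro mult_mono) auto
  moreover have "(1 + 178/100 * \<sigma>) * (S * (1 - 12/10 * \<sigma>)) = S * (1 + 58/100 * \<sigma> - 2136/1000 * \<sigma>\<^sup>2)"
    by (simp add: field_simps power2_eq_square)
  moreover have "S * (1 + 5/10 * \<sigma>) \<le> S * (1 + 58/100 * \<sigma> - 2136/1000 * \<sigma>\<^sup>2)"
  proof (rule mult_left_mono)
    show "1 + 5/10 * \<sigma> \<le> 1 + 58/100 * \<sigma> - 2136/1000 * \<sigma>\<^sup>2" using adm by argo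
  qed (use S in simp)
  ultimately have prod: "S * (1 + 5/10 * \<sigma>) \<le> (1 + 9/10 * (\<sigma> + \<sigma>')) * ((\<tau>' + \<sigma>') / 2 - 11/10 * D)"
    by linarith
  have "(\<tau>' - \<sigma>') * (S * (1 + 5/10 * \<sigma>)) \<le> (\<tau>' - \<sigma>') * ((1 + 9/10 * (\<sigma> + \<sigma>')) * ((\<tau>' + \<sigma>') / 2 - 11/10 * D))"
    using prod mono by (intro mult_left_mono) auto
  also have "\<dots> = ((\<tau>' - \<sigma>') * ((\<tau>' + \<sigma>') / 2 - 11/10 * D)) * (1 + 9/10 * (\<sigma> + \<sigma>'))"
    by (simp only: mult_ac)
  also have "\<dots> \<le> w1 * (1 + 9/10 * (\<sigma> + \<sigma>'))"
    using fall z1(4) by (intro mult_right_mono) auto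
  also have "\<dots> \<le> w0" by (rule w1)
  also have "\<dots> \<le> (\<tau> - \<sigma>) * S" using w0 by (simp add: S_def)
  finally have "S * ((\<tau>' - \<sigma>') * (1 + 5/10 * \<sigma>)) \<le> S * (\<tau> - \<sigma>)" by (simp only: mult_ac)
  then have "(\<tau>' - \<sigma>') * (1 + 5/10 * \<sigma>) \<le> \<tau> - \<sigma>" using S by (simp only: mult_le_cancel_left_pos)
  moreover have "\<tau> - \<sigma> \<le> (1 - 3/10 * \<sigma>) * (\<tau> - \<sigma>) * (1 + 5/10 * \<sigma>)"
  proof -
    have "1 \<le> (1 - 3/10 * \<sigma>) * (1 + 5/10 * \<sigma>)" using adm by (simp add: field_simps power2_eq_square)
    then have "1 * (\<tau> - \<sigma>) \<le> (1 - 3/10 * \<sigma>) * (1 + 5/10 * \<sigma>) * (\<tau> - \<sigma>)"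
      using le by (intro mult_right_mono) auto
    then show ?thesis by (simp only: mult_ac mult_1_left)
  qed
  ultimately have "(\<tau>' - \<sigma>') * (1 + 5/10 * \<sigma>) \<le> (1 - 3/10 * \<sigma>) * (\<tau> - \<sigma>) * (1 + 5/10 * \<sigma>)" by linarith
  then show "\<tau>' - \<sigma>' \<le> (1 - 3/10 * \<sigma>) * (\<tau> - \<sigma>)"
    using adm by (simp only: mult_le_cancel_right_pos[of "1 + 5/10 * \<sigma>"] add_pos_pos zero_less_one)
qed

lemma half_turn_unique:
  assumes "drag g" "admissible D \<sigma>" "half_turn g D \<sigma> z1 \<sigma>1" "half_turn g D \<sigma> z2 \<sigma>2"
  shows "\<sigma>1 = \<sigma>2"
  using half_turn_contract_local(1)[OF assms(1,2,2,3,4)] half_turn_contract_local(1)[OF assms(1,2,2,4,3)]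
    assms(2) by (auto simp: admissible_def)

definition half_map :: "(real \<Rightarrow> real) \<Rightarrow> real \<Rightarrow> real \<Rightarrow> real" where
  "half_map g D \<sigma> = (THE \<sigma>'. \<exists>z. half_turn g D \<sigma> z \<sigma>')"

lemma half_map_eq:
  assumes "drag g" "admissible D \<sigma>" "half_turn g D \<sigma> z \<sigma>'"
  shows "half_map g D \<sigma> = \<sigma>'"
  unfolding half_map_def using half_turn_unique[OF assms(1,2)] assms(3) by blast

lemma half_map_turn:
  assumes "drag g" "admissible D \<sigma>"
  obtains z where "half_turn g D \<sigma> z (half_map g D \<sigma>)"
  using half_turn_exists[OF assms] half_map_eq[OF assms] by metis

lemma admissible_up: "admissible D \<sigma> \<Longrightarrow> \<sigma> \<le> \<tau> \<Longrightarrow> \<tau> \<le> 1/100 \<Longrightarrow> admissible D \<tau>"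
  unfolding admissible_def by (meson less_imp_le less_le_trans order_trans power_mono)

text \<open>
  The local estimate is chained along a geometric sequence of ratio \<open>21/20\<close> from \<open>\<sigma>\<close> to \<open>\<tau>\<close>; each step
  contracts at least as strongly as the first.
\<close>

lemma half_map_contract:
  assumes g: "drag g" and D: "admissible D \<sigma>" and le: "\<sigma> \<le> \<tau>" "\<tau> \<le> 1/100"
  shows "half_map g D \<sigma> \<le> half_map g D \<tau>"
    and "half_map g D \<tau> - half_map g D \<sigma> \<le> (1 - 3/10 * \<sigma>) * (\<tau> - \<sigma>)"
proof -
  have chain: "half_map g D \<sigma> \<le> half_map g D \<tau> \<and>
      half_map g D \<tau> - half_map g D \<sigma> \<le> (1 - 3/10 * \<sigma>) * (\<tau> - \<sigma>)"
    if "admissible D \<sigma>" "\<sigma> \<le> \<tau>" "\<tau> \<le> 1/100" "\<tau> \<le> (21/20)^n * \<sigma>" for n \<tau> \<sigma>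
    using that
  proof (induction n arbitrary: \<tau>)
    case 0
    then have "\<tau> = \<sigma>" by simp
    then show ?case by simp
  next
    case (Suc n)
    have \<sigma>: "\<sigma> > 0" using Suc.prems(1) by (simp add: admissible_def)
    \<comment> \<open>The intermediate torque is one geometric step below \<open>\<tau>\<close>, but not below \<open>\<sigma>\<close>.\<close>
    define r where "r = max \<sigma> (20/21 * \<tau>)"
    have r: "\<sigma> \<le> r" "r \<le> \<tau>" "\<tau> \<le> 21/20 * r" using Suc.prems \<sigma> by (auto simp: r_def)
    have "\<sigma> \<le> (21/20)^n * \<sigma>" using \<sigma> one_le_power[of "21/20::real" n] by simp
    then have rn: "r \<le> (21/20)^n * \<sigma>" using Suc.prems(4) by (simp add: r_def)
    have adm: "admissible D r" "admissible D \<tau>"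
      using admissible_up[OF Suc.prems(1)] r Suc.prems by auto
    have 1: "half_map g D \<sigma> \<le> half_map g D r" "half_map g D r - half_map g D \<sigma> \<le> (1 - 3/10 * \<sigma>) * (r - \<sigma>)"
      using Suc.IH[OF Suc.prems(1) r(1) _ rn] r Suc.prems by auto
    obtain z1 z2 where h: "half_turn g D r z1 (half_map g D r)" "half_turn g D \<tau> z2 (half_map g D \<tau>)"
      using half_map_turn[OF g adm(1)] half_map_turn[OF g adm(2)] by metis
    note 2 = half_turn_contract_local[OF g adm h r(2,3)]
    have "(1 - 3/10 * r) * (\<tau> - r) \<le> (1 - 3/10 * \<sigma>) * (\<tau> - r)"
      using r by (intro mult_right_mono) auto
    moreover have "(1 - 3/10 * \<sigma>) * (\<tau> - r) + (1 - 3/10 * \<sigma>) * (r - \<sigma>) = (1 - 3/10 * \<sigma>) * (\<tau> - \<sigma>)"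
      by (simp add: field_simps)
    ultimately show ?case using 1 2 by linarith
  qed
  have "\<sigma> > 0" using D by (simp add: admissible_def)
  then obtain n where "\<tau> / \<sigma> < (21/20)^n" using real_arch_pow[of "21/20" "\<tau> / \<sigma>"] by auto
  then have "\<tau> \<le> (21/20)^n * \<sigma>" using \<open>\<sigma> > 0\<close> by (simp add: field_simps)
  from chain[OF D le this]
  show "half_map g D \<sigma> \<le> half_map g D \<tau>"
    "half_map g D \<tau> - half_map g D \<sigma> \<le> (1 - 3/10 * \<sigma>) * (\<tau> - \<sigma>)" by auto
qed

section \<open>Energy balance and the fixed point\<close>

text \<open>
  At this torque the gain \<open>2 D = 2 \<mu> lo^3\<close> exceeds the greatest possible loss, \<open>11/10 lo^3\<close> up to higher order.
\<close>

lemma half_map_start: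
  assumes g: "drag g" and D: "admissible D lo" "D = \<mu> * lo ^ 3" "\<mu> \<ge> 1"
  shows "lo < half_map g D lo" "half_map g D lo - lo \<le> 5 * \<mu> * lo\<^sup>2"
proof -
  note adm = admissible_square[OF D(1)]
  obtain z where z: "half_turn g D lo z (half_map g D lo)" using half_map_turn[OF g D(1)] .
  define h where "h = half_map g D lo"
  note b = half_turn_bounds[OF g D(1) z, folded h_def]
  have Dlo: "D * lo \<le> D / 100" using adm mult_left_mono[of lo "1/100" D] by simp
  have Dmu: "D = \<mu> * lo\<^sup>2 * lo" using D(2) by (simp add: power2_eq_square power3_eq_cube)
  show "lo < half_map g D lo"
  proof (rule ccontr)
    assume "\<not> ?thesis"
    then have h: "h \<le> lo" by (simp add: h_def)
    have "(h + lo) * ((h - lo) / 2 + 11/10 * (D + lo\<^sup>2 / 2)) \<le> (h + lo) * (11/10 * (D + lo\<^sup>2 / 2))"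
      by (intro mult_left_mono; use h b(1) adm in argo)
    also have "\<dots> \<le> (2 * lo) * (11/10 * (D + lo\<^sup>2 / 2))"
      by (intro mult_right_mono; use h b(1) adm in argo)
    also have "\<dots> = 22/10 * (D * lo) + 11/10 * lo ^ 3"
      by (simp add: field_simps power2_eq_square power3_eq_cube)
    finally have "2 * D \<le> 22/10 * (D * lo) + 11/10 * lo ^ 3" using b(3) by argo
    moreover have "1 * lo ^ 3 \<le> \<mu> * lo ^ 3" using D(3) adm by (intro mult_right_mono) auto
    ultimately show False using Dlo D(2) adm by argo
  qed
  then have h: "lo < h" by (simp add: h_def)
  show "half_map g D lo - lo \<le> 5 * \<mu> * lo\<^sup>2"
  proof (rule ccontr)
    assume "\<not> ?thesis"
    then have h5: "5 * (\<mu> * lo\<^sup>2) < h - lo" by (simp add: h_def)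
    have mulo: "0 < \<mu> * lo\<^sup>2" "D \<le> \<mu> * lo\<^sup>2 / 100"
      using D(3) adm mult_left_mono[of lo "1/100" "\<mu> * lo\<^sup>2"] unfolding Dmu by auto
    have "(2 * lo) * (5/2 * (\<mu> * lo\<^sup>2) - 11/10 * D) \<le> (h + lo) * ((h - lo) / 2 - 11/10 * D)"
      by (intro mult_mono; use h h5 adm mulo in argo)
    then have "(2 * lo) * (5/2 * (\<mu> * lo\<^sup>2) - 11/10 * D) \<le> 2 * D" using b(4) by argo
    moreover have "(2 * lo) * (5/2 * (\<mu> * lo\<^sup>2) - 11/10 * D) = 5 * (\<mu> * lo\<^sup>2 * lo) - 22/10 * (D * lo)"
      by (simp add: field_simps)
    ultimately show False using Dmu Dlo adm by argo
  qed
qed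

text \<open>
  The window of torques \<open>[lo, E]\<close> for which everything happens.  Its lower end is where \<open>D = \<mu> lo^3\<close>, the bound that
  limit cycles have to respect.  The factor \<open>1 + 20 \<mu>\<close> is explained by the next lemma.
\<close>

definition operating_range :: "real \<Rightarrow> real \<Rightarrow> real \<Rightarrow> real \<Rightarrow> bool" where
  "operating_range D \<mu> lo E \<longleftrightarrow> admissible D lo \<and> D = \<mu> * lo ^ 3 \<and> \<mu> \<ge> 1 \<and>
     (1 + 20 * \<mu>) * lo \<le> E \<and> E \<le> 1/100"

text \<open>
  The increment of the half-turn map is at most \<open>5 \<mu> lo^2\<close> at \<open>lo\<close>, and by contraction it decreases at rate at
  least \<open>3/10 lo\<close>.  At distance \<open>20 \<mu> lo\<close> from \<open>lo\<close> it has decreased by \<open>6 \<mu> lo^2\<close> and is negative.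
\<close>

lemma half_map_descends:
  assumes g: "drag g" and R: "operating_range D \<mu> lo E"
    and \<sigma>: "(1 + 20 * \<mu>) * lo \<le> \<sigma>" "\<sigma> \<le> E"
  shows "half_map g D \<sigma> < \<sigma>"
proof -
  have D: "admissible D lo" "D = \<mu> * lo ^ 3" "\<mu> \<ge> 1" and E: "E \<le> 1/100"
    using R by (auto simp: operating_range_def)
  note adm = admissible_square[OF D(1)]
  have "lo * 1 \<le> (1 + 20 * \<mu>) * lo"
    unfolding mult.commute[of lo] by (intro mult_right_mono) (use adm D(3) in auto)
  with \<sigma>(1) have lo: "lo \<le> \<sigma>" by (simp only: mult_1_right)
  have "half_map g D \<sigma> - half_map g D lo \<le> (1 - 3/10 * lo) * (\<sigma> - lo)"
    using E \<sigma> by (intro half_map_contract(2)[OF g D(1) lo]) auto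
  also have "\<dots> = (\<sigma> - lo) - 3/10 * lo * (\<sigma> - lo)" by (simp add: field_simps)
  finally have "half_map g D \<sigma> - \<sigma> \<le> (half_map g D lo - lo) - 3/10 * lo * (\<sigma> - lo)" by argo
  also have "\<dots> \<le> 5 * \<mu> * lo\<^sup>2 - 3/10 * lo * (20 * \<mu> * lo)"
    using half_map_start(2)[OF g D] \<sigma>(1) adm by (intro diff_mono mult_left_mono) (auto simp: algebra_simps)
  also have "\<dots> < 0" using D(3) adm by (simp add: power2_eq_square)
  finally show ?thesis by simp
qed

lemma half_map_range:
  assumes g: "drag g" and R: "operating_range D \<mu> lo E" and \<sigma>: "lo \<le> \<sigma>" "\<sigma> \<le> E"
  shows "admissible D \<sigma>" "lo < half_map g D \<sigma>" "half_map g D \<sigma> \<le> E"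
    and "\<sigma> \<le> (1 + 20 * \<mu>) * lo \<Longrightarrow> half_map g D \<sigma> < (1 + 20 * \<mu>) * lo"
proof -
  have D: "admissible D lo" "D = \<mu> * lo ^ 3" "\<mu> \<ge> 1" and E: "(1 + 20 * \<mu>) * lo \<le> E" "E \<le> 1/100"
    using R by (auto simp: operating_range_def)
  show adm: "admissible D \<sigma>" using admissible_up[OF D(1) \<sigma>(1)] \<sigma> E by auto
  show "lo < half_map g D \<sigma>"
    using half_map_start(1)[OF g D] half_map_contract(1)[OF g D(1) \<sigma>(1)] \<sigma> E by auto
  show low: "half_map g D \<sigma> < (1 + 20 * \<mu>) * lo" if "\<sigma> \<le> (1 + 20 * \<mu>) * lo"
    using half_map_contract(1)[OF g adm that] half_map_descends[OF g R order_refl E(1)] E by auto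
  show "half_map g D \<sigma> \<le> E"
    using low half_map_descends[OF g R _ \<sigma>(2)] E \<sigma> by (cases "\<sigma> \<le> (1 + 20 * \<mu>) * lo") auto
qed

lemma half_map_dist:
  assumes g: "drag g" and R: "operating_range D \<mu> lo E"
    and "lo \<le> \<sigma>" "\<sigma> \<le> E" "lo \<le> \<tau>" "\<tau> \<le> E"
  shows "\<bar>half_map g D \<sigma> - half_map g D \<tau>\<bar> \<le> (1 - 3/10 * lo) * \<bar>\<sigma> - \<tau>\<bar>"
proof -
  have D: "admissible D lo" and E: "E \<le> 1/100"
    using R by (auto simp: operating_range_def)
  note adm = admissible_square[OF D]
  have *: "\<bar>half_map g D x - half_map g D y\<bar> \<le> (1 - 3/10 * lo) * \<bar>x - y\<bar>"
    if "lo \<le> y" "y \<le> x" "x \<le> E" for x y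
  proof -
    have "admissible D y" using half_map_range(1)[OF g R] that by auto
    note c = half_map_contract[OF g this that(2)]
    have "(1 - 3/10 * y) * (x - y) \<le> (1 - 3/10 * lo) * (x - y)"
      using that by (intro mult_right_mono) auto
    then show ?thesis using c that E by auto
  qed
  show ?thesis
    using *[of \<tau> \<sigma>] *[of \<sigma> \<tau>] assms by (cases "\<sigma> \<le> \<tau>") (auto simp: abs_minus_commute)
qed

lemma full_turn_fixed_point:
  assumes g: "drag g1" "drag g2" and R: "operating_range D \<mu> lo E"
  obtains \<sigma> where "lo < \<sigma>" "\<sigma> < (1 + 20 * \<mu>) * lo" "half_map g2 D (half_map g1 D \<sigma>) = \<sigma>"
proof -
  define hi where "hi = (1 + 20 * \<mu>) * lo"
  have D: "admissible D lo" "\<mu> \<ge> 1" and E: "E \<le> 1/100" "hi \<le> E"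
    using R by (auto simp: operating_range_def hi_def)
  note adm = admissible_square[OF D(1)]
  have hi: "lo \<le> hi" using D adm by (simp add: hi_def)
  have r1: "lo < half_map g D x" "half_map g D x < hi" if "drag g" "x \<in> {lo..hi}" for g x
    using half_map_range(2,4)[OF that(1) R, of x] that(2) E unfolding hi_def by auto
  let ?P = "\<lambda>x. half_map g2 D (half_map g1 D x)"
  let ?c = "1 - 3/10 * lo"
  have c: "0 \<le> ?c" "?c < 1" using adm by auto
  have d: "\<bar>half_map g D x - half_map g D y\<bar> \<le> ?c * \<bar>x - y\<bar>"
    if "drag g" "x \<in> {lo..hi}" "y \<in> {lo..hi}" for g x y
    using half_map_dist[OF that(1) R, of x y] that E by auto
  have "\<exists>!x\<in>{lo..hi}. ?P x = x"
  proof (rule Banach_fix[OF _ _ c])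
    show "complete {lo..hi}" by (intro compact_imp_complete) auto
    show "{lo..hi} \<noteq> {}" using hi by auto
    show "?P ` {lo..hi} \<subseteq> {lo..hi}"
    proof (intro image_subsetI)
      fix x assume "x \<in> {lo..hi}"
      from r1[OF g(1) this] have "half_map g1 D x \<in> {lo..hi}" by simp
      from r1[OF g(2) this] show "?P x \<in> {lo..hi}" by simp
    qed
    show "dist (?P x) (?P y) \<le> ?c * dist x y" if "x \<in> {lo..hi}" "y \<in> {lo..hi}" for x y
    proof -
      have "half_map g1 D x \<in> {lo..hi}" "half_map g1 D y \<in> {lo..hi}"
        using r1[OF g(1) that(1)] r1[OF g(1) that(2)] by auto
      from d[OF g(2) this] have "\<bar>?P x - ?P y\<bar> \<le> ?c * \<bar>half_map g1 D x - half_map g1 D y\<bar>" .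
      also have "\<dots> \<le> ?c * (?c * \<bar>x - y\<bar>)" using d[OF g(1) that] c by (intro mult_left_mono) auto
      also have "\<dots> \<le> 1 * (?c * \<bar>x - y\<bar>)" using c by (intro mult_right_mono) auto
      finally show ?thesis by (simp add: dist_real_def)
    qed
  qed
  then obtain x where x: "x \<in> {lo..hi}" "?P x = x" by blast
  have "half_map g1 D x \<in> {lo..hi}" using r1[OF g(1) x(1)] by simp
  from r1[OF g(2) this] x(2) have "lo < x" "x < hi" by auto
  then show ?thesis using that x(2) unfolding hi_def by blast
qed

section \<open>Arcs near a reference arc\<close>

text \<open>
  Up to shortly before its end the reference arc \<open>Z\<close> has a positive distance from the lower line, so an arc close to
  it cannot end earlier; shortly after it, the neighbouring arc has been falling at speed at least \<open>\<sigma>/4\<close>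
  and must have ended.  In between the two arcs stay close because differences of arcs do not grow.
  The starting point may lie slightly outside the time range of the reference arc, so the points
  compared are not simultaneous.
\<close>

lemma half_turn_shadow:
  assumes g: "drag g" and D: "admissible D \<sigma>" and h: "half_turn g D \<sigma> Z \<sigma>'" and \<eta>: "\<eta> > 0"
  obtains \<delta> where "\<delta> > 0"
    "\<And>z s0 s. slip_arc g z \<Longrightarrow> z s0 > - D \<Longrightarrow> -\<sigma> \<le> s \<Longrightarrow> s < \<sigma>' \<Longrightarrow> \<bar>s0 - s\<bar> < \<delta> \<Longrightarrow>
       \<bar>z s0 - Z s\<bar> < \<delta> \<Longrightarrow>
       \<exists>e. s0 < e \<and> z e = - D \<and> \<bar>e - \<sigma>'\<bar> < \<eta> \<and> (\<forall>r. s0 \<le> r \<and> r < e \<longrightarrow> z r > - D \<and>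
         (\<exists>r'. -\<sigma> \<le> r' \<and> r' < \<sigma>' \<and> \<bar>r - r'\<bar> < \<eta> \<and> \<bar>z r - Z r'\<bar> < \<eta>))"
proof -
  note adm = admissible_square[OF D] note b = half_turn_bounds[OF g D h]
  have Z: "slip_arc g Z" "Z (-\<sigma>) = D" "Z \<sigma>' = - D" "-\<sigma> < \<sigma>'" "\<sigma>' < 1/10"
    and above: "\<And>s. -\<sigma> \<le> s \<Longrightarrow> s < \<sigma>' \<Longrightarrow> Z s > - D"
    using h by (auto simp: half_turn_def)
  have contZ: "continuous_on {-1/10..1/10} Z" by (rule slip_arc_continuous[OF Z(1)]) auto
  then have uc: "uniformly_continuous_on {-1/10..1/10} Z"
    by (rule compact_uniformly_continuous) simp
  have uc': "\<exists>d>0. \<forall>x\<in>{-1/10..1/10}. \<forall>y\<in>{-1/10..1/10}. \<bar>x - y\<bar> < d \<longrightarrow> \<bar>Z x - Z y\<bar> < \<epsilon>" if "\<epsilon> > 0" for \<epsilon>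
    using uc that unfolding uniformly_continuous_on_def dist_real_def by blast
  obtain d0 where d0: "d0 > 0" "\<And>x y. x \<in> {-1/10..1/10} \<Longrightarrow> y \<in> {-1/10..1/10} \<Longrightarrow> \<bar>x - y\<bar> < d0 \<Longrightarrow> \<bar>Z x - Z y\<bar> < \<eta>/2"
    using uc'[of "\<eta>/2"] \<eta> by auto
  define \<kappa> where "\<kappa> = Min {d0/3, \<eta>/3, \<sigma>/8}"
  have \<kappa>: "\<kappa> > 0" "\<kappa> \<le> d0/3" "\<kappa> \<le> \<eta>/3" "\<kappa> \<le> \<sigma>/8" using d0 \<eta> adm by (auto simp: \<kappa>_def)
  \<comment> \<open>Up to time \<open>\<sigma>' - \<kappa>\<close> the reference arc keeps a positive distance from the line.\<close>
  have "compact {-\<sigma>..\<sigma>' - \<kappa>}" "{-\<sigma>..\<sigma>' - \<kappa>} \<noteq> {}" using b(1) \<kappa> adm by auto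
  moreover have "continuous_on {-\<sigma>..\<sigma>' - \<kappa>} Z"
    using \<kappa> Z adm by (intro continuous_on_subset[OF contZ]) auto
  ultimately obtain m where m: "m \<in> {-\<sigma>..\<sigma>' - \<kappa>}" "\<And>s. s \<in> {-\<sigma>..\<sigma>' - \<kappa>} \<Longrightarrow> Z m \<le> Z s"
    using continuous_attains_inf[of "{-\<sigma>..\<sigma>' - \<kappa>}" Z] by blast
  have m_pos: "Z m + D > 0" using above[of m] m(1) \<kappa> by auto
  define \<omega> where "\<omega> = Min {(Z m + D)/4, \<kappa> * \<sigma> / 32, D/4, \<eta>/6}"
  have \<omega>: "\<omega> > 0" using m_pos \<kappa> adm \<eta> by (auto simp: \<omega>_def)
  have "\<omega> \<le> (Z m + D)/4" "\<omega> \<le> \<kappa> * \<sigma> / 32" "\<omega> \<le> D/4" "\<omega> \<le> \<eta>/6"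
    unfolding \<omega>_def by (intro Min_le; blast)+
  note \<omega> = \<omega> this
  obtain d1 where d1: "d1 > 0" "\<And>x y. x \<in> {-1/10..1/10} \<Longrightarrow> y \<in> {-1/10..1/10} \<Longrightarrow> \<bar>x - y\<bar> < d1 \<Longrightarrow> \<bar>Z x - Z y\<bar> < \<omega>"
    using uc'[of \<omega>] \<omega> by auto
  define \<delta> where "\<delta> = Min {d1, \<kappa>/2, \<omega>}"
  have \<delta>: "\<delta> > 0" "\<delta> \<le> d1" "\<delta> \<le> \<kappa>/2" "\<delta> \<le> \<omega>" using d1 \<kappa> \<omega> by (auto simp: \<delta>_def)
  show ?thesis
  proof (rule that[OF \<delta>(1)])
    fix z s0 s
    assume z: "slip_arc g z" "z s0 > - D" and s: "-\<sigma> \<le> s" "s < \<sigma>'"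
      and close: "\<bar>s0 - s\<bar> < \<delta>" "\<bar>z s0 - Z s\<bar> < \<delta>"
    have s0: "-\<sigma> - \<kappa>/2 < s0" "s0 < \<sigma>' + \<kappa>/2" "-\<sigma> - \<delta> < s0" "s0 < \<sigma>' + \<delta>" using s close \<delta> by auto
    have s0': "s0 \<in> {-1/10..1/10}" "s \<in> {-1/10..1/10}" using s0 \<kappa> b(2) adm s by auto
    have "\<bar>Z s0 - Z s\<bar> < \<omega>" using d1(2)[OF s0'] close \<delta> by auto
    then have zs0: "\<bar>z s0 - Z s0\<bar> \<le> 2 * \<omega>" using close \<delta> by auto
    have near: "\<bar>z r - Z r\<bar> \<le> 2 * \<omega>" if "s0 \<le> r" "r \<le> 1/10" for r
      using slip_arc_close[OF g z(1) Z(1), of s0 r "2*\<omega>"] zs0 that s0' by auto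
    define b where "b = \<sigma>' + \<kappa>"
    have b_le: "b \<le> 1/10" "s0 \<le> b" using b(2) \<kappa> adm s0 by (auto simp: b_def)
    have "\<exists>r. s0 \<le> r \<and> r \<le> b \<and> z r \<le> - D"
    proof (rule ccontr)
      assume no: "\<not> ?thesis"
      define a where "a = max s0 \<sigma>'"
      have a: "s0 \<le> a" "\<sigma>' \<le> a" "a < \<sigma>' + \<delta>" "a \<le> b - \<kappa>/2" using s0 \<delta> \<kappa> by (auto simp: a_def b_def)
      have "a \<in> {-1/10..1/10}" "\<sigma>' \<in> {-1/10..1/10}" using a b_le Z adm \<kappa> by auto
      then have "\<bar>Z a - Z \<sigma>'\<bar> < \<omega>" using d1(2)[of a \<sigma>'] a \<delta> by auto
      then have za: "z a \<le> - D + 3 * \<omega>" using near[of a] a b_le \<kappa> Z(3) by auto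
      have "z b + b\<^sup>2/2 - 11/10 * D * b \<le> z a + a\<^sup>2/2 - 11/10 * D * a"
      proof (rule slip_arc_fall[OF g z(1)])
        fix r assume "a \<le> r" "r \<le> b"
        then show "z r \<ge> - D" using no a by (meson less_imp_le not_le order_trans)
      qed (use a b_le \<kappa> s0 adm Z in auto)
      then have "z b \<le> z a - (b - a) * ((b + a) / 2 - 11/10 * D)"
        by (simp add: field_simps power2_eq_square)
      moreover have "\<kappa>/2 * (\<sigma>/4) \<le> (b - a) * ((b + a) / 2 - 11/10 * D)"
        by (intro mult_mono; use a b(1) \<kappa> adm in argo)
      ultimately have "z b \<le> - D + 3 * \<omega> - \<kappa> * \<sigma> / 8" using za by simp
      then have "z b \<le> - D" using \<omega> \<kappa> adm by simp
      then show False using no b_le by auto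
    qed
    then obtain b' where b': "s0 \<le> b'" "b' \<le> b" "z b' \<le> - D" by blast
    have cont: "continuous_on {s0..b'} z" using s0' b' b_le by (intro slip_arc_continuous[OF z(1)]) auto
    obtain e where e: "s0 < e" "e \<le> b'" "z e = - D" "\<And>r. s0 \<le> r \<Longrightarrow> r < e \<Longrightarrow> z r > - D"
      by (rule first_hit[OF b'(1) cont z(2) b'(3)]) blast
    have "\<sigma>' - \<kappa> \<le> e"
    proof (rule ccontr)
      assume "\<not> ?thesis"
      then have lt: "e < \<sigma>' - \<kappa>" by simp
      have ne: "\<bar>z e - Z e\<bar> \<le> 2 * \<omega>" using near[of e] e b' b_le by auto
      show False
      proof (cases "-\<sigma> \<le> e")
        case True
        then have "Z m \<le> Z e" using lt by (intro m(2)) auto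
        then show False using ne e(3) \<omega> m_pos by argo
      next
        case False
        have "e \<in> {-1/10..1/10}" "-\<sigma> \<in> {-1/10..1/10}" "\<bar>e - -\<sigma>\<bar> < d1"
          using False e s0 s0' adm \<delta> by auto
        then have "\<bar>Z e - D\<bar> < \<omega>" using d1(2)[of e "-\<sigma>"] Z(2) by auto
        then show False using ne e(3) \<omega> adm by argo
      qed
    qed
    then have e': "\<bar>e - \<sigma>'\<bar> \<le> \<kappa>" using e b' by (auto simp: b_def)
    have "\<exists>r'. -\<sigma> \<le> r' \<and> r' < \<sigma>' \<and> \<bar>r - r'\<bar> < \<eta> \<and> \<bar>z r - Z r'\<bar> < \<eta>" if r: "s0 \<le> r" "r < e" for r
    proof -
      define r' where "r' = max (-\<sigma>) (min r (\<sigma>' - \<kappa>))"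
      have r': "-\<sigma> \<le> r'" "r' < \<sigma>'" using \<kappa> Z by (auto simp: r'_def)
      have rr: "\<bar>r - r'\<bar> \<le> 2 * \<kappa>" using r e' s0 \<kappa> b(1) adm by (auto simp: r'_def)
      have "r \<in> {-1/10..1/10}" "r' \<in> {-1/10..1/10}" using r e b' b_le s0' r' Z(5) adm by auto
      then have "\<bar>Z r - Z r'\<bar> < \<eta>/2" using d0(2)[of r r'] rr \<kappa> d0(1) by auto
      moreover have "\<bar>z r - Z r\<bar> \<le> 2 * \<omega>" using near[of r] r e b' b_le by auto
      ultimately have "\<bar>z r - Z r'\<bar> < \<eta>" using \<omega>(5) \<eta> by argo
      then show ?thesis using r' rr \<kappa> \<eta> by (intro exI[of _ r']) auto
    qed
    then show "\<exists>e. s0 < e \<and> z e = - D \<and> \<bar>e - \<sigma>'\<bar> < \<eta> \<and> (\<forall>r. s0 \<le> r \<and> r < e \<longrightarrow> z r > - D \<and>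
         (\<exists>r'. -\<sigma> \<le> r' \<and> r' < \<sigma>' \<and> \<bar>r - r'\<bar> < \<eta> \<and> \<bar>z r - Z r'\<bar> < \<eta>))"
      using e e' \<kappa> \<eta> by (intro exI[of _ e]) auto
  qed
qed

section \<open>Affine changes of coordinates and the mirror symmetry\<close>

text \<open>
  Affine changes of slip, torque and time.  Negative \<open>A\<close> and \<open>B\<close> are allowed: they cover both the
  reflection that exchanges the two switching lines and the case of negative \<open>k\<close>.
\<close>

lemma abs_solution_affine:
  assumes sol: "abs_solution F F0 k l0 \<Delta> I l T u"
    and c: "c > 0" and A: "A \<noteq> 0" and B: "B \<noteq> 0"
    and rhs: "\<And>x y. - F' (A * x + a0) + F0' * (B * y + b0) = A / c * (- F x + F0 * y)"
    and k': "k' = B * k / c" and \<Delta>': "\<Delta>' = A * \<Delta>" and l0': "l0' = A * l0 + a0"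
  shows "abs_solution F' F0' k' l0' \<Delta>' {t. t / c \<in> I}
    (\<lambda>t. A * l (t / c) + a0) (\<lambda>t. B * T (t / c) + b0) (\<lambda>t. B * u (t / c) / c)"
proof -
  let ?I = "{t. t / c \<in> I}"
  have chain: "((\<lambda>t. x (t / c)) has_real_derivative x' / c) (at t within S)"
    if "(x has_real_derivative x') (at (t / c) within S')" "(\<lambda>t. t / c) ` S \<subseteq> S'" for x x' t S S'
  proof -
    have "((\<lambda>t. t / c) has_real_derivative 1 / c) (at t within S)"
      using c by (auto intro!: derivative_eq_intros)
    from DERIV_image_chain[OF has_field_derivative_subset[OF that] this]
    show ?thesis by (simp add: o_def)
  qed
  have hit: "A * x + a0 = l0' + s * \<Delta>' \<longleftrightarrow> x = l0 + s * \<Delta>" for x s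
  proof -
    have "A * x + a0 = l0' + s * \<Delta>' \<longleftrightarrow> A * (x - (l0 + s * \<Delta>)) = 0"
      unfolding l0' \<Delta>' by (auto simp: algebra_simps)
    then show ?thesis using A by simp
  qed
  note hits = hit[of _ 1, simplified] hit[of _ "-1", simplified]
  have L: "\<forall>t\<in>I. (l has_real_derivative (- F (l t) + F0 * T t)) (at t within I)"
    and Tc: "continuous_on I T"
    and Td: "\<forall>t\<in>I. (T has_real_derivative u t) (at t within (I \<inter> {t..}))"
    and R: "relay_rule k l0 \<Delta> I l u"
    and tr: "\<forall>t\<in>I. l t \<in> {l0 + \<Delta>, l0 - \<Delta>} \<longrightarrow> - F (l t) + F0 * T t \<noteq> 0"
    using sol by (auto simp: abs_solution_def)
  have "((\<lambda>t. A * l (t / c) + a0) has_real_derivative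
      (- F' (A * l (t / c) + a0) + F0' * (B * T (t / c) + b0))) (at t within ?I)" if "t \<in> ?I" for t
  proof -
    have "(l has_real_derivative (- F (l (t / c)) + F0 * T (t / c))) (at (t / c) within I)"
      using L that by auto
    then have "((\<lambda>t. l (t / c)) has_real_derivative (- F (l (t / c)) + F0 * T (t / c)) / c) (at t within ?I)"
      by (rule chain) auto
    from DERIV_add[OF DERIV_cmult[OF this, of A] DERIV_const[of a0]]
    have "((\<lambda>t. A * l (t / c) + a0) has_real_derivative A * ((- F (l (t / c)) + F0 * T (t / c)) / c) + 0) (at t within ?I)" .
    then show ?thesis unfolding rhs by simp
  qed
  moreover have "continuous_on ?I (\<lambda>t. B * T (t / c) + b0)"
    using c by (intro continuous_intros continuous_on_compose2[OF Tc]) auto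
  moreover have "((\<lambda>t. B * T (t / c) + b0) has_real_derivative B * u (t / c) / c) (at t within ?I \<inter> {t..})"
    if "t \<in> ?I" for t
  proof -
    have "(T has_real_derivative u (t / c)) (at (t / c) within I \<inter> {t / c..})"
      using Td that by auto
    then have "((\<lambda>t. T (t / c)) has_real_derivative u (t / c) / c) (at t within ?I \<inter> {t..})"
      by (rule chain) (use c in \<open>auto simp: divide_right_mono\<close>)
    from DERIV_add[OF DERIV_cmult[OF this, of B] DERIV_const[of b0]]
    have "((\<lambda>t. B * T (t / c) + b0) has_real_derivative B * (u (t / c) / c) + 0) (at t within ?I \<inter> {t..})" .
    then show ?thesis by simp
  qed
  moreover have "relay_rule k' l0' \<Delta>' ?I (\<lambda>t. A * l (t / c) + a0) (\<lambda>t. B * u (t / c) / c)"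
    unfolding relay_rule_def
  proof (intro conjI ballI impI)
    fix t assume t: "t \<in> ?I"
    then have "u (t / c) \<in> {- k, k}" using R by (auto simp: relay_rule_def)
    then show "B * u (t / c) / c \<in> {- k', k'}" using k' by auto
    show "B * u (t / c) / c = - k'" if "A * l (t / c) + a0 = l0' + \<Delta>'"
      using R t that unfolding relay_rule_def k' by (auto simp: hits)
    show "B * u (t / c) / c = k'" if "A * l (t / c) + a0 = l0' - \<Delta>'"
      using R t that unfolding relay_rule_def k' by (auto simp: hits)
  next
    fix s t assume st: "s \<in> ?I" "t \<in> ?I"
      and nohit: "s < t \<and> (\<forall>q\<in>{s<..t}. A * l (q / c) + a0 \<notin> {l0' + \<Delta>', l0' - \<Delta>'})"
    have "\<forall>q\<in>{s / c<..t / c}. l q \<notin> {l0 + \<Delta>, l0 - \<Delta>}"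
    proof
      fix q assume "q \<in> {s / c<..t / c}"
      then have "c * q \<in> {s<..t}" using c by (auto simp: field_simps)
      then have "A * l (c * q / c) + a0 \<notin> {l0' + \<Delta>', l0' - \<Delta>'}" using nohit by blast
      then show "l q \<notin> {l0 + \<Delta>, l0 - \<Delta>}" using c by (simp add: hits)
    qed
    moreover have "s / c < t / c" using nohit c by (auto simp: divide_strict_right_mono)
    ultimately have "u (t / c) = u (s / c)"
      using R st unfolding relay_rule_def by blast
    then show "B * u (t / c) / c = B * u (s / c) / c" by simp
  qed
  moreover have "- F' (A * l (t / c) + a0) + F0' * (B * T (t / c) + b0) \<noteq> 0"
    if "t \<in> ?I" "A * l (t / c) + a0 \<in> {l0' + \<Delta>', l0' - \<Delta>'}" for t
    using tr that A c unfolding rhs by (auto simp: hits)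
  ultimately show ?thesis unfolding abs_solution_def by blast
qed

text \<open>
  Changing the sign of both \<open>k\<close> and \<open>\<Delta>\<close> exchanges the names of the two switching lines only.
\<close>

lemma abs_solution_flip_sign:
  "abs_solution F F0 (- k) l0 (- \<Delta>) I l T u \<longleftrightarrow> abs_solution F F0 k l0 \<Delta> I l T u"
proof -
  have "relay_rule (- k) l0 (- \<Delta>) I l u \<longleftrightarrow> relay_rule k l0 \<Delta> I l u"
    unfolding relay_rule_def by (auto simp: insert_commute)
  then show ?thesis unfolding abs_solution_def by (simp add: insert_commute)
qed

lemma abs_solution_mirror:
  assumes "abs_solution f 1 1 0 D I l T u"
  shows "abs_solution (mirror f) 1 1 0 D I (\<lambda>t. - l t) (\<lambda>t. - T t) (\<lambda>t. - u t)"
proof -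
  have "abs_solution (mirror f) 1 (-1) 0 (-D) {t. t / 1 \<in> I}
      (\<lambda>t. (-1) * l (t / 1) + 0) (\<lambda>t. (-1) * T (t / 1) + 0) (\<lambda>t. (-1) * u (t / 1) / 1)"
    by (rule abs_solution_affine[OF assms]) (auto simp: mirror_def)
  then show ?thesis by (simp add: abs_solution_flip_sign[of _ _ 1])
qed

section \<open>Solutions follow arcs\<close>

text \<open>
  The usual mean value theorems ask for two-sided derivatives, but the control jumps at switchings.
  Subtracting a small slope \<open>e'\<close> makes the right derivative of the error negative, so that the error cannot
  become positive after its last zero.
\<close>

lemma linear_of_right_derivative:
  fixes T :: "real \<Rightarrow> real"
  assumes "a \<le> b" and cont: "continuous_on {a..b} T"
    and der: "\<And>t. a \<le> t \<Longrightarrow> t < b \<Longrightarrow> (T has_real_derivative v) (at t within {t..b})"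
  shows "T b = T a + v * (b - a)"
proof -
  have le: "s * (T b - T a - v * (b - a)) \<le> 0" if s: "s \<in> {-1, 1}" for s :: real
  proof (rule field_le_epsilon)
    fix e :: real assume e: "e > 0"
    define e' where "e' = e / (1 + (b - a))"
    have e': "e' > 0" "e' * (b - a) \<le> e" using e assms(1) by (auto simp: e'_def field_simps)
    let ?w = "\<lambda>t. s * (T t - T a - v * (t - a)) - e' * (t - a)"
    have "?w b \<le> 0"
    proof (rule ccontr)
      assume "\<not> ?w b \<le> 0"
      moreover have "continuous_on {a..b} ?w" by (intro continuous_intros cont)
      ultimately obtain q where q: "a \<le> q" "q < b" "?w q = 0" "\<And>t. q < t \<Longrightarrow> t \<le> b \<Longrightarrow> ?w t > 0"
        using last_nonpos_time[of a b ?w] assms(1) by auto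
      have wd: "(?w has_real_derivative - e') (at q within {q..b})"
        by (rule derivative_eq_intros der q refl | simp)+
      have "- e' < 0" using e' by simp
      from has_real_derivative_neg_dec_right[OF wd this]
      obtain d where d: "d > 0" "\<forall>h>0. q + h \<in> {q..b} \<longrightarrow> h < d \<longrightarrow> ?w q > ?w (q + h)"
        by (elim exE conjE) (rule that)
      define h where "h = min (d / 2) (b - q)"
      have "h > 0" "h < d" "q + h \<in> {q..b}" using d q by (auto simp: h_def)
      then have "?w (q + h) < ?w q" "?w (q + h) > 0" using d(2) q(4)[of "q + h"] by auto
      then show False using q(3) by linarith
    qed
    then show "s * (T b - T a - v * (b - a)) \<le> 0 + e" using e' by linarith
  qed
  from le[of 1] le[of "-1"] show ?thesis by simp
qed

text \<open>
  The right-hand sides agree only for \<open>\<bar>x\<bar> \<le> \<rho>\<close>, and it is the arc, not the solution \<open>X\<close>, that is known to stay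
  there.  At the last time of agreement \<open>X\<close> is on the arc, hence inside, and remains inside for a moment,
  during which the squared difference cannot grow.
\<close>

lemma slip_arc_unique_local:
  assumes g: "drag g" and z: "slip_arc g z" and ext: "\<And>x. \<bar>x\<bar> \<le> \<rho> \<Longrightarrow> f x = g x"
    and "a \<le> b" and rng: "-1/5 < a + c" "b + c < 1/5"
    and X: "\<And>r. a \<le> r \<Longrightarrow> r \<le> b \<Longrightarrow> (X has_real_derivative (- (r + c) - f (X r))) (at r within {a..b})"
    and small: "\<And>r. a \<le> r \<Longrightarrow> r \<le> b \<Longrightarrow> \<bar>z (r + c)\<bar> < \<rho>"
    and init: "X a = z (a + c)"
  shows "X b = z (b + c)"
proof (rule ccontr)
  assume ne: "X b \<noteq> z (b + c)"
  have zd: "((\<lambda>r. z (r + c)) has_real_derivative (- (r + c) - g (z (r + c)))) (at r within S)"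
    if "a \<le> r" "r \<le> b" for r S
  proof -
    have "\<bar>r + c\<bar> < 1/5" unfolding abs_less_iff using that rng by argo
    then have "(z has_real_derivative (- (r + c) - g (z (r + c)))) (at (r + c))"
      by (rule slip_arc_deriv[OF z])
    then have "((\<lambda>r. z (r + c)) has_real_derivative (- (r + c) - g (z (r + c)))) (at r)"
      by (simp add: DERIV_shift)
    then show ?thesis by (rule has_field_derivative_at_within)
  qed
  let ?w = "\<lambda>r. (X r - z (r + c))\<^sup>2"
  have Xc: "continuous_on {a..b} X" by (rule DERIV_continuous_on[OF X]) simp_all
  have "continuous_on {a..b} (\<lambda>r. z (r + c))" by (rule DERIV_continuous_on[OF zd]) simp_all
  then have wc: "continuous_on {a..b} ?w" by (intro continuous_intros Xc)
  obtain q where q: "a \<le> q" "q < b" "?w q = 0" "\<And>r. q < r \<Longrightarrow> r \<le> b \<Longrightarrow> ?w r > 0"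
    using last_nonpos_time[OF \<open>a \<le> b\<close> wc] ne init by auto
  have Xq: "\<bar>X q\<bar> < \<rho>" using q small[of q] by auto
  have "\<exists>d>0. \<forall>r\<in>{a..b}. dist r q < d \<longrightarrow> dist (X r) (X q) < \<rho> - \<bar>X q\<bar>"
  proof -
    have "q \<in> {a..b}" "0 < \<rho> - \<bar>X q\<bar>" using q Xq by auto
    then show ?thesis using Xc unfolding continuous_on_iff by blast
  qed
  then obtain d where d: "d > 0" "\<And>r. r \<in> {a..b} \<Longrightarrow> \<bar>r - q\<bar> < d \<Longrightarrow> \<bar>X r - X q\<bar> < \<rho> - \<bar>X q\<bar>"
    unfolding dist_real_def by blast
  define b' where "b' = min b (q + d / 2)"
  have b': "q < b'" "b' \<le> b" "b' < q + d" using q d by (auto simp: b'_def)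
  have "?w b' \<le> ?w q"
  proof (rule DERIV_nonpos_imp_decreasing_open[of q b'])
    fix r assume r: "q < r" "r < b'"
    have at: "at r within {a..b} = at r" using r q b' by (intro at_within_Icc_at) auto
    have Xr: "(X has_real_derivative (- (r + c) - f (X r))) (at r)" using X[of r] r q b' at by auto
    have "\<bar>X r\<bar> \<le> \<rho>" using d(2)[of r] r q b' by auto
    then have fg: "f (X r) = g (X r)" by (rule ext)
    have "(?w has_real_derivative (2 * (X r - z (r + c)) * ((- (r + c) - f (X r)) - (- (r + c) - g (z (r + c)))))) (at r)"
      by (rule derivative_eq_intros Xr zd refl | use r q b' in simp)+
    moreover have "(X r - z (r + c)) * (g (X r) - g (z (r + c))) \<ge> 0"
      using drag_mono[OF g, of "X r" "z (r + c)"] drag_mono[OF g, of "z (r + c)" "X r"]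
      by (cases "X r \<le> z (r + c)") (auto intro: mult_nonneg_nonneg mult_nonpos_nonpos)
    then have "2 * (X r - z (r + c)) * ((- (r + c) - f (X r)) - (- (r + c) - g (z (r + c)))) \<le> 0"
      unfolding fg by (simp add: algebra_simps)
    ultimately show "\<exists>y. (?w has_real_derivative y) (at r) \<and> y \<le> 0" by blast
  next
    show "continuous_on {q..b'} ?w" by (rule continuous_on_subset[OF wc]) (use q b' in auto)
  qed (use b' in simp)
  then show False using q(3) q(4)[of b'] b' by auto
qed

text \<open>
  Hits of the upper line only confirm the value \<open>-1\<close>, so the last such hit can be taken as the start of a
  time interval without any hit.
\<close>

lemma relay_keeps_value:
  assumes R: "relay_rule 1 0 D I l u" and I: "is_interval I" and st: "s \<in> I" "t \<in> I" "s \<le> t"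
    and l: "continuous_on I l" and us: "u s = - 1"
    and nohit: "\<And>q. s < q \<Longrightarrow> q \<le> t \<Longrightarrow> l q \<noteq> - D"
  shows "u t = - 1"
proof -
  have sub: "{s..t} \<subseteq> I" using I st by (meson atLeastAtMost_iff mem_is_interval_1_I subsetI)
  let ?S = "{s..t} \<inter> l -` {D}"
  have step: "u t = - 1" if q: "q \<in> {s..t}" "u q = - 1" "\<And>r. q < r \<Longrightarrow> r \<le> t \<Longrightarrow> l r \<noteq> D" for q
  proof (cases "q = t")
    case False
    then have "q < t" using q by auto
    moreover have "\<forall>r\<in>{q<..t}. l r \<notin> {0 + D, 0 - D}" using q nohit by auto
    ultimately have "u t = u q" using R q sub st unfolding relay_rule_def by blast
    then show ?thesis using q by simp
  qed (use q in simp)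
  show ?thesis
  proof (cases "?S = {}")
    case True
    then have "l r \<noteq> D" if "s < r" "r \<le> t" for r using that by (simp add: disjoint_iff)
    then show ?thesis using us st by (intro step[of s]) auto
  next
    case False
    have "closed ?S" using l sub by (intro continuous_closed_preimage continuous_on_subset[OF l]) auto
    then have "compact ?S" by (simp add: compact_eq_bounded_closed bounded_Int)
    then obtain q where q: "q \<in> ?S" "\<forall>r\<in>?S. r \<le> q" using compact_attains_sup False by blast
    have "u q = - 1" using R q(1) sub unfolding relay_rule_def by auto
    moreover have "l r \<noteq> D" if "q < r" "r \<le> t" for r
    proof
      assume "l r = D"
      then have "r \<in> ?S" using that q(1) by auto
      with q(2) that show False by force
    qed
    ultimately show ?thesis using q(1) by (intro step[of q]) auto
  qed
qed

text \<open>
  Up to the first possible switching the torque is linear and the slip solves the equation of the arc.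
\<close>

lemma solution_runs_free:
  assumes sol: "abs_solution f 1 1 0 D I l T u" and I: "is_interval I"
    and g: "drag g" and z: "slip_arc g z" and ext: "\<And>x. \<bar>x\<bar> \<le> \<rho> \<Longrightarrow> f x = g x"
    and t: "t0 \<in> I" "t \<in> I" "t0 \<le> t" and u0: "u t0 = - 1" and init: "z (- T t0) = l t0"
    and rng: "-1/5 < - T t0" "t - t0 - T t0 < 1/5"
    and small: "\<And>s. - T t0 \<le> s \<Longrightarrow> s \<le> t - t0 - T t0 \<Longrightarrow> \<bar>z s\<bar> < \<rho>"
    and nohit: "\<And>q. t0 < q \<Longrightarrow> q < t \<Longrightarrow> l q \<noteq> - D"
  shows "l t = z (t - t0 - T t0)" "T t = T t0 - (t - t0)"
proof -
  have sub: "{t0..t} \<subseteq> I" using I t by (meson atLeastAtMost_iff mem_is_interval_1_I subsetI)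
  have ld: "(l has_real_derivative (- f (l q) + 1 * T q)) (at q within I)" if "q \<in> I" for q
    using sol that by (auto simp: abs_solution_def)
  have lc: "continuous_on I l" using ld by (rule DERIV_continuous_on)
  have R: "relay_rule 1 0 D I l u" using sol by (simp add: abs_solution_def)
  have u: "u q = - 1" if "t0 \<le> q" "q < t" for q
    using that t sub nohit by (intro relay_keeps_value[OF R I t(1) _ that(1) lc u0]) auto
  have Tq: "T q = T t0 - (q - t0)" if q: "t0 \<le> q" "q \<le> t" for q
  proof -
    have "T q = T t0 + (-1) * (q - t0)"
    proof (rule linear_of_right_derivative[OF q(1)])
      show "continuous_on {t0..q} T"
        by (rule continuous_on_subset[of I]) (use sol sub q in \<open>auto simp: abs_solution_def\<close>)
      fix r assume r: "t0 \<le> r" "r < q"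
      then have "r \<in> I" using sub q by auto
      then have "(T has_real_derivative u r) (at r within I \<inter> {r..})"
        using sol unfolding abs_solution_def by blast
      then have "(T has_real_derivative u r) (at r within {r..q})"
        by (rule has_field_derivative_subset) (use sub q r in auto)
      then show "(T has_real_derivative -1) (at r within {r..q})" using u[of r] r q by simp
    qed
    then show ?thesis by simp
  qed
  show "T t = T t0 - (t - t0)" by (rule Tq[OF t(3) order_refl])
  have "l t = z (t + (- t0 - T t0))"
  proof (rule slip_arc_unique_local[OF g z ext t(3)])
    fix r assume r: "t0 \<le> r" "r \<le> t"
    have "(l has_real_derivative (- f (l r) + 1 * T r)) (at r within {t0..t})"
      by (rule has_field_derivative_subset[OF ld sub]) (use r sub in auto)
    then show "(l has_real_derivative - (r + (- t0 - T t0)) - f (l r)) (at r within {t0..t})"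
      using Tq[OF r] by (simp add: algebra_simps)
  next
    fix r assume "t0 \<le> r" "r \<le> t"
    then show "\<bar>z (r + (- t0 - T t0))\<bar> < \<rho>" by (intro small) auto
  qed (use rng init in auto)
  then show "l t = z (t - t0 - T t0)" by (simp add: algebra_simps)
qed

text \<open>
  If the solution hit the lower line before the arc does, it would have followed the arc up to its first
  such hit, where the arc is still above the line.
\<close>

lemma solution_follows_arc:
  assumes sol: "abs_solution f 1 1 0 D I l T u" and I: "is_interval I"
    and g: "drag g" and z: "slip_arc g z" and ext: "\<And>x. \<bar>x\<bar> \<le> \<rho> \<Longrightarrow> f x = g x"
    and t: "t0 \<in> I" "t \<in> I" "t0 \<le> t" and u0: "u t0 = - 1" and init: "z (- T t0) = l t0"
    and rng: "-1/5 < - T t0" "t - t0 - T t0 < 1/5"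
    and small: "\<And>s. - T t0 \<le> s \<Longrightarrow> s \<le> t - t0 - T t0 \<Longrightarrow> \<bar>z s\<bar> < \<rho>"
    and above: "\<And>s. - T t0 \<le> s \<Longrightarrow> s < t - t0 - T t0 \<Longrightarrow> z s > - D"
  shows "l t = z (t - t0 - T t0)" "T t = T t0 - (t - t0)"
    "z (t - t0 - T t0) > - D \<Longrightarrow> u t = - 1"
proof -
  have sub: "{t0..t} \<subseteq> I" using I t by (meson atLeastAtMost_iff mem_is_interval_1_I subsetI)
  have ld: "(l has_real_derivative (- f (l q) + 1 * T q)) (at q within I)" if "q \<in> I" for q
    using sol that by (auto simp: abs_solution_def)
  have lc: "continuous_on I l" using ld by (rule DERIV_continuous_on)
  have R: "relay_rule 1 0 D I l u" using sol by (simp add: abs_solution_def)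
  have nohit: "l q \<noteq> - D" if q: "t0 < q" "q < t" for q
  proof
    assume lq: "l q = - D"
    have cont: "continuous_on {t0..q} l" using sub q by (intro continuous_on_subset[OF lc]) auto
    have "l t0 > - D" using above[of "- T t0"] init q by auto
    then obtain e where e: "t0 < e" "e \<le> q" "l e = - D" "\<And>s. t0 \<le> s \<Longrightarrow> s < e \<Longrightarrow> l s > - D"
      using first_hit[OF _ cont, of "- D"] lq q by auto
    have "l e = z (e - t0 - T t0)"
    proof (rule solution_runs_free[OF sol I g z ext t(1) _ _ u0 init rng(1)])
      show "l r \<noteq> - D" if "t0 < r" "r < e" for r using e(4)[of r] that by auto
    qed (use e q sub rng(2) small in auto)
    then show False using above[of "e - t0 - T t0"] e q by auto
  qed
  show l: "l t = z (t - t0 - T t0)" and "T t = T t0 - (t - t0)"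
    by (rule solution_runs_free[OF sol I g z ext t u0 init rng small nohit]; assumption)+
  show "u t = - 1" if "z (t - t0 - T t0) > - D"
  proof (rule relay_keeps_value[OF R I t lc u0])
    show "l q \<noteq> - D" if "t0 < q" "q \<le> t" for q
      using nohit[of q] l \<open>z (t - t0 - T t0) > - D\<close> that by (cases "q = t") auto
  qed
qed

section \<open>The return to the switching line\<close>

text \<open>
  \<open>f\<close> is the drag of the normalised system and \<open>g\<close> its global extension; \<open>E\<^sup>2\<close> bounds the height of all arcs, so
  they see only the part of \<open>g\<close> that agrees with \<open>f\<close>.
\<close>

locale relay_system =
  fixes f g :: "real \<Rightarrow> real" and \<rho> D \<mu> lo E :: real
  assumes drag: "drag g" and ext: "\<And>x. \<bar>x\<bar> \<le> \<rho> \<Longrightarrow> f x = g x"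
    and range: "operating_range D \<mu> lo E" and small: "E\<^sup>2 < \<rho>"
begin

lemma mirror_system: "relay_system (mirror f) (mirror g) \<rho> D \<mu> lo E"
  by unfold_locales (auto simp: drag_mirror[OF drag] mirror_def ext range small)

lemma range_facts: "0 < lo" "0 < D" "E \<le> 1/100" "(1 + 20 * \<mu>) * lo \<le> E" "\<mu> \<ge> 1" "lo \<le> E" "0 < \<rho>"
proof -
  show *: "0 < lo" "0 < D" "E \<le> 1/100" "(1 + 20 * \<mu>) * lo \<le> E" "\<mu> \<ge> 1"
    using range by (auto simp: operating_range_def admissible_def)
  have "1 * lo \<le> (1 + 20 * \<mu>) * lo" using * by (intro mult_right_mono) auto
  with *(4) show "lo \<le> E" by linarith
  show "0 < \<rho>" using small zero_le_power2[of E] by linarith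
qed

lemma range_admissible: "lo \<le> \<sigma> \<Longrightarrow> \<sigma> \<le> E \<Longrightarrow> admissible D \<sigma>"
  using half_map_range(1)[OF drag range] .

lemma f_zero: "f 0 = 0"
  using ext[of 0] drag_zero[OF drag] range_facts by simp

lemma half_turn_small:
  assumes "drag g'" "lo \<le> \<sigma>" "\<sigma> \<le> E" "half_turn g' D \<sigma> z \<sigma>'" "-\<sigma> \<le> s" "s \<le> \<sigma>'"
  shows "\<bar>z s\<bar> \<le> E\<^sup>2" "-1/10 < s" "s < 1/10" "z s \<ge> - D"
proof -
  note adm = admissible_square[OF range_admissible[OF assms(2,3)]]
  have h: "slip_arc g' z" "z (-\<sigma>) = D" "z \<sigma>' = - D" "\<sigma>' < 1/10"
    and above: "\<And>s. -\<sigma> \<le> s \<Longrightarrow> s < \<sigma>' \<Longrightarrow> z s > - D"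
    using assms(4) by (auto simp: half_turn_def)
  show s: "-1/10 < s" "s < 1/10" using adm assms h by auto
  have "z s \<le> D + \<sigma>\<^sup>2 / 2"
    using s by (intro slip_arc_max[OF assms(1) h(1) range_admissible[OF assms(2,3)] h(2) assms(5)]) auto
  moreover show low: "z s \<ge> - D" using above[of s] h assms by (cases "s = \<sigma>'") auto
  moreover have "\<sigma>\<^sup>2 \<le> E\<^sup>2" using adm assms by (intro power_mono) auto
  ultimately show "\<bar>z s\<bar> \<le> E\<^sup>2"
    unfolding abs_le_iff using adm zero_le_power2[of \<sigma>] by argo
qed

text \<open>
  At the end of the arc only slip and torque are asserted: the control has already switched there.
\<close>

lemma arc_phase:
  assumes sol: "abs_solution f 1 1 0 D I l T u" and I: "is_interval I"
    and z: "slip_arc g z" and t0: "t0 \<in> I" "u t0 = - 1" "z (- T t0) = l t0"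
    and e: "-1/5 < - T t0" "- T t0 \<le> e" "e < 1/5" "z e = - D"
    and bd: "\<And>s. - T t0 \<le> s \<Longrightarrow> s \<le> e \<Longrightarrow> \<bar>z s\<bar> < \<rho>"
    and above: "\<And>s. - T t0 \<le> s \<Longrightarrow> s < e \<Longrightarrow> z s > - D"
  shows "t \<in> I \<Longrightarrow> t0 \<le> t \<Longrightarrow> t < t0 + T t0 + e \<Longrightarrow>
      l t = z (t - t0 - T t0) \<and> T t = - (t - t0 - T t0) \<and> u t = - 1"
    and "t0 + T t0 + e \<in> I \<Longrightarrow> l (t0 + T t0 + e) = - D \<and> T (t0 + T t0 + e) = - e"
proof -
  show "l t = z (t - t0 - T t0) \<and> T t = - (t - t0 - T t0) \<and> u t = - 1"
    if t: "t \<in> I" "t0 \<le> t" "t < t0 + T t0 + e"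
  proof -
    have 1: "t - t0 - T t0 < 1/5" using t e by linarith
    have 2: "\<bar>z s\<bar> < \<rho>" if "- T t0 \<le> s" "s \<le> t - t0 - T t0" for s
      using that t by (intro bd) auto
    have 3: "z s > - D" if "- T t0 \<le> s" "s \<le> t - t0 - T t0" for s
      using that t by (intro above) auto
    note F = solution_follows_arc[OF sol I drag z ext t0(1) t(1,2) t0(2,3) e(1) 1]
    have "l t = z (t - t0 - T t0)" by (rule F(1)) (use 2 3 in auto)
    moreover have "T t = T t0 - (t - t0)" by (rule F(2)) (use 2 3 in auto)
    moreover have "u t = - 1" by (rule F(3)) (use 2 3 t in auto)
    ultimately show ?thesis by simp
  qed
  show "l (t0 + T t0 + e) = - D \<and> T (t0 + T t0 + e) = - e" if t: "t0 + T t0 + e \<in> I"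
  proof -
    have 0: "t0 \<le> t0 + T t0 + e" using e by linarith
    have 1: "t0 + T t0 + e - t0 - T t0 < 1/5" using e by linarith
    note F = solution_follows_arc[OF sol I drag z ext t0(1) t 0 t0(2,3) e(1) 1]
    have "l (t0 + T t0 + e) = z (t0 + T t0 + e - t0 - T t0)" by (rule F(1)) (use bd above in auto)
    moreover have "T (t0 + T t0 + e) = T t0 - (t0 + T t0 + e - t0)" by (rule F(2)) (use bd above in auto)
    ultimately show ?thesis using e(4) by simp
  qed
qed

lemma half_turn_phase:
  assumes sol: "abs_solution f 1 1 0 D I l T u" and I: "is_interval I"
    and t0: "t0 \<in> I" "l t0 = D" "T t0 = \<sigma>" and \<sigma>: "lo \<le> \<sigma>" "\<sigma> \<le> E" and h: "half_turn g D \<sigma> z \<sigma>'"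
  shows "t \<in> I \<Longrightarrow> t0 \<le> t \<Longrightarrow> t < t0 + \<sigma> + \<sigma>' \<Longrightarrow>
      l t = z (t - t0 - \<sigma>) \<and> T t = - (t - t0 - \<sigma>) \<and> u t = - 1"
    and "t0 + \<sigma> + \<sigma>' \<in> I \<Longrightarrow> l (t0 + \<sigma> + \<sigma>') = - D \<and> T (t0 + \<sigma> + \<sigma>') = - \<sigma>'"
proof -
  note adm = admissible_square[OF range_admissible[OF \<sigma>]]
  have z: "slip_arc g z" "z (-\<sigma>) = D" "z \<sigma>' = - D" "-\<sigma> < \<sigma>'" "\<sigma>' < 1/10"
    and above: "\<And>s. -\<sigma> \<le> s \<Longrightarrow> s < \<sigma>' \<Longrightarrow> z s > - D"
    using h by (auto simp: half_turn_def)
  have u0: "u t0 = - 1" using sol t0 by (auto simp: abs_solution_def relay_rule_def)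
  have bd: "\<bar>z s\<bar> < \<rho>" if "-\<sigma> \<le> s" "s \<le> \<sigma>'" for s
    using half_turn_small(1)[OF drag \<sigma> h that] small by linarith
  have A: "z (- T t0) = l t0" "-1/5 < - T t0" "- T t0 \<le> \<sigma>'" "\<sigma>' < 1/5"
    using z t0 adm by auto
  note F = arc_phase[OF sol I z(1) t0(1) u0 A z(3), unfolded t0(3)]
  show "l t = z (t - t0 - \<sigma>) \<and> T t = - (t - t0 - \<sigma>) \<and> u t = - 1"
    if "t \<in> I" "t0 \<le> t" "t < t0 + \<sigma> + \<sigma>'"
    by (rule F(1)) (use bd above that in auto)
  show "l (t0 + \<sigma> + \<sigma>') = - D \<and> T (t0 + \<sigma> + \<sigma>') = - \<sigma>'" if "t0 + \<sigma> + \<sigma>' \<in> I"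
    by (rule F(2)) (use bd above that in auto)
qed

lemma full_turn:
  assumes sol: "abs_solution f 1 1 0 D I l T u" and I: "is_interval I"
    and t0: "t0 \<in> I" "l t0 = D" "T t0 = \<sigma>" and \<sigma>: "lo \<le> \<sigma>" "\<sigma> \<le> E"
    and h1: "half_turn g D \<sigma> z1 \<sigma>'" and h2: "half_turn (mirror g) D \<sigma>' z2 \<sigma>''"
  shows "t \<in> I \<Longrightarrow> t0 \<le> t \<Longrightarrow> t < t0 + \<sigma> + \<sigma>' \<Longrightarrow>
      l t = z1 (t - t0 - \<sigma>) \<and> T t = - (t - t0 - \<sigma>) \<and> u t = - 1"
    and "t \<in> I \<Longrightarrow> t0 + \<sigma> + \<sigma>' \<le> t \<Longrightarrow> t < t0 + \<sigma> + \<sigma>' + \<sigma>' + \<sigma>'' \<Longrightarrow>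
      l t = - z2 (t - (t0 + \<sigma> + \<sigma>') - \<sigma>') \<and> T t = t - (t0 + \<sigma> + \<sigma>') - \<sigma>' \<and> u t = 1"
    and "t0 + \<sigma> + \<sigma>' + \<sigma>' + \<sigma>'' \<in> I \<Longrightarrow>
      l (t0 + \<sigma> + \<sigma>' + \<sigma>' + \<sigma>'') = D \<and> T (t0 + \<sigma> + \<sigma>' + \<sigma>' + \<sigma>'') = \<sigma>''"
proof -
  interpret m: relay_system "mirror f" "mirror g" \<rho> D \<mu> lo E by (rule mirror_system)
  have eq: "half_map g D \<sigma> = \<sigma>'" by (rule half_map_eq[OF drag range_admissible[OF \<sigma>] h1])
  have \<sigma>': "lo \<le> \<sigma>'" "\<sigma>' \<le> E" using half_map_range(2,3)[OF drag range \<sigma>] unfolding eq by auto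
  note b1 = half_turn_bounds[OF drag range_admissible[OF \<sigma>] h1]
  note b2 = half_turn_bounds[OF m.drag range_admissible[OF \<sigma>'] h2]
  define t1 where "t1 = t0 + \<sigma> + \<sigma>'"
  have t01: "t0 \<le> t1" using b1 \<sigma> \<sigma>' range_facts by (auto simp: t1_def)
  show "l t = z1 (t - t0 - \<sigma>) \<and> T t = - (t - t0 - \<sigma>) \<and> u t = - 1"
    if "t \<in> I" "t0 \<le> t" "t < t0 + \<sigma> + \<sigma>'"
    by (rule half_turn_phase(1)[OF sol I t0 \<sigma> h1 that])
  have turn: "l t1 = - D \<and> T t1 = - \<sigma>'" if "t1 \<in> I"
    using half_turn_phase(2)[OF sol I t0 \<sigma> h1] that unfolding t1_def by blast
  have t1I: "t1 \<in> I" if "t \<in> I" "t1 \<le> t" for t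
    using I t0(1) that t01 by (meson mem_is_interval_1_I)
  have M: "(t \<in> I \<longrightarrow> t1 \<le> t \<longrightarrow> t < t1 + \<sigma>' + \<sigma>'' \<longrightarrow>
      - l t = z2 (t - t1 - \<sigma>') \<and> - T t = - (t - t1 - \<sigma>') \<and> - u t = - 1) \<and>
      (t1 + \<sigma>' + \<sigma>'' \<in> I \<longrightarrow> - l (t1 + \<sigma>' + \<sigma>'') = - D \<and> - T (t1 + \<sigma>' + \<sigma>'') = - \<sigma>'')" if "t1 \<in> I" for t
  proof -
    have "- l t1 = D" "- T t1 = \<sigma>'" using turn[OF that] by auto
    note F = m.half_turn_phase[OF abs_solution_mirror[OF sol] I that this \<sigma>' h2]
    from F show ?thesis by blast
  qed
  show "l t = - z2 (t - (t0 + \<sigma> + \<sigma>') - \<sigma>') \<and> T t = t - (t0 + \<sigma> + \<sigma>') - \<sigma>' \<and> u t = 1"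
    if "t \<in> I" "t0 + \<sigma> + \<sigma>' \<le> t" "t < t0 + \<sigma> + \<sigma>' + \<sigma>' + \<sigma>''"
    using M[of t] t1I[of t] that unfolding t1_def by force
  show "l (t0 + \<sigma> + \<sigma>' + \<sigma>' + \<sigma>'') = D \<and> T (t0 + \<sigma> + \<sigma>' + \<sigma>' + \<sigma>'') = \<sigma>''"
    if "t0 + \<sigma> + \<sigma>' + \<sigma>' + \<sigma>'' \<in> I"
  proof -
    have "t1 \<in> I" using t1I[OF that] b1 b2 \<sigma> \<sigma>' range_facts by (auto simp: t1_def)
    from M[OF this] that show ?thesis unfolding t1_def by force
  qed
qed

text \<open>
  A property of single times holds forever if it holds during each full turn that starts from an
  invariant set \<open>A\<close> of crossing torques.  Full turns take at least the time \<open>lo\<close>, so they exhaust the time axis.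
\<close>

lemma recurrence:
  assumes sol: "abs_solution f 1 1 0 D I l T u" and I: "is_interval I"
    and A: "\<And>\<sigma>. \<sigma> \<in> A \<Longrightarrow> lo \<le> \<sigma> \<and> \<sigma> \<le> E \<and> half_map (mirror g) D (half_map g D \<sigma>) \<in> A"
    and Q: "\<And>t0 t \<sigma>. t0 \<in> I \<Longrightarrow> l t0 = D \<Longrightarrow> T t0 \<in> A \<Longrightarrow> \<sigma> = T t0 \<Longrightarrow> t \<in> I \<Longrightarrow> t0 \<le> t \<Longrightarrow>
        t < t0 + \<sigma> + half_map g D \<sigma> + half_map g D \<sigma> + half_map (mirror g) D (half_map g D \<sigma>) \<Longrightarrow> Q t"
    and t0: "t0 \<in> I" "l t0 = D" "T t0 \<in> A" and t: "t \<in> I" "t0 \<le> t"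
  shows "Q t"
proof -
  have "Q t" if "t0 \<in> I" "l t0 = D" "T t0 \<in> A" "t0 \<le> t" "t - t0 \<le> real n * lo" for n t0
    using that
  proof (induction n arbitrary: t0)
    case (Suc n)
    interpret m: relay_system "mirror f" "mirror g" \<rho> D \<mu> lo E by (rule mirror_system)
    define \<sigma> where "\<sigma> = T t0"
    define \<sigma>' where "\<sigma>' = half_map g D \<sigma>"
    define \<sigma>'' where "\<sigma>'' = half_map (mirror g) D \<sigma>'"
    have \<sigma>: "lo \<le> \<sigma>" "\<sigma> \<le> E" "\<sigma>'' \<in> A"
      using A[OF Suc.prems(3)] by (auto simp: \<sigma>_def \<sigma>'_def \<sigma>''_def)
    have \<sigma>': "lo \<le> \<sigma>'" "\<sigma>' \<le> E" using half_map_range(2,3)[OF drag range \<sigma>(1,2)] by (auto simp: \<sigma>'_def)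
    have \<sigma>'': "lo \<le> \<sigma>''" using half_map_range(2)[OF m.drag range \<sigma>'] by (auto simp: \<sigma>''_def)
    obtain z1 where z1: "half_turn g D \<sigma> z1 \<sigma>'"
      using half_map_turn[OF drag range_admissible[OF \<sigma>(1,2)]] unfolding \<sigma>'_def by blast
    obtain z2 where z2: "half_turn (mirror g) D \<sigma>' z2 \<sigma>''"
      using half_map_turn[OF m.drag range_admissible[OF \<sigma>']] unfolding \<sigma>''_def by blast
    define t2 where "t2 = t0 + \<sigma> + \<sigma>' + \<sigma>' + \<sigma>''"
    show ?case
    proof (cases "t < t2")
      case True
      then show ?thesis
        using Suc.prems t(1) by (intro Q[of t0 \<sigma> t]) (auto simp: t2_def \<sigma>_def \<sigma>'_def \<sigma>''_def)
    next
      case False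
      then have le: "t2 \<le> t" "t0 + lo \<le> t2" using \<sigma> \<sigma>' \<sigma>'' range_facts(1) by (auto simp: t2_def)
      then have t2: "t2 \<in> I"
        using I Suc.prems(1) t(1) range_facts(1) by (intro mem_is_interval_1_I[OF I Suc.prems(1) t(1)]) auto
      have "l t2 = D \<and> T t2 = \<sigma>''"
        using full_turn(3)[OF sol I Suc.prems(1,2) _ \<sigma>(1,2) z1 z2] t2 by (simp add: t2_def \<sigma>_def)
      moreover have "t - t2 \<le> real n * lo" using Suc.prems(5) le by (simp add: algebra_simps)
      ultimately show ?thesis using \<sigma>(3) t2 le by (intro Suc.IH) auto
    qed
  next
    case 0
    then have "t = t0" by simp
    interpret m: relay_system "mirror f" "mirror g" \<rho> D \<mu> lo E by (rule mirror_system)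
    have a: "lo \<le> T t0" "T t0 \<le> E" using A[OF 0(3)] by auto
    have b: "lo \<le> half_map g D (T t0)" "half_map g D (T t0) \<le> E"
      using half_map_range(2,3)[OF drag range a] by auto
    have c: "lo \<le> half_map (mirror g) D (half_map g D (T t0))"
      using half_map_range(2)[OF m.drag range b] by auto
    show ?case
      using 0 a b c t range_facts(1) \<open>t = t0\<close> by (intro Q[of t0 "T t0" t]) auto
  qed
  moreover obtain n where "(t - t0) / lo < real n" using reals_Archimedean2 by blast
  then have "t - t0 \<le> real n * lo" using range_facts(1) by (simp add: field_simps)
  ultimately show ?thesis using t0 t by blast
qed

end

section \<open>The periodic solution\<close>

lemma has_real_derivative_glue:
  assumes "(X has_real_derivative d) (at t within {a..t})" "(X has_real_derivative d) (at t within {t..b})"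
    and "a < t" "t < b"
  shows "(X has_real_derivative d) (at t)"
proof -
  have "(X has_real_derivative d) (at t within {a..t} \<union> {t..b})"
    using assms(1,2) unfolding has_field_derivative_iff by (rule Lim_within_Un[THEN iffD2, OF conjI])
  moreover have "{a..t} \<union> {t..b} = {a..b}" using assms by auto
  moreover have "at t within {a..b} = at t" using assms by (intro at_within_Icc_at)
  ultimately show ?thesis by simp
qed

lemma continuous_glue:
  fixes X :: "real \<Rightarrow> real"
  assumes "continuous_on {a..t} X" "continuous_on {t..b} X" and "a < t" "t < b"
  shows "isCont X t"
proof -
  have "continuous_on ({a..t} \<union> {t..b}) X" using assms by (intro continuous_on_closed_Un) auto
  moreover have "{a..t} \<union> {t..b} = {a..b}" using assms by auto
  ultimately show ?thesis using assms by (intro continuous_on_interior[of "{a..b}"]) auto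
qed

text \<open>
  The upper line is met only at the start, at speed about \<open>\<sigma>\<close> upwards, and later than \<open>s = \<sigma>/2\<close>, at speed
  about \<open>s\<close> downwards; the drag at the line is negligible against both.
\<close>

lemma half_turn_transversal:
  assumes g: "drag g" and D: "admissible D \<sigma>" and h: "half_turn g D \<sigma> z \<sigma>'"
    and s: "-\<sigma> \<le> s" "s < \<sigma>'" "z s = D"
  shows "- s - g (z s) \<noteq> 0"
proof -
  note adm = admissible_square[OF D]
  have z: "slip_arc g z" "z (-\<sigma>) = D" using h by (auto simp: half_turn_def)
  have gD: "0 \<le> g D" "g D \<le> 11/10 * D"
    using drag_nonneg[OF g, of D] drag_upper[OF g, of 0 D] drag_zero[OF g] adm by auto
  have "s = -\<sigma> \<or> \<sigma>/2 < s" using slip_arc_early[OF g z(1) D z(2), of s] s by force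
  then show ?thesis using gD s(3) adm by auto
qed

text \<open>
  A fixed point \<open>\<sigma>\<close> of the return map with its two arcs.  The second arc lives in mirrored coordinates.
\<close>

locale relay_cycle_system = relay_system +
  fixes \<sigma> \<sigma>' :: real and z1 z2 :: "real \<Rightarrow> real"
  assumes \<sigma>: "lo < \<sigma>" "\<sigma> < (1 + 20 * \<mu>) * lo"
    and turn1: "half_turn g D \<sigma> z1 \<sigma>'" and turn2: "half_turn (mirror g) D \<sigma>' z2 \<sigma>"
begin

definition cycle_set :: "(real \<times> real \<times> real) set" where
  "cycle_set = (\<lambda>s. (z1 s, - s, - 1)) ` {-\<sigma>..<\<sigma>'} \<union> (\<lambda>s. (- z2 s, s, 1)) ` {-\<sigma>'..<\<sigma>}"

lemma \<sigma>_range: "lo \<le> \<sigma>" "\<sigma> \<le> E"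
  using \<sigma> range_facts by auto

lemma half_map_\<sigma>: "half_map g D \<sigma> = \<sigma>'"
  by (rule half_map_eq[OF drag range_admissible[OF \<sigma>_range] turn1])

lemma \<sigma>'_range: "lo < \<sigma>'" "\<sigma>' < (1 + 20 * \<mu>) * lo" "lo \<le> \<sigma>'" "\<sigma>' \<le> E"
  using half_map_range(2,3,4)[OF drag range \<sigma>_range] \<sigma> unfolding half_map_\<sigma> by auto

lemma half_map_\<sigma>': "half_map (mirror g) D \<sigma>' = \<sigma>"
  by (rule half_map_eq[OF drag_mirror[OF drag] range_admissible[OF \<sigma>'_range(3,4)] turn2])

lemma mirror_cycle_system: "relay_cycle_system (mirror f) (mirror g) \<rho> D \<mu> lo E \<sigma>' \<sigma> z2 z1"
proof -
  interpret m: relay_system "mirror f" "mirror g" \<rho> D \<mu> lo E by (rule mirror_system)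
  show ?thesis by unfold_locales (auto simp: \<sigma>'_range turn1 turn2)
qed

text \<open>
  Both half-turns take the same time \<open>\<sigma> + \<sigma>'\<close>, since the torque sweeps the same interval; hence the index of the
  current half-turn is a floor.
\<close>

definition half_period :: real where "half_period = \<sigma> + \<sigma>'"

lemma half_period_pos: "half_period > 0"
  using \<sigma> \<sigma>'_range range_facts by (auto simp: half_period_def)

text \<open>The \<open>n\<close>-th half-turn, as functions of the time \<open>r\<close> elapsed since the \<open>n\<close>-th switching.\<close>

definition piece_l :: "int \<Rightarrow> real \<Rightarrow> real" where
  "piece_l n r = (if even n then z1 (r - \<sigma>) else - z2 (r - \<sigma>'))"

definition piece_T :: "int \<Rightarrow> real \<Rightarrow> real" where
  "piece_T n r = (if even n then \<sigma> - r else r - \<sigma>')"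

definition cyc_l :: "real \<Rightarrow> real" where "cyc_l t = piece_l \<lfloor>t / half_period\<rfloor> (t - \<lfloor>t / half_period\<rfloor> * half_period)"
definition cyc_T :: "real \<Rightarrow> real" where "cyc_T t = piece_T \<lfloor>t / half_period\<rfloor> (t - \<lfloor>t / half_period\<rfloor> * half_period)"
definition cyc_u :: "real \<Rightarrow> real" where "cyc_u t = (if even \<lfloor>t / half_period\<rfloor> then - 1 else 1)"

lemma floor_half_period: "\<lfloor>t / half_period\<rfloor> = n \<longleftrightarrow> n * half_period \<le> t \<and> t < n * half_period + half_period"
  using half_period_pos by (auto simp: floor_eq_iff field_simps)

text \<open>
  The closed interval matters: at its right end the next piece has already taken over, and the two pieces
  agree there.
\<close>

lemma cyc_piece:
  fixes n :: int
  assumes "n * half_period \<le> t" "t \<le> n * half_period + half_period"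
  shows "cyc_l t = piece_l n (t - n * half_period)" "cyc_T t = piece_T n (t - n * half_period)"
    "t < n * half_period + half_period \<Longrightarrow> cyc_u t = (if even n then - 1 else 1)"
proof -
  have ends: "z1 (-\<sigma>) = D" "z1 \<sigma>' = - D" "z2 (-\<sigma>') = D" "z2 \<sigma> = - D"
    using turn1 turn2 by (auto simp: half_turn_def)
  show "cyc_u t = (if even n then - 1 else 1)" if "t < n * half_period + half_period"
    using assms that by (simp add: cyc_u_def floor_half_period[THEN iffD2])
  have "cyc_l t = piece_l n (t - n * half_period) \<and> cyc_T t = piece_T n (t - n * half_period)"
  proof (cases "t = n * half_period + half_period")
    case True
    then have "\<lfloor>t / half_period\<rfloor> = n + 1" using half_period_pos by (subst floor_half_period) (auto simp: algebra_simps)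
    then show ?thesis using True ends
      by (auto simp: cyc_l_def cyc_T_def piece_l_def piece_T_def half_period_def algebra_simps)
  next
    case False
    then have "\<lfloor>t / half_period\<rfloor> = n" using assms by (subst floor_half_period) auto
    then show ?thesis by (simp add: cyc_l_def cyc_T_def)
  qed
  then show "cyc_l t = piece_l n (t - n * half_period)" "cyc_T t = piece_T n (t - n * half_period)" by auto
qed

lemma piece_l_deriv:
  assumes "0 \<le> r" "r \<le> half_period"
  shows "(piece_l n has_real_derivative (- f (piece_l n r) + piece_T n r)) (at r)"
proof (cases "even n")
  case True
  have s: "-\<sigma> \<le> r - \<sigma>" "r - \<sigma> \<le> \<sigma>'" using assms by (auto simp: half_period_def)
  note b = half_turn_small[OF drag \<sigma>_range turn1 s]
  have "f (z1 (r - \<sigma>)) = g (z1 (r - \<sigma>))" using b small by (intro ext) auto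
  moreover have "\<bar>r - \<sigma>\<bar> < 1/5" unfolding abs_less_iff using b by argo
  then have "(z1 has_real_derivative (- (r - \<sigma>) - g (z1 (r - \<sigma>)))) (at (r + (- \<sigma>)))"
    using slip_arc_deriv[of g z1 "r - \<sigma>"] turn1 by (simp add: half_turn_def)
  then have "((\<lambda>r. z1 (r + (- \<sigma>))) has_real_derivative (- (r - \<sigma>) - g (z1 (r - \<sigma>)))) (at r)"
    unfolding DERIV_shift .
  ultimately show ?thesis using True by (simp add: piece_l_def[abs_def] piece_T_def algebra_simps)
next
  case False
  interpret m: relay_system "mirror f" "mirror g" \<rho> D \<mu> lo E by (rule mirror_system)
  have s: "-\<sigma>' \<le> r - \<sigma>'" "r - \<sigma>' \<le> \<sigma>" using assms by (auto simp: half_period_def)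
  note b = half_turn_small[OF m.drag \<sigma>'_range(3,4) turn2 s]
  have "f (- z2 (r - \<sigma>')) = g (- z2 (r - \<sigma>'))" using b small by (intro ext) auto
  then have fg: "f (- z2 (r - \<sigma>')) = - mirror g (z2 (r - \<sigma>'))" by (simp add: mirror_def)
  have "\<bar>r - \<sigma>'\<bar> < 1/5" unfolding abs_less_iff using b by argo
  then have "(z2 has_real_derivative (- (r - \<sigma>') - mirror g (z2 (r - \<sigma>')))) (at (r + (- \<sigma>')))"
    using slip_arc_deriv[of "mirror g" z2 "r - \<sigma>'"] turn2 by (simp add: half_turn_def)
  then have "((\<lambda>r. z2 (r + (- \<sigma>'))) has_real_derivative (- (r - \<sigma>') - mirror g (z2 (r - \<sigma>')))) (at r)"
    unfolding DERIV_shift .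
  from DERIV_minus[OF this] show ?thesis using False fg
    by (simp add: piece_l_def[abs_def] piece_T_def algebra_simps)
qed

lemma piece_T_deriv: "(piece_T n has_real_derivative (if even n then - 1 else 1)) (at r)"
  unfolding piece_T_def[abs_def] by (auto intro!: derivative_eq_intros)

lemma piece_shift:
  assumes "(p has_real_derivative v) (at (t - c))"
  shows "((\<lambda>t. p (t - c)) has_real_derivative v) (at t within S)"
proof -
  have "(p has_real_derivative v) (at (t + (- c)))" using assms by simp
  then have "((\<lambda>t. p (t + (- c))) has_real_derivative v) (at t)" unfolding DERIV_shift .
  then show ?thesis by (auto intro: has_field_derivative_at_within)
qed

lemma cyc_l_deriv_piece:
  fixes n :: int
  assumes "n * half_period \<le> t" "t \<le> n * half_period + half_period"
  shows "(cyc_l has_real_derivative (- f (cyc_l t) + cyc_T t)) (at t within {n * half_period..n * half_period + half_period})"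
proof -
  have "((\<lambda>t. piece_l n (t - n * half_period)) has_real_derivative
      (- f (piece_l n (t - n * half_period)) + piece_T n (t - n * half_period))) (at t within {n * half_period..n * half_period + half_period})"
    using assms by (intro piece_shift piece_l_deriv) auto
  then have "((\<lambda>t. piece_l n (t - n * half_period)) has_real_derivative
      (- f (cyc_l t) + cyc_T t)) (at t within {n * half_period..n * half_period + half_period})"
    using cyc_piece[OF assms] by simp
  then show ?thesis
    by (rule has_field_derivative_transform_within[of _ _ _ _ 1]) (use assms cyc_piece in auto)
qed

lemma cyc_T_cont_piece:
  fixes n :: int
  shows "continuous_on {n * half_period..n * half_period + half_period} cyc_T"
proof -
  have "continuous_on {n * half_period..n * half_period + half_period} (\<lambda>t. piece_T n (t - n * half_period))"
    unfolding piece_T_def by (cases "even n") (auto intro!: continuous_intros)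
  then show ?thesis by (rule continuous_on_eq) (use cyc_piece in auto)
qed

lemma cyc_l_deriv: "(cyc_l has_real_derivative (- f (cyc_l t) + cyc_T t)) (at t)"
  and cyc_T_cont: "isCont cyc_T t"
proof -
  define n where "n = \<lfloor>t / half_period\<rfloor>"
  have n: "n * half_period \<le> t" "t < n * half_period + half_period" using floor_half_period[of t n] by (auto simp: n_def)
  have "(cyc_l has_real_derivative (- f (cyc_l t) + cyc_T t)) (at t) \<and> isCont cyc_T t"
  proof (cases "t = n * half_period")
    case False
    then have "at t within {n * half_period..n * half_period + half_period} = at t" using n by (intro at_within_Icc_at) auto
    moreover have "isCont cyc_T t"
      using n False by (intro continuous_on_interior[OF cyc_T_cont_piece[of n]]) auto
    moreover have "(cyc_l has_real_derivative (- f (cyc_l t) + cyc_T t)) (at t within {n * half_period..n * half_period + half_period})"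
      using n by (intro cyc_l_deriv_piece) auto
    ultimately show ?thesis by metis
  next
    case True
    define tp where "tp = real_of_int (n - 1) * half_period"
    have "tp + half_period = t" unfolding tp_def True by (simp add: algebra_simps)
    note e' = tp_def[symmetric] this True[symmetric]
    have lt: "tp < t" "t < t + half_period" using \<open>tp + half_period = t\<close> half_period_pos by auto
    have "(cyc_l has_real_derivative (- f (cyc_l t) + cyc_T t)) (at t)"
    proof (rule has_real_derivative_glue[OF _ _ lt])
      show "(cyc_l has_real_derivative - f (cyc_l t) + cyc_T t) (at t within {tp..t})"
        using cyc_l_deriv_piece[of "n - 1" t, unfolded e'] lt by (metis less_imp_le order_refl)
      show "(cyc_l has_real_derivative - f (cyc_l t) + cyc_T t) (at t within {t..t + half_period})"
        using cyc_l_deriv_piece[of n t, unfolded e'] lt by (metis less_imp_le order_refl)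
    qed
    moreover have "isCont cyc_T t"
      by (rule continuous_glue[OF cyc_T_cont_piece[of "n - 1", unfolded e'] cyc_T_cont_piece[of n, unfolded e'] lt])
    ultimately show ?thesis by (rule conjI)
  qed
  then show "(cyc_l has_real_derivative (- f (cyc_l t) + cyc_T t)) (at t)" "isCont cyc_T t" by auto
qed

lemma cyc_T_right_deriv: "(cyc_T has_real_derivative cyc_u t) (at t within {t..})"
proof -
  define n where "n = \<lfloor>t / half_period\<rfloor>"
  have n: "n * half_period \<le> t" "t < n * half_period + half_period" using floor_half_period[of t n] by (auto simp: n_def)
  have "((\<lambda>t. piece_T n (t - n * half_period)) has_real_derivative cyc_u t) (at t within {t..})"
    using cyc_piece(3)[of n t] n piece_T_deriv[of n] by (intro piece_shift) auto
  then show ?thesis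
    by (rule has_field_derivative_transform_within[of _ _ _ _ "n * half_period + half_period - t"])
       (use n cyc_piece(2)[of n] in \<open>auto simp: dist_real_def\<close>)
qed

lemma cyc_switching:
  fixes n :: int
  assumes "n * half_period \<le> t" "t < n * half_period + half_period" "even n"
  shows "cyc_l t > - D" "cyc_l t = D \<Longrightarrow> - f (cyc_l t) + cyc_T t \<noteq> 0"
proof -
  define s where "s = t - n * half_period - \<sigma>"
  have s: "-\<sigma> \<le> s" "s < \<sigma>'" using assms by (auto simp: s_def half_period_def)
  have l: "cyc_l t = z1 s" "cyc_T t = - s"
    using cyc_piece(1,2)[of n t] assms by (auto simp: piece_l_def piece_T_def s_def)
  show "cyc_l t > - D" using turn1 s l by (auto simp: half_turn_def)
  have "f (z1 s) = g (z1 s)"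
    using half_turn_small(1)[OF drag \<sigma>_range turn1, of s] s small by (intro ext) auto
  then show "- f (cyc_l t) + cyc_T t \<noteq> 0" if "cyc_l t = D"
    using half_turn_transversal[OF drag range_admissible[OF \<sigma>_range] turn1 s] that l by auto
qed

lemma cyc_switching_odd:
  fixes n :: int
  assumes "n * half_period \<le> t" "t < n * half_period + half_period" "odd n"
  shows "cyc_l t < D" "cyc_l t = - D \<Longrightarrow> - f (cyc_l t) + cyc_T t \<noteq> 0"
proof -
  interpret m: relay_system "mirror f" "mirror g" \<rho> D \<mu> lo E by (rule mirror_system)
  define s where "s = t - n * half_period - \<sigma>'"
  have s: "-\<sigma>' \<le> s" "s < \<sigma>" using assms by (auto simp: s_def half_period_def)
  have l: "cyc_l t = - z2 s" "cyc_T t = s"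
    using cyc_piece(1,2)[of n t] assms by (auto simp: piece_l_def piece_T_def s_def)
  show "cyc_l t < D" using turn2 s l by (auto simp: half_turn_def)
  have "mirror f (z2 s) = mirror g (z2 s)"
    using half_turn_small(1)[OF m.drag \<sigma>'_range(3,4) turn2, of s] s small by (intro m.ext) auto
  then have "f (- z2 s) = - mirror g (z2 s)" by (simp add: mirror_def)
  then show "- f (cyc_l t) + cyc_T t \<noteq> 0" if "cyc_l t = - D"
    using half_turn_transversal[OF m.drag range_admissible[OF \<sigma>'_range(3,4)] turn2 s] that l by auto
qed

lemma cyc_node:
  fixes n :: int
  shows "cyc_l (n * half_period) = (if even n then D else - D)"
  using cyc_piece(1)[of n "n * half_period"] turn1 turn2 half_period_pos by (auto simp: piece_l_def half_turn_def)

lemma cycle_solution: "abs_solution f 1 1 0 D {0..} cyc_l cyc_T cyc_u"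
proof -
  have D: "D > 0" using range_facts by simp
  have fl: "\<lfloor>t / half_period\<rfloor> * half_period \<le> t" "t < \<lfloor>t / half_period\<rfloor> * half_period + half_period" for t using floor_half_period[of t "\<lfloor>t / half_period\<rfloor>"] by auto
  have hit1: "cyc_u t = - 1" if "cyc_l t = D" for t
    using cyc_switching_odd(1)[OF fl] that by (auto simp: cyc_u_def)
  have hit2: "cyc_u t = 1" if "cyc_l t = - D" for t
    using cyc_switching(1)[OF fl] that by (force simp: cyc_u_def)
  have keep: "cyc_u t = cyc_u s" if "s < t" "\<forall>q\<in>{s<..t}. cyc_l q \<notin> {0 + D, 0 - D}" for s t
  proof -
    have "\<lfloor>t / half_period\<rfloor> \<le> \<lfloor>s / half_period\<rfloor>"
    proof (rule ccontr)
      assume "\<not> ?thesis"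
      then have "\<lfloor>s / half_period\<rfloor> + 1 \<le> \<lfloor>t / half_period\<rfloor>" by simp
      then have "real_of_int (\<lfloor>s / half_period\<rfloor> + 1) * half_period \<le> \<lfloor>t / half_period\<rfloor> * half_period"
        using half_period_pos by (intro mult_right_mono) linarith+
      then have "\<lfloor>t / half_period\<rfloor> * half_period \<in> {s<..t}" using fl[of s] fl[of t] by (auto simp: algebra_simps)
      then have "cyc_l (\<lfloor>t / half_period\<rfloor> * half_period) \<notin> {0 + D, 0 - D}" using that by blast
      then show False by (auto simp: cyc_node split: if_splits)
    qed
    moreover have "\<lfloor>s / half_period\<rfloor> \<le> \<lfloor>t / half_period\<rfloor>" using that half_period_pos by (intro floor_mono divide_right_mono) auto
    ultimately show ?thesis by (simp add: cyc_u_def)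
  qed
  have trans: "- f (cyc_l t) + cyc_T t \<noteq> 0" if "cyc_l t \<in> {D, - D}" for t
  proof (cases "even \<lfloor>t / half_period\<rfloor>")
    case True
    then show ?thesis using cyc_switching[OF fl] that by force
  next
    case False
    then show ?thesis using cyc_switching_odd[OF fl] that by force
  qed
  show ?thesis
    unfolding abs_solution_def relay_rule_def
  proof (intro conjI ballI impI)
    show "continuous_on {0..} cyc_T" using cyc_T_cont by (intro continuous_at_imp_continuous_on) auto
    show "(cyc_l has_real_derivative - f (cyc_l t) + 1 * cyc_T t) (at t within {0..})" for t
      using cyc_l_deriv by (auto intro: has_field_derivative_at_within)
    show "(cyc_T has_real_derivative cyc_u t) (at t within {0..} \<inter> {t..})" for t
      by (rule has_field_derivative_subset[OF cyc_T_right_deriv]) auto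
    show "cyc_u t \<in> {- 1, 1}" for t by (auto simp: cyc_u_def)
    show "cyc_u t = - 1" if "cyc_l t = 0 + D" for t using hit1 that by simp
    show "cyc_u t = 1" if "cyc_l t = 0 - D" for t using hit2 that by simp
    show "cyc_u t = cyc_u s" if "s < t \<and> (\<forall>q\<in>{s<..t}. cyc_l q \<notin> {0 + D, 0 - D})" for s t
      using keep that by blast
    show "- f (cyc_l t) + 1 * cyc_T t \<noteq> 0" if "cyc_l t \<in> {0 + D, 0 - D}" for t using trans that by simp
  qed
qed

lemma cycle_periodic: "cyc_l (t + 2 * half_period) = cyc_l t" "cyc_T (t + 2 * half_period) = cyc_T t" "cyc_u (t + 2 * half_period) = cyc_u t"
proof -
  have "(t + 2 * half_period) / half_period = t / half_period + 2" using half_period_pos by (simp add: field_simps)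
  then have fl: "\<lfloor>(t + 2 * half_period) / half_period\<rfloor> = \<lfloor>t / half_period\<rfloor> + 2" by linarith
  then have arg: "t + 2 * half_period - \<lfloor>(t + 2 * half_period) / half_period\<rfloor> * half_period = t - \<lfloor>t / half_period\<rfloor> * half_period" by (simp add: algebra_simps)
  have shift: "piece_l (n + 2) r = piece_l n r" "piece_T (n + 2) r = piece_T n r" for n r
    by (simp_all add: piece_l_def piece_T_def)
  show "cyc_l (t + 2 * half_period) = cyc_l t" "cyc_T (t + 2 * half_period) = cyc_T t" "cyc_u (t + 2 * half_period) = cyc_u t"
    unfolding cyc_l_def cyc_T_def cyc_u_def arg unfolding fl shift by simp_all
qed

lemma cycle_start: "cyc_l 0 = D" "cyc_T 0 = \<sigma>"
  using cyc_piece(1,2)[of 0 0] turn1 half_period_pos by (auto simp: piece_l_def piece_T_def half_turn_def)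

lemma cycle_nonconstant: "cyc_T (half_period / 2) \<noteq> cyc_T 0"
  using cyc_piece(2)[of 0 "half_period / 2"] cycle_start half_period_pos by (auto simp: piece_T_def)

end

section \<open>Uniqueness\<close>

context relay_cycle_system
begin

text \<open>
  The invariant set of crossing torques is \<open>{\<sigma>}\<close>.
\<close>

lemma visits_cycle:
  assumes sol: "abs_solution f 1 1 0 D I l T u" and I: "is_interval I"
    and t0: "t0 \<in> I" "l t0 = D" "T t0 = \<sigma>" and t: "t \<in> I" "t0 \<le> t"
  shows "(l t, T t, u t) \<in> cycle_set"
proof (rule recurrence[OF sol I, where A = "{\<sigma>}" and Q = "\<lambda>t. (l t, T t, u t) \<in> cycle_set"])
  show "lo \<le> x \<and> x \<le> E \<and> half_map (mirror g) D (half_map g D x) \<in> {\<sigma>}" if "x \<in> {\<sigma>}" for x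
    using that \<sigma>_range by (simp add: half_map_\<sigma> half_map_\<sigma>')
next
  fix t0 t x
  assume *: "t0 \<in> I" "l t0 = D" "T t0 \<in> {\<sigma>}" "x = T t0" "t \<in> I" "t0 \<le> t"
    "t < t0 + x + half_map g D x + half_map g D x + half_map (mirror g) D (half_map g D x)"
  then have x: "x = \<sigma>" "T t0 = \<sigma>" and tl: "t < t0 + \<sigma> + \<sigma>' + \<sigma>' + \<sigma>"
    by (simp_all add: half_map_\<sigma> half_map_\<sigma>')
  note F = full_turn[OF sol I *(1,2) x(2) \<sigma>_range turn1 turn2]
  show "(l t, T t, u t) \<in> cycle_set"
  proof (cases "t < t0 + \<sigma> + \<sigma>'")
    case True
    then have "(l t, T t, u t) = (\<lambda>s. (z1 s, - s, - 1)) (t - t0 - \<sigma>)" using F(1)[OF *(5,6)] by simp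
    moreover have "t - t0 - \<sigma> \<in> {-\<sigma>..<\<sigma>'}" using True *(6) by auto
    ultimately show ?thesis unfolding cycle_set_def by blast
  next
    case False
    then have "(l t, T t, u t) = (\<lambda>s. (- z2 s, s, 1)) (t - (t0 + \<sigma> + \<sigma>') - \<sigma>')"
      using F(2)[OF *(5) _ tl] by simp
    moreover have "t - (t0 + \<sigma> + \<sigma>') - \<sigma>' \<in> {-\<sigma>'..<\<sigma>}" using False tl by auto
    ultimately show ?thesis unfolding cycle_set_def by blast
  qed
qed (use t0 t in auto)

lemma orbit_eq_cycle:
  assumes sol: "abs_solution f 1 1 0 D {0..} l T u"
    and t0: "0 \<le> t0" "l t0 = D" "T t0 = \<sigma>"
  shows "(\<lambda>t. (l t, T t, u t)) ` {t0..} = cycle_set"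
proof
  have I: "is_interval {0::real..}" by simp
  have t0I: "t0 \<in> {0..}" using t0 by simp
  show "(\<lambda>t. (l t, T t, u t)) ` {t0..} \<subseteq> cycle_set"
    using visits_cycle[OF sol I t0I t0(2,3)] t0 by auto
  note F = full_turn[OF sol I t0I t0(2,3) \<sigma>_range turn1 turn2]
  have pos: "\<sigma> > 0" "\<sigma>' > 0" using \<sigma> \<sigma>'_range range_facts by auto
  show "cycle_set \<subseteq> (\<lambda>t. (l t, T t, u t)) ` {t0..}"
    unfolding cycle_set_def
  proof (intro Un_least image_subsetI)
    fix s assume s: "s \<in> {-\<sigma>..<\<sigma>'}"
    then have "(z1 s, - s, - 1) = (\<lambda>t. (l t, T t, u t)) (t0 + \<sigma> + s)"
      using F(1)[of "t0 + \<sigma> + s"] t0 by auto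
    then show "(z1 s, - s, - 1) \<in> (\<lambda>t. (l t, T t, u t)) ` {t0..}"
      by (rule image_eqI) (use s in auto)
  next
    fix s assume s: "s \<in> {-\<sigma>'..<\<sigma>}"
    then have "(- z2 s, s, 1) = (\<lambda>t. (l t, T t, u t)) (t0 + \<sigma> + \<sigma>' + \<sigma>' + s)"
      using F(2)[of "t0 + \<sigma> + \<sigma>' + \<sigma>' + s"] t0 pos by auto
    then show "(- z2 s, s, 1) \<in> (\<lambda>t. (l t, T t, u t)) ` {t0..}"
      by (rule image_eqI) (use s pos in auto)
  qed
qed

lemma turn_map_dist:
  assumes "lo \<le> x" "x \<le> E"
  shows "\<bar>half_map g D x - \<sigma>'\<bar> \<le> \<bar>x - \<sigma>\<bar>"
    and "\<bar>half_map (mirror g) D (half_map g D x) - \<sigma>\<bar> \<le> (1 - 3/10 * lo) * \<bar>x - \<sigma>\<bar>"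
    and "\<bar>half_map (mirror g) D (half_map g D x) - \<sigma>\<bar> \<le> \<bar>x - \<sigma>\<bar>"
    and "lo \<le> half_map g D x" "half_map g D x \<le> E"
    and "lo \<le> half_map (mirror g) D (half_map g D x)" "half_map (mirror g) D (half_map g D x) \<le> E"
proof -
  interpret m: relay_system "mirror f" "mirror g" \<rho> D \<mu> lo E by (rule mirror_system)
  have c: "0 \<le> 1 - 3/10 * lo" "1 - 3/10 * lo \<le> 1" using range_facts by auto
  have x': "lo \<le> half_map g D x" "half_map g D x \<le> E" using half_map_range(2,3)[OF drag range assms] by auto
  then show "lo \<le> half_map g D x" "half_map g D x \<le> E" .
  show "lo \<le> half_map (mirror g) D (half_map g D x)" "half_map (mirror g) D (half_map g D x) \<le> E"
    using half_map_range(2,3)[OF m.drag range x'] by auto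
  have shrink: "(1 - 3/10 * lo) * \<bar>v\<bar> \<le> \<bar>v\<bar>" for v using mult_right_mono[OF c(2), of "\<bar>v\<bar>"] by simp
  have 1: "\<bar>half_map g D x - \<sigma>'\<bar> \<le> (1 - 3/10 * lo) * \<bar>x - \<sigma>\<bar>"
    using half_map_dist[OF drag range assms \<sigma>_range] by (simp add: half_map_\<sigma>)
  then show *: "\<bar>half_map g D x - \<sigma>'\<bar> \<le> \<bar>x - \<sigma>\<bar>" using shrink order_trans by blast
  have "\<bar>half_map (mirror g) D (half_map g D x) - \<sigma>\<bar> \<le> (1 - 3/10 * lo) * \<bar>half_map g D x - \<sigma>'\<bar>"
    using half_map_dist[OF m.drag range x' \<sigma>'_range(3,4)] by (simp add: half_map_\<sigma>')
  also have "\<dots> \<le> (1 - 3/10 * lo) * \<bar>x - \<sigma>\<bar>" using * c by (intro mult_left_mono) auto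
  finally show 2: "\<bar>half_map (mirror g) D (half_map g D x) - \<sigma>\<bar> \<le> (1 - 3/10 * lo) * \<bar>x - \<sigma>\<bar>" .
  then show "\<bar>half_map (mirror g) D (half_map g D x) - \<sigma>\<bar> \<le> \<bar>x - \<sigma>\<bar>" using shrink order_trans by blast
qed

text \<open>
  The upward crossings with torque at most as far from \<open>\<sigma>\<close> as the first return form an invariant set.  By
  periodicity the initial crossing occurs again after that return, so it is no farther from \<open>\<sigma>\<close> than its own image,
  which a strict contraction allows only at \<open>\<sigma>\<close>.
\<close>

lemma periodic_start_unique:
  assumes sol: "abs_solution f 1 1 0 D {0..} l T u"
    and P: "P > 0" "\<And>t. t \<ge> 0 \<Longrightarrow> l (t + P) = l t \<and> T (t + P) = T t \<and> u (t + P) = u t"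
    and t0: "0 \<le> t0" "l t0 = D" "lo \<le> T t0" "T t0 \<le> E"
  shows "T t0 = \<sigma>"
proof (rule ccontr)
  assume ne: "T t0 \<noteq> \<sigma>"
  interpret m: relay_system "mirror f" "mirror g" \<rho> D \<mu> lo E by (rule mirror_system)
  have I: "is_interval {0::real..}" by simp
  define \<tau> where "\<tau> = T t0"
  define \<tau>' where "\<tau>' = half_map g D \<tau>"
  define \<tau>'' where "\<tau>'' = half_map (mirror g) D \<tau>'"
  have \<tau>: "lo \<le> \<tau>" "\<tau> \<le> E" using t0 by (auto simp: \<tau>_def)
  note dist = turn_map_dist[OF \<tau>, folded \<tau>'_def, folded \<tau>''_def]
  obtain w1 where w1: "half_turn g D \<tau> w1 \<tau>'"
    using half_map_turn[OF drag range_admissible[OF \<tau>]] unfolding \<tau>'_def by blast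
  obtain w2 where w2: "half_turn (mirror g) D \<tau>' w2 \<tau>''"
    using half_map_turn[OF m.drag range_admissible[OF dist(4,5)]] unfolding \<tau>''_def by blast
  define t2 where "t2 = t0 + \<tau> + \<tau>' + \<tau>' + \<tau>''"
  have t2: "t0 \<le> t2" using \<tau> dist range_facts by (auto simp: t2_def)
  have at2: "l t2 = D" "T t2 = \<tau>''"
    using full_turn(3)[OF sol I _ t0(2) \<tau>_def[symmetric] \<tau> w1 w2] t0(1) t2 by (auto simp: t2_def)
  define A where "A = {x. lo \<le> x \<and> x \<le> E \<and> \<bar>x - \<sigma>\<bar> \<le> \<bar>\<tau>'' - \<sigma>\<bar>}"
  \<comment> \<open>Every upward crossing after the first return is at least as close to the cycle as that return.\<close>
  have crossing: "l t = D \<and> u t = - 1 \<and> T t > 0 \<longrightarrow> T t \<in> A" if "t2 \<le> t" for t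
  proof (rule recurrence[OF sol I, where A = A and Q = "\<lambda>t. l t = D \<and> u t = - 1 \<and> T t > 0 \<longrightarrow> T t \<in> A"])
    show "lo \<le> x \<and> x \<le> E \<and> half_map (mirror g) D (half_map g D x) \<in> A" if "x \<in> A" for x
      using that turn_map_dist(3,6,7)[of x] by (auto simp: A_def)
  next
    fix r0 r x
    assume *: "r0 \<in> {0..}" "l r0 = D" "T r0 \<in> A" "x = T r0" "r \<in> {0..}" "r0 \<le> r"
      and r: "r < r0 + x + half_map g D x + half_map g D x + half_map (mirror g) D (half_map g D x)"
    have x: "lo \<le> x" "x \<le> E" "x \<in> A" using * by (auto simp: A_def)
    note x' = turn_map_dist(4,5)[OF x(1,2)]
    obtain v1 where v1: "half_turn g D x v1 (half_map g D x)"
      using half_map_turn[OF drag range_admissible[OF x(1,2)]] by blast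
    obtain v2 where v2: "half_turn (mirror g) D (half_map g D x) v2 (half_map (mirror g) D (half_map g D x))"
      using half_map_turn[OF m.drag range_admissible[OF x']] by blast
    note F = full_turn[OF sol I *(1,2) *(4)[symmetric] x(1,2) v1 v2]
    show "l r = D \<and> u r = - 1 \<and> T r > 0 \<longrightarrow> T r \<in> A"
    proof (cases "r < r0 + x + half_map g D x")
      case True
      note G = F(1)[OF *(5,6) True]
      show ?thesis
      proof (intro impI)
        assume a: "l r = D \<and> u r = - 1 \<and> T r > 0"
        have v: "slip_arc g v1" "v1 (-x) = D" using v1 by (auto simp: half_turn_def)
        have "\<not> (-x < r - r0 - x)"
          using slip_arc_early[OF drag v(1) range_admissible[OF x(1,2)] v(2), of "r - r0 - x"] G a x(1) range_facts
          by auto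
        then have "r = r0" using *(6) by auto
        then show "T r \<in> A" using *(3) by simp
      qed
    next
      case False
      then show ?thesis using F(2)[OF *(5) _ r] by auto
    qed
  qed (use that t0 t2 at2 dist in \<open>auto simp: A_def\<close>)
  \<comment> \<open>Periodicity brings the initial crossing back after the first return.\<close>
  have per: "l (t0 + real n * P) = D \<and> T (t0 + real n * P) = \<tau> \<and> u (t0 + real n * P) = - 1" for n
  proof (induction n)
    case 0
    then show ?case using t0 sol by (auto simp: \<tau>_def abs_solution_def relay_rule_def)
  next
    case (Suc n)
    have "t0 + real n * P \<ge> 0" using t0 P by simp
    from P(2)[OF this] Suc show ?case by (simp add: algebra_simps)
  qed
  obtain n where "(t2 - t0) / P < real n" using reals_Archimedean2 by blast
  then have "t2 \<le> t0 + real n * P" using P by (simp add: field_simps)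
  from crossing[OF this] per[of n] have "\<tau> \<in> A" using \<tau> range_facts by auto
  then have "\<bar>\<tau> - \<sigma>\<bar> \<le> (1 - 3/10 * lo) * \<bar>\<tau> - \<sigma>\<bar>" using dist(2) by (auto simp: A_def)
  then have "3/10 * lo * \<bar>\<tau> - \<sigma>\<bar> \<le> 0" by (simp add: algebra_simps)
  moreover have "3/10 * lo * \<bar>\<tau> - \<sigma>\<bar> > 0" using ne range_facts by (simp add: \<tau>_def)
  ultimately show False by linarith
qed

text \<open>
  A start with negative torque lies on the returning part of an arc.  It goes to the lower line with torque of
  size between \<open>\<bar>T 0\<bar>\<close> and \<open>2 \<bar>T 0\<bar>\<close>, and the next half-turn leads upwards through the line \<open>D\<close>.
\<close>

lemma reaches_upward_crossing:
  assumes sol: "abs_solution f 1 1 0 D {0..} l T u" and l0: "l 0 = D"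
    and y: "lo \<le> \<bar>T 0\<bar>" "2 * \<bar>T 0\<bar> \<le> E"
  obtains t0 where "0 \<le> t0" "l t0 = D" "lo \<le> T t0" "T t0 \<le> E"
proof (cases "T 0 > 0")
  case True
  then show ?thesis using that[of 0] l0 y by auto
next
  case False
  interpret m: relay_system "mirror f" "mirror g" \<rho> D \<mu> lo E by (rule mirror_system)
  have I: "is_interval {0::real..}" by simp
  define a where "a = - T 0"
  have a: "lo \<le> a" "2 * a \<le> E" "a > 0" using False y range_facts by (auto simp: a_def)
  have adm: "admissible D a" using a by (intro range_admissible) auto
  note adm' = admissible_square[OF adm]
  have "\<bar>a\<bar> < 1/5" using adm' by auto
  then obtain z where z: "slip_arc g z" "z a = D" using slip_arc_exists[OF drag] by blast
  obtain e where e: "a < e" "e < 2 * a" "z e = - D" "\<And>s. a \<le> s \<Longrightarrow> s < e \<Longrightarrow> z s > - D"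
      "\<And>s. a \<le> s \<Longrightarrow> s \<le> e \<Longrightarrow> z s \<le> D"
    using slip_arc_drop[OF drag z(1) adm z(2)] by blast
  have "a\<^sup>2 \<le> E\<^sup>2" using a by (intro power_mono) auto
  then have "D < \<rho>" using adm' small zero_le_power2[of a] by linarith
  have bd: "\<bar>z s\<bar> < \<rho>" if "- T 0 \<le> s" "s \<le> e" for s
  proof -
    have "- D \<le> z s" using e(3) e(4)[of s] that by (cases "s = e") (auto simp: a_def)
    then show ?thesis using e(5)[of s] that \<open>D < \<rho>\<close> unfolding a_def by auto
  qed
  have u0: "u 0 = - 1" using sol l0 by (auto simp: abs_solution_def relay_rule_def)
  define t1 where "t1 = 0 + T 0 + e"
  have t1: "t1 \<ge> 0" "t1 \<in> {0..}" using e by (auto simp: t1_def a_def)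
  have "l (0 + T 0 + e) = - D \<and> T (0 + T 0 + e) = - e"
    by (rule arc_phase(2)[OF sol I z(1) _ u0, of e]) (use z e l0 adm' a bd t1 in \<open>auto simp: a_def t1_def\<close>)
  then have at1: "l t1 = - D" "T t1 = - e" unfolding t1_def by auto
  have er: "lo \<le> e" "e \<le> E" using e a by auto
  obtain w where w: "half_turn (mirror g) D e w (half_map (mirror g) D e)"
    using half_map_turn[OF m.drag range_admissible[OF er]] by blast
  note er' = half_map_range(2,3)[OF m.drag range er]
  define t2 where "t2 = t1 + e + half_map (mirror g) D e"
  have t2: "0 \<le> t2" using t1 er er' range_facts by (auto simp: t2_def)
  have "- l t2 = - D \<and> - T t2 = - half_map (mirror g) D e"
    unfolding t2_def
    by (rule m.half_turn_phase(2)[OF abs_solution_mirror[OF sol] I t1(2) _ _ er w])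
       (use at1 t2 in \<open>auto simp: t2_def\<close>)
  then show ?thesis using that[OF t2] er' by auto
qed

lemma periodic_orbit_unique:
  assumes sol: "abs_solution f 1 1 0 D {0..} l T u"
    and P: "P > 0" "\<And>t. t \<ge> 0 \<Longrightarrow> l (t + P) = l t \<and> T (t + P) = T t \<and> u (t + P) = u t"
    and l0: "l 0 = D" and y: "lo \<le> \<bar>T 0\<bar>" "2 * \<bar>T 0\<bar> \<le> E"
  shows "(\<lambda>t. (l t, T t, u t)) ` {0..} = cycle_set"
proof -
  obtain t0 where t0: "0 \<le> t0" "l t0 = D" "lo \<le> T t0" "T t0 \<le> E"
    using reaches_upward_crossing[OF sol l0 y] .
  have eq: "(\<lambda>t. (l t, T t, u t)) ` {t0..} = cycle_set"
    using orbit_eq_cycle[OF sol t0(1,2) periodic_start_unique[OF sol P t0]] .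
  let ?X = "\<lambda>t. (l t, T t, u t)"
  have per: "?X (t + real n * P) = ?X t" if "t \<ge> 0" for t n
  proof (induction n)
    case (Suc n)
    have "t + real n * P \<ge> 0" using that P by simp
    from P(2)[OF this] Suc show ?case by (simp add: algebra_simps)
  qed simp
  have "?X ` {0..} \<subseteq> ?X ` {t0..}"
  proof (rule image_subsetI)
    fix t :: real assume t: "t \<in> {0..}"
    obtain n where "t0 / P < real n" using reals_Archimedean2 by blast
    then have "t0 \<le> t + real n * P" using P t by (simp add: field_simps)
    moreover have "?X t = ?X (t + real n * P)" using per t by simp
    ultimately show "?X t \<in> ?X ` {t0..}" by blast
  qed
  moreover have "?X ` {t0..} \<subseteq> ?X ` {0..}" using t0(1) by (intro image_mono) auto
  ultimately show ?thesis using eq by blast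
qed

end

section \<open>Orbital stability\<close>

lemma dist_triple_le: "dist (x, y, v) (x', y', v') \<le> \<bar>x - x'\<bar> + \<bar>y - y'\<bar> + \<bar>v - v'\<bar>"
  for x y v x' y' v' :: real
proof -
  have "dist (x, y, v) (x', y', v') \<le> dist x x' + dist (y, v) (y', v')"
    unfolding dist_Pair_Pair[of x] by (rule order_trans[OF sqrt_sum_squares_le_sum_abs]) simp
  also have "dist (y, v) (y', v') \<le> dist y y' + dist v v'"
    unfolding dist_Pair_Pair by (rule order_trans[OF sqrt_sum_squares_le_sum_abs]) simp
  finally show ?thesis by (simp add: dist_real_def)
qed

context relay_cycle_system
begin

text \<open>
  Each control value is compared with its own half-turn only.  In contrast to the distance from the cycle,
  this form is preserved by the mirror symmetry by mere inspection.
\<close>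

definition near_cycle :: "real \<Rightarrow> real \<Rightarrow> real \<Rightarrow> real \<Rightarrow> bool" where
  "near_cycle \<eta> x y v \<longleftrightarrow>
     (v = - 1 \<and> (\<exists>s. -\<sigma> \<le> s \<and> s < \<sigma>' \<and> \<bar>- y - s\<bar> < \<eta> \<and> \<bar>x - z1 s\<bar> < \<eta>)) \<or>
     (v = 1 \<and> (\<exists>s. -\<sigma>' \<le> s \<and> s < \<sigma> \<and> \<bar>y - s\<bar> < \<eta> \<and> \<bar>- x - z2 s\<bar> < \<eta>))"

lemma near_cycle_mirror:
  "relay_cycle_system.near_cycle \<sigma>' \<sigma> z2 z1 \<eta> (- x) (- y) (- v) \<longleftrightarrow> near_cycle \<eta> x y v"
proof -
  interpret m: relay_cycle_system "mirror f" "mirror g" \<rho> D \<mu> lo E \<sigma>' \<sigma> z2 z1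
    by (rule mirror_cycle_system)
  have "- v = 1 \<longleftrightarrow> v = - 1" by linarith
  then show ?thesis unfolding m.near_cycle_def near_cycle_def by auto
qed

text \<open>
  Here \<open>half_turn_shadow\<close> is applied to arcs that start on the switching line.  The end that it provides is not
  before the end of the half-turn.
\<close>

lemma half_turn_near:
  assumes "\<eta> > 0"
  obtains \<delta> where "\<delta> > 0"
    "\<And>x w x' s. lo \<le> x \<Longrightarrow> x \<le> E \<Longrightarrow> \<bar>x - \<sigma>\<bar> < \<delta> \<Longrightarrow> half_turn g D x w x' \<Longrightarrow> -x \<le> s \<Longrightarrow> s < x' \<Longrightarrow>
      \<exists>r. -\<sigma> \<le> r \<and> r < \<sigma>' \<and> \<bar>s - r\<bar> < \<eta> \<and> \<bar>w s - z1 r\<bar> < \<eta>"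
proof -
  obtain \<delta> where \<delta>: "\<delta> > 0" and sh:
    "\<And>z s0 s. slip_arc g z \<Longrightarrow> z s0 > - D \<Longrightarrow> -\<sigma> \<le> s \<Longrightarrow> s < \<sigma>' \<Longrightarrow> \<bar>s0 - s\<bar> < \<delta> \<Longrightarrow>
       \<bar>z s0 - z1 s\<bar> < \<delta> \<Longrightarrow>
       \<exists>e. s0 < e \<and> z e = - D \<and> \<bar>e - \<sigma>'\<bar> < \<eta> \<and> (\<forall>r. s0 \<le> r \<and> r < e \<longrightarrow> z r > - D \<and>
         (\<exists>r'. -\<sigma> \<le> r' \<and> r' < \<sigma>' \<and> \<bar>r - r'\<bar> < \<eta> \<and> \<bar>z r - z1 r'\<bar> < \<eta>))"
    using half_turn_shadow[OF drag range_admissible[OF \<sigma>_range] turn1 assms] by blast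
  have ends: "z1 (-\<sigma>) = D" "-\<sigma> < \<sigma>'" using turn1 by (auto simp: half_turn_def)
  show ?thesis
  proof (rule that[OF \<delta>])
    fix x w x' s
    assume x: "lo \<le> x" "x \<le> E" "\<bar>x - \<sigma>\<bar> < \<delta>" and h: "half_turn g D x w x'" and s: "-x \<le> s" "s < x'"
    have w: "slip_arc g w" "w (-x) = D" "w x' = - D" "\<And>s. -x \<le> s \<Longrightarrow> s < x' \<Longrightarrow> w s > - D"
      using h by (auto simp: half_turn_def)
    have "w (-x) > - D" using w range_facts by simp
    moreover have "\<bar>-x - -\<sigma>\<bar> < \<delta>" using x by (simp add: abs_minus_commute)
    moreover have "\<bar>w (-x) - z1 (-\<sigma>)\<bar> < \<delta>" using w ends \<delta> by simp
    ultimately obtain e where e: "-x < e" "w e = - D"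
      "\<forall>r. -x \<le> r \<and> r < e \<longrightarrow> w r > - D \<and> (\<exists>r'. -\<sigma> \<le> r' \<and> r' < \<sigma>' \<and> \<bar>r - r'\<bar> < \<eta> \<and> \<bar>w r - z1 r'\<bar> < \<eta>)"
      using sh[OF w(1), of "-x" "-\<sigma>"] ends by auto
    have "x' \<le> e" using w(4)[of e] e(1,2) by force
    then show "\<exists>r. -\<sigma> \<le> r \<and> r < \<sigma>' \<and> \<bar>s - r\<bar> < \<eta> \<and> \<bar>w s - z1 r\<bar> < \<eta>" using e(3) s by auto
  qed
qed

text \<open>
  The crossing torques within \<open>r\<close> of \<open>\<sigma>\<close> are invariant because the return map does not increase
  distances; so closeness has to be checked for a single full turn only.
\<close>

lemma stays_near:
  assumes \<eta>: "\<eta> > 0"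
  obtains r where "r > 0"
    "\<And>I l T u t0 t. abs_solution f 1 1 0 D I l T u \<Longrightarrow> is_interval I \<Longrightarrow> t0 \<in> I \<Longrightarrow> l t0 = D \<Longrightarrow>
       \<bar>T t0 - \<sigma>\<bar> \<le> r \<Longrightarrow> t \<in> I \<Longrightarrow> t0 \<le> t \<Longrightarrow> near_cycle \<eta> (l t) (T t) (u t)"
proof -
  interpret m: relay_cycle_system "mirror f" "mirror g" \<rho> D \<mu> lo E \<sigma>' \<sigma> z2 z1
    by (rule mirror_cycle_system)
  obtain \<delta>1 where \<delta>1: "\<delta>1 > 0"
    "\<And>x w x' s. lo \<le> x \<Longrightarrow> x \<le> E \<Longrightarrow> \<bar>x - \<sigma>\<bar> < \<delta>1 \<Longrightarrow> half_turn g D x w x' \<Longrightarrow> -x \<le> s \<Longrightarrow> s < x' \<Longrightarrow>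
      \<exists>r. -\<sigma> \<le> r \<and> r < \<sigma>' \<and> \<bar>s - r\<bar> < \<eta> \<and> \<bar>w s - z1 r\<bar> < \<eta>"
    using half_turn_near[OF \<eta>] by blast
  obtain \<delta>2 where \<delta>2: "\<delta>2 > 0"
    "\<And>x w x' s. lo \<le> x \<Longrightarrow> x \<le> E \<Longrightarrow> \<bar>x - \<sigma>'\<bar> < \<delta>2 \<Longrightarrow> half_turn (mirror g) D x w x' \<Longrightarrow> -x \<le> s \<Longrightarrow> s < x' \<Longrightarrow>
      \<exists>r. -\<sigma>' \<le> r \<and> r < \<sigma> \<and> \<bar>s - r\<bar> < \<eta> \<and> \<bar>w s - z2 r\<bar> < \<eta>"
    using m.half_turn_near[OF \<eta>] by blast
  \<comment> \<open>The last two entries keep the crossing torques inside the window.\<close>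
  define r where "r = Min {\<delta>1/2, \<delta>2/2, \<sigma> - lo, E - \<sigma>}"
  have hi: "\<sigma> < E" using \<sigma> range_facts by auto
  have "r > 0" using \<delta>1(1) \<delta>2(1) \<sigma> hi by (auto simp: r_def)
  moreover have "r \<le> \<delta>1/2" "r \<le> \<delta>2/2" "r \<le> \<sigma> - lo" "r \<le> E - \<sigma>"
    unfolding r_def by (intro Min_le; blast)+
  ultimately have r: "r > 0" "r \<le> \<delta>1/2" "r \<le> \<delta>2/2" "r \<le> \<sigma> - lo" "r \<le> E - \<sigma>"
    by auto
  define A where "A = {x. \<bar>x - \<sigma>\<bar> \<le> r}"
  have A: "lo \<le> x" "x \<le> E" if "x \<in> A" for x
    using that r(4,5) unfolding A_def mem_Collect_eq abs_le_iff by auto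
  show ?thesis
  proof (rule that[OF r(1)])
    fix I l T u t0 t
    assume sol: "abs_solution f 1 1 0 D I l T u" and I: "is_interval I"
      and t0: "t0 \<in> I" "l t0 = D" "\<bar>T t0 - \<sigma>\<bar> \<le> r" and t: "t \<in> I" "t0 \<le> t"
    show "near_cycle \<eta> (l t) (T t) (u t)"
    proof (rule recurrence[OF sol I, where A = A and Q = "\<lambda>t. near_cycle \<eta> (l t) (T t) (u t)"])
      show "lo \<le> x \<and> x \<le> E \<and> half_map (mirror g) D (half_map g D x) \<in> A" if "x \<in> A" for x
        using A[OF that] turn_map_dist(3)[OF A[OF that]] that by (auto simp: A_def)
    next
      fix r0 q x
      assume *: "r0 \<in> I" "l r0 = D" "T r0 \<in> A" "x = T r0" "q \<in> I" "r0 \<le> q"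
        and q: "q < r0 + x + half_map g D x + half_map g D x + half_map (mirror g) D (half_map g D x)"
      have x: "lo \<le> x" "x \<le> E" "\<bar>x - \<sigma>\<bar> \<le> r" using * A[of x] by (auto simp: A_def)
      note x' = turn_map_dist[OF x(1,2)]
      obtain v1 where v1: "half_turn g D x v1 (half_map g D x)"
        using half_map_turn[OF drag range_admissible[OF x(1,2)]] by blast
      obtain v2 where v2: "half_turn (mirror g) D (half_map g D x) v2 (half_map (mirror g) D (half_map g D x))"
        using half_map_turn[OF m.drag range_admissible[OF x'(4,5)]] by blast
      note F = full_turn[OF sol I *(1,2) *(4)[symmetric] x(1,2) v1 v2]
      show "near_cycle \<eta> (l q) (T q) (u q)"
      proof (cases "q < r0 + x + half_map g D x")
        case True
        note G = F(1)[OF *(5,6) True]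
        have "\<exists>r. -\<sigma> \<le> r \<and> r < \<sigma>' \<and> \<bar>(q - r0 - x) - r\<bar> < \<eta> \<and> \<bar>v1 (q - r0 - x) - z1 r\<bar> < \<eta>"
          by (rule \<delta>1(2)[OF x(1,2) _ v1]) (use x r \<delta>1(1) * True in auto)
        then show ?thesis unfolding near_cycle_def using G by auto
      next
        case False
        then have G: "l q = - v2 (q - (r0 + x + half_map g D x) - half_map g D x) \<and>
            T q = q - (r0 + x + half_map g D x) - half_map g D x \<and> u q = 1"
          using F(2)[OF *(5) _ q] by auto
        have "\<bar>half_map g D x - \<sigma>'\<bar> < \<delta>2" using x'(1) x(3) r(3) \<delta>2(1) by linarith
        then have "\<exists>s. -\<sigma>' \<le> s \<and> s < \<sigma> \<and> \<bar>(q - (r0 + x + half_map g D x) - half_map g D x) - s\<bar> < \<eta> \<and>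
            \<bar>v2 (q - (r0 + x + half_map g D x) - half_map g D x) - z2 s\<bar> < \<eta>"
          by (rule \<delta>2(2)[OF x'(4,5) _ v2]) (use False q in auto)
        then show ?thesis unfolding near_cycle_def using G by auto
      qed
    qed (use t0 t in \<open>auto simp: A_def\<close>)
  qed
qed

text \<open>
  A solution that starts near a point of the first half-turn follows an arc to the lower line and arrives
  there so close to \<open>\<sigma>'\<close> that \<open>stays_near\<close> for the mirrored system takes over.
\<close>

lemma approach:
  assumes \<eta>: "\<eta> > 0"
  obtains \<delta> where "\<delta> > 0"
    "\<And>I l T u t0 t s. abs_solution f 1 1 0 D I l T u \<Longrightarrow> is_interval I \<Longrightarrow> t0 \<in> I \<Longrightarrow> u t0 = - 1 \<Longrightarrow>
       l t0 > - D \<Longrightarrow> -\<sigma> \<le> s \<Longrightarrow> s < \<sigma>' \<Longrightarrow> \<bar>- T t0 - s\<bar> < \<delta> \<Longrightarrow> \<bar>l t0 - z1 s\<bar> < \<delta> \<Longrightarrow>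
       t \<in> I \<Longrightarrow> t0 \<le> t \<Longrightarrow> near_cycle \<eta> (l t) (T t) (u t)"
proof -
  interpret m: relay_cycle_system "mirror f" "mirror g" \<rho> D \<mu> lo E \<sigma>' \<sigma> z2 z1
    by (rule mirror_cycle_system)
  obtain r where r: "r > 0"
    "\<And>I l T u t0 t. abs_solution (mirror f) 1 1 0 D I l T u \<Longrightarrow> is_interval I \<Longrightarrow> t0 \<in> I \<Longrightarrow> l t0 = D \<Longrightarrow>
       \<bar>T t0 - \<sigma>'\<bar> \<le> r \<Longrightarrow> t \<in> I \<Longrightarrow> t0 \<le> t \<Longrightarrow> m.near_cycle \<eta> (l t) (T t) (u t)"
    using m.stays_near[OF \<eta>] by blast
  \<comment> \<open>The entry \<open>\<rho> - E\<^sup>2\<close> keeps the nearby arc inside the region where \<open>f\<close> and \<open>g\<close> agree.\<close>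
  define \<eta>' where "\<eta>' = Min {\<eta>, r, \<rho> - E\<^sup>2, 1/20}"
  have "\<eta>' > 0" unfolding \<eta>'_def using \<eta> r(1) small by auto
  moreover have "\<eta>' \<le> \<eta>" "\<eta>' \<le> r" "\<eta>' \<le> \<rho> - E\<^sup>2" "\<eta>' \<le> 1/20"
    unfolding \<eta>'_def by (intro Min_le; blast)+
  ultimately have \<eta>': "\<eta>' > 0" "\<eta>' \<le> \<eta>" "\<eta>' \<le> r" "\<eta>' \<le> \<rho> - E\<^sup>2" "\<eta>' \<le> 1/20"
    by auto
  obtain \<delta>0 where \<delta>0: "\<delta>0 > 0" and sh:
    "\<And>z s0 s. slip_arc g z \<Longrightarrow> z s0 > - D \<Longrightarrow> -\<sigma> \<le> s \<Longrightarrow> s < \<sigma>' \<Longrightarrow> \<bar>s0 - s\<bar> < \<delta>0 \<Longrightarrow>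
       \<bar>z s0 - z1 s\<bar> < \<delta>0 \<Longrightarrow>
       \<exists>e. s0 < e \<and> z e = - D \<and> \<bar>e - \<sigma>'\<bar> < \<eta>' \<and> (\<forall>r. s0 \<le> r \<and> r < e \<longrightarrow> z r > - D \<and>
         (\<exists>r'. -\<sigma> \<le> r' \<and> r' < \<sigma>' \<and> \<bar>r - r'\<bar> < \<eta>' \<and> \<bar>z r - z1 r'\<bar> < \<eta>'))"
    using half_turn_shadow[OF drag range_admissible[OF \<sigma>_range] turn1 \<eta>'(1)] by blast
  define \<delta> where "\<delta> = min \<delta>0 (1/20)"
  have \<delta>: "\<delta> > 0" "\<delta> \<le> \<delta>0" "\<delta> \<le> 1/20" using \<delta>0 by (auto simp: \<delta>_def)
  show ?thesis
  proof (rule that[OF \<delta>(1)])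
    fix I l T u t0 t s
    assume sol: "abs_solution f 1 1 0 D I l T u" and I: "is_interval I"
      and t0: "t0 \<in> I" "u t0 = - 1" "l t0 > - D" and s: "-\<sigma> \<le> s" "s < \<sigma>'"
      and close: "\<bar>- T t0 - s\<bar> < \<delta>" "\<bar>l t0 - z1 s\<bar> < \<delta>" and t: "t \<in> I" "t0 \<le> t"
    have sr: "-1/10 < s" "s < 1/10"
      using half_turn_small(2,3)[OF drag \<sigma>_range turn1, of s] s by auto
    have s0: "-1/5 < - T t0" "- T t0 < 1/5" using close(1) \<delta>(3) sr unfolding abs_less_iff by argo+
    then have "\<bar>- T t0\<bar> < 1/5" unfolding abs_less_iff by argo
    then obtain z where z: "slip_arc g z" "z (- T t0) = l t0" using slip_arc_exists[OF drag] by blast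
    have "\<bar>- T t0 - s\<bar> < \<delta>0" "\<bar>z (- T t0) - z1 s\<bar> < \<delta>0" "z (- T t0) > - D" using close \<delta>(2) z t0 by auto
    then obtain e where e: "- T t0 < e" "z e = - D" "\<bar>e - \<sigma>'\<bar> < \<eta>'"
      and ne: "\<And>q. - T t0 \<le> q \<Longrightarrow> q < e \<Longrightarrow> z q > - D \<and>
         (\<exists>r'. -\<sigma> \<le> r' \<and> r' < \<sigma>' \<and> \<bar>q - r'\<bar> < \<eta>' \<and> \<bar>z q - z1 r'\<bar> < \<eta>')"
      using sh[OF z(1) _ s] by blast
    have e5: "e < 1/5"
      using e(3) \<eta>'(5) turn1 unfolding abs_less_iff half_turn_def by argo
    have D\<rho>: "D < \<rho>"
      using half_turn_small(1)[OF drag \<sigma>_range turn1, of "-\<sigma>"] turn1 small by (auto simp: half_turn_def)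
    have bd: "\<bar>z q\<bar> < \<rho>" if q: "- T t0 \<le> q" "q \<le> e" for q
    proof (cases "q = e")
      case True
      then show ?thesis using e(2) D\<rho> range_facts by simp
    next
      case False
      then obtain r' where r': "-\<sigma> \<le> r'" "r' < \<sigma>'" "\<bar>z q - z1 r'\<bar> < \<eta>'" using ne[of q] q by auto
      have "\<bar>z1 r'\<bar> \<le> E\<^sup>2" using half_turn_small(1)[OF drag \<sigma>_range turn1, of r'] r' by auto
      then show ?thesis using r'(3) \<eta>'(4) by linarith
    qed
    have ab: "z q > - D" if "- T t0 \<le> q" "q < e" for q using ne[OF that] by blast
    note ph = arc_phase[OF sol I z(1) t0(1,2) z(2) s0(1) less_imp_le[OF e(1)] e5 e(2)]
    have F: "t < t0 + T t0 + e \<Longrightarrow> l t = z (t - t0 - T t0) \<and> T t = - (t - t0 - T t0) \<and> u t = - 1"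
      by (rule ph(1)[OF _ _ t]) (use bd ab in auto)
    have F2: "t0 + T t0 + e \<in> I \<Longrightarrow> l (t0 + T t0 + e) = - D \<and> T (t0 + T t0 + e) = - e"
      by (rule ph(2)) (use bd ab in auto)
    show "near_cycle \<eta> (l t) (T t) (u t)"
    proof (cases "t < t0 + T t0 + e")
      case True
      obtain r' where "-\<sigma> \<le> r'" "r' < \<sigma>'" "\<bar>(t - t0 - T t0) - r'\<bar> < \<eta>'" "\<bar>z (t - t0 - T t0) - z1 r'\<bar> < \<eta>'"
        using ne[of "t - t0 - T t0"] True t by auto
      then show ?thesis using F[OF True] \<eta>'(2) unfolding near_cycle_def by force
    next
      case False
      define t1 where "t1 = t0 + T t0 + e"
      have t1: "t0 \<le> t1" "t1 \<le> t" using False e by (auto simp: t1_def)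
      have t1I: "t1 \<in> I" using mem_is_interval_1_I[OF I t0(1) t(1) t1] .
      have "- l t1 = D" "\<bar>- T t1 - \<sigma>'\<bar> \<le> r"
        using F2 t1I e(3) \<eta>'(3) unfolding t1_def by auto
      from r(2)[OF abs_solution_mirror[OF sol] I t1I this t(1) t1(2)]
      show ?thesis unfolding near_cycle_mirror .
    qed
  qed
qed

lemma near_cycle_infdist:
  assumes "near_cycle \<eta> x y v"
  shows "infdist (x, y, v) cycle_set < 2 * \<eta>"
proof -
  obtain p where p: "p \<in> cycle_set" "dist (x, y, v) p < 2 * \<eta>"
    using assms unfolding near_cycle_def
  proof (elim disjE conjE exE)
    fix s assume *: "v = - 1" "-\<sigma> \<le> s" "s < \<sigma>'" "\<bar>- y - s\<bar> < \<eta>" "\<bar>x - z1 s\<bar> < \<eta>"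
    have "(z1 s, - s, - 1) \<in> cycle_set" using * by (auto simp: cycle_set_def)
    moreover have "dist (x, y, v) (z1 s, - s, - 1) < 2 * \<eta>"
      using dist_triple_le[of x y v "z1 s" "- s" "- 1"] * by auto
    ultimately show ?thesis by (rule that)
  next
    fix s assume *: "v = 1" "-\<sigma>' \<le> s" "s < \<sigma>" "\<bar>y - s\<bar> < \<eta>" "\<bar>- x - z2 s\<bar> < \<eta>"
    have "(- z2 s, s, 1) \<in> cycle_set" using * by (auto simp: cycle_set_def)
    moreover have "dist (x, y, v) (- z2 s, s, 1) < 2 * \<eta>"
      using dist_triple_le[of x y v "- z2 s" s 1] * by auto
    ultimately show ?thesis by (rule that)
  qed
  then show ?thesis using infdist_le[OF p(1), of "(x, y, v)"] by linarith
qed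

text \<open>
  The control takes two values only, so a state at distance less than \<open>1\<close> from a point of the cycle has the same
  control value.  Consistency of the relay is what excludes starts beyond the line at which the arc of
  that control value ends.
\<close>

lemma cycle_stable: "orbitally_stable f 1 1 0 D cycle_set"
  unfolding orbitally_stable_def
proof (intro allI impI)
  interpret m: relay_cycle_system "mirror f" "mirror g" \<rho> D \<mu> lo E \<sigma>' \<sigma> z2 z1
    by (rule mirror_cycle_system)
  fix \<epsilon> :: real assume \<epsilon>: "\<epsilon> > 0"
  obtain \<delta>1 where \<delta>1: "\<delta>1 > 0"
    "\<And>I l T u t0 t s. abs_solution f 1 1 0 D I l T u \<Longrightarrow> is_interval I \<Longrightarrow> t0 \<in> I \<Longrightarrow> u t0 = - 1 \<Longrightarrow>
       l t0 > - D \<Longrightarrow> -\<sigma> \<le> s \<Longrightarrow> s < \<sigma>' \<Longrightarrow> \<bar>- T t0 - s\<bar> < \<delta>1 \<Longrightarrow> \<bar>l t0 - z1 s\<bar> < \<delta>1 \<Longrightarrow>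
       t \<in> I \<Longrightarrow> t0 \<le> t \<Longrightarrow> near_cycle (\<epsilon>/2) (l t) (T t) (u t)"
    using approach[of "\<epsilon>/2"] \<epsilon> by (metis half_gt_zero)
  obtain \<delta>2 where \<delta>2: "\<delta>2 > 0"
    "\<And>I l T u t0 t s. abs_solution (mirror f) 1 1 0 D I l T u \<Longrightarrow> is_interval I \<Longrightarrow> t0 \<in> I \<Longrightarrow> u t0 = - 1 \<Longrightarrow>
       l t0 > - D \<Longrightarrow> -\<sigma>' \<le> s \<Longrightarrow> s < \<sigma> \<Longrightarrow> \<bar>- T t0 - s\<bar> < \<delta>2 \<Longrightarrow> \<bar>l t0 - z2 s\<bar> < \<delta>2 \<Longrightarrow>
       t \<in> I \<Longrightarrow> t0 \<le> t \<Longrightarrow> m.near_cycle (\<epsilon>/2) (l t) (T t) (u t)"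
    using m.approach[of "\<epsilon>/2"] \<epsilon> by (metis half_gt_zero)
  define \<delta> where "\<delta> = Min {\<delta>1, \<delta>2, 1}"
  have \<delta>: "\<delta> > 0" "\<delta> \<le> \<delta>1" "\<delta> \<le> \<delta>2" "\<delta> \<le> 1" using \<delta>1(1) \<delta>2(1) by (auto simp: \<delta>_def)
  have st: "shifted_state f 1 0 (x, y, v) = (x, y, v)" for x y v
    by (simp add: shifted_state_def f_zero)
  have D: "D > 0" using range_facts by simp
  have "\<forall>t\<in>{0..\<tau>}. infdist (l t, T t, u t) cycle_set < \<epsilon>"
    if \<tau>: "\<tau> > 0" and sol: "abs_solution f 1 1 0 D {0..\<tau>} l T u" and rc: "relay_consistent 1 0 D (l 0) (u 0)"
      and close: "infdist (l 0, T 0, u 0) cycle_set < \<delta>" for \<tau> l T u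
  proof
    fix t assume t: "t \<in> {0..\<tau>}"
    have I: "is_interval {0..\<tau>}" and 0: "0 \<in> {0..\<tau>}" "0 \<le> t" using \<tau> t by auto
    have ne: "cycle_set \<noteq> {}" using \<sigma> range_facts \<sigma>'_range by (auto simp: cycle_set_def)
    then have "(INF q\<in>cycle_set. dist (l 0, T 0, u 0) q) < \<delta>" using close by (simp add: infdist_def)
    then obtain q where q: "q \<in> cycle_set" "dist (l 0, T 0, u 0) q < \<delta>"
      using ne by (subst (asm) cINF_less_iff) (auto intro: bdd_belowI[of _ 0])
    obtain x y v where qe: "q = (x, y, v)" by (cases q)
    have dx: "\<bar>l 0 - x\<bar> < \<delta>" using dist_fst_le[of "(l 0, T 0, u 0)" q] q qe by (simp add: dist_real_def)
    have dyv: "dist (T 0, u 0) (y, v) < \<delta>" using dist_snd_le[of "(l 0, T 0, u 0)" q] q qe by simp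
    have dy: "\<bar>T 0 - y\<bar> < \<delta>" using dist_fst_le[of "(T 0, u 0)" "(y, v)"] dyv by (simp add: dist_real_def)
    have dv: "\<bar>u 0 - v\<bar> < \<delta>" using dist_snd_le[of "(T 0, u 0)" "(y, v)"] dyv by (simp add: dist_real_def)
    have uv: "u 0 \<in> {- 1, 1}" "l 0 = D \<longrightarrow> u 0 = - 1" "l 0 = - D \<longrightarrow> u 0 = 1"
      using sol 0 by (auto simp: abs_solution_def relay_rule_def)
    have "near_cycle (\<epsilon>/2) (l t) (T t) (u t)"
      using q(1)[unfolded cycle_set_def qe]
    proof (elim UnE imageE)
      fix s assume s: "(x, y, v) = (z1 s, - s, - 1)" "s \<in> {-\<sigma>..<\<sigma>'}"
      then have u: "u 0 = - 1" using dv uv(1) \<delta>(4) by auto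
      have "l 0 > - D"
      proof (rule ccontr)
        assume "\<not> l 0 > - D"
        then have "l 0 < - D" using uv u by auto
        then have "l 0 * D < - D * D" using D by (intro mult_strict_right_mono)
        then show False using rc u by (auto simp: relay_consistent_def power2_eq_square)
      qed
      then show ?thesis
        using \<delta>1(2)[OF sol I 0(1) u _ _ _ _ _ t 0(2), of s] s dx dy \<delta> by auto
    next
      fix s assume s: "(x, y, v) = (- z2 s, s, 1)" "s \<in> {-\<sigma>'..<\<sigma>}"
      then have u: "u 0 = 1" using dv uv(1) \<delta>(4) by auto
      have "l 0 < D"
      proof (rule ccontr)
        assume "\<not> l 0 < D"
        then have "l 0 > D" using uv u by auto
        then have "D * D < l 0 * D" using D by (intro mult_strict_right_mono)
        then show False using rc u by (auto simp: relay_consistent_def power2_eq_square)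
      qed
      then have "m.near_cycle (\<epsilon>/2) (- l t) (- T t) (- u t)"
        using \<delta>2(2)[OF abs_solution_mirror[OF sol] I 0(1) _ _ _ _ _ _ t 0(2), of s] s dx dy u \<delta> by auto
      then show ?thesis unfolding near_cycle_mirror .
    qed
    then show "infdist (l t, T t, u t) cycle_set < \<epsilon>" using near_cycle_infdist by fastforce
  qed
  then show "\<exists>\<delta>>0. \<forall>\<tau>>0. \<forall>l T u. abs_solution f 1 1 0 D {0..\<tau>} l T u \<and>
      relay_consistent 1 0 D (l 0) (u 0) \<and>
      infdist (shifted_state f 1 0 (l 0, T 0, u 0)) cycle_set < \<delta> \<longrightarrow>
      (\<forall>t\<in>{0..\<tau>}. infdist (shifted_state f 1 0 (l t, T t, u t)) cycle_set < \<epsilon>)"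
    unfolding st using \<delta>(1) by blast
qed

lemma limit_cycle: "limit_cycle_from f 1 1 0 D (D, \<sigma>) cycle_set"
proof -
  have st: "shifted_state f 1 0 (x, y, v) = (x, y, v)" for x y v
    by (simp add: shifted_state_def f_zero)
  have "(\<lambda>t. (cyc_l t, cyc_T t, cyc_u t)) ` {0..} = cycle_set"
    by (rule orbit_eq_cycle[OF cycle_solution order_refl cycle_start])
  then have orbit: "cycle_set = (\<lambda>t. shifted_state f 1 0 (cyc_l t, cyc_T t, cyc_u t)) ` {0..}"
    unfolding st by simp
  have nonconst: "\<exists>t\<ge>0. (cyc_l t, cyc_T t) \<noteq> (cyc_l 0, cyc_T 0)"
    using cycle_nonconstant half_period_pos by (intro exI[of _ "half_period / 2"]) auto
  show ?thesis
    unfolding limit_cycle_from_def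
    by (rule exI[of _ cyc_l], rule exI[of _ cyc_T], rule exI[of _ cyc_u], rule exI[of _ "2 * half_period"])
       (use cycle_solution cycle_start cycle_periodic half_period_pos nonconst orbit f_zero in simp)
qed

lemma limit_cycle_unique:
  assumes "limit_cycle_from f 1 1 0 D (D, y) \<Gamma>" "lo \<le> \<bar>y\<bar>" "2 * \<bar>y\<bar> \<le> E"
  shows "\<Gamma> = cycle_set"
proof -
  have st: "shifted_state f 1 0 (x, y, v) = (x, y, v)" for x y v
    by (simp add: shifted_state_def f_zero)
  obtain l T u P where sol: "abs_solution f 1 1 0 D {0..} l T u"
    and init: "(l 0 - 0, T 0 - f 0 / 1) = (D, y)"
    and P: "P > 0" "\<forall>t\<ge>0. l (t + P) = l t \<and> T (t + P) = T t \<and> u (t + P) = u t"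
    and \<Gamma>: "\<Gamma> = (\<lambda>t. shifted_state f 1 0 (l t, T t, u t)) ` {0..}"
    using assms(1) unfolding limit_cycle_from_def by blast
  have "l 0 = D" "T 0 = y" using init f_zero by auto
  then show ?thesis
    using periodic_orbit_unique[OF sol P(1)] P(2) assms(2,3) unfolding \<Gamma> st by auto
qed

end

section \<open>Transfer of limit cycles and stability\<close>

lemma time_rescale_image:
  fixes c :: real
  assumes "c > 0"
  shows "{t. t / c \<in> {0..}} = {0..}" "{t. t / c \<in> {0..\<tau>}} = {0..\<tau> * c}"
  using assms by (auto simp: field_simps)

definition diag :: "real \<Rightarrow> real \<Rightarrow> real \<Rightarrow> real \<times> real \<times> real \<Rightarrow> real \<times> real \<times> real" where
  "diag a b e = (\<lambda>(x, y, v). (a * x, b * y, e * v))"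

lemma diag_inverse:
  assumes "a \<noteq> 0" "b \<noteq> 0" "e \<noteq> 0"
  shows "diag (1 / a) (1 / b) (1 / e) (diag a b e p) = p"
  using assms by (cases p) (simp add: diag_def)

text \<open>
  Transfers distances from orbits between the original and the normalised coordinates; applied to the inverse map
  it gives the reverse estimate.
\<close>

lemma infdist_diag_le: "infdist (diag a b e p) (diag a b e ` \<Gamma>) \<le> (\<bar>a\<bar> + \<bar>b\<bar> + \<bar>e\<bar>) * infdist p \<Gamma>"
proof (cases "\<Gamma> = {}")
  case False
  let ?M = "\<bar>a\<bar> + \<bar>b\<bar> + \<bar>e\<bar>"
  have le: "dist (diag a b e p) (diag a b e q) \<le> ?M * dist p q" for p q
  proof -
    obtain x y v x' y' v' where pq: "p = (x, y, v)" "q = (x', y', v')" by (metis prod_cases3)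
    have 1: "\<bar>x - x'\<bar> \<le> dist p q" using dist_fst_le[of p q] pq by (simp add: dist_real_def)
    have 2: "dist (y, v) (y', v') \<le> dist p q" using dist_snd_le[of p q] pq by simp
    have 3: "\<bar>y - y'\<bar> \<le> dist p q" using dist_fst_le[of "(y, v)" "(y', v')"] 2 by (simp add: dist_real_def)
    have 4: "\<bar>v - v'\<bar> \<le> dist p q" using dist_snd_le[of "(y, v)" "(y', v')"] 2 by (simp add: dist_real_def)
    have "dist (diag a b e p) (diag a b e q) \<le> \<bar>a * x - a * x'\<bar> + \<bar>b * y - b * y'\<bar> + \<bar>e * v - e * v'\<bar>"
      unfolding pq diag_def prod.case by (rule dist_triple_le)
    also have "\<dots> = \<bar>a\<bar> * \<bar>x - x'\<bar> + \<bar>b\<bar> * \<bar>y - y'\<bar> + \<bar>e\<bar> * \<bar>v - v'\<bar>"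
      by (simp only: right_diff_distrib[symmetric] abs_mult)
    also have "\<dots> \<le> \<bar>a\<bar> * dist p q + \<bar>b\<bar> * dist p q + \<bar>e\<bar> * dist p q"
      using 1 3 4 by (intro add_mono mult_left_mono) auto
    finally show ?thesis by (simp add: algebra_simps)
  qed
  show ?thesis
  proof (cases "?M = 0")
    case True
    obtain q where "q \<in> \<Gamma>" using False by blast
    then have "infdist (diag a b e p) (diag a b e ` \<Gamma>) \<le> dist (diag a b e p) (diag a b e q)"
      by (intro infdist_le imageI)
    also have "\<dots> \<le> ?M * dist p q" by (rule le)
    also have "\<dots> = ?M * infdist p \<Gamma>" unfolding True by simp
    finally show ?thesis .
  next
    case M: False
    then have M: "?M > 0" by (metis abs_ge_zero add_nonneg_nonneg less_eq_real_def)
    have "infdist (diag a b e p) (diag a b e ` \<Gamma>) / ?M \<le> dist p q" if "q \<in> \<Gamma>" for q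
    proof -
      have "infdist (diag a b e p) (diag a b e ` \<Gamma>) \<le> dist (diag a b e p) (diag a b e q)"
        using that by (intro infdist_le) auto
      also have "\<dots> \<le> ?M * dist p q" by (rule le)
      finally show ?thesis using M by (simp add: pos_divide_le_eq mult.commute)
    qed
    then have "infdist (diag a b e p) (diag a b e ` \<Gamma>) / ?M \<le> infdist p \<Gamma>"
      unfolding infdist_notempty[OF False] using False by (intro cINF_greatest) auto
    then show ?thesis using M by (simp add: pos_divide_le_eq mult.commute)
  qed
qed (simp add: infdist_def)

text \<open>
  The equilibrium \<open>(l0, F l0 / F0)\<close> is carried to \<open>(l0', F' l0' / F0')\<close>, so in shifted coordinates the change
  becomes the diagonal map \<open>diag A B (B / c)\<close>.
\<close>

locale affine_equivalence =
  fixes F F' :: "real \<Rightarrow> real" and F0 F0' k k' l0 l0' A B c :: real and a0 b0 :: real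
  assumes c: "c > 0" and A: "A \<noteq> 0" and B: "B \<noteq> 0" and F0: "F0 \<noteq> 0" "F0' \<noteq> 0"
    and rhs: "\<And>x y. - F' (A * x + a0) + F0' * (B * y + b0) = A / c * (- F x + F0 * y)"
    and k': "k' = B * k / c" and l0': "l0' = A * l0 + a0"
begin

lemma solution:
  assumes "abs_solution F F0 k l0 \<Delta> I l T u"
  shows "abs_solution F' F0' k' l0' (A * \<Delta>) {t. t / c \<in> I}
    (\<lambda>t. A * l (t / c) + a0) (\<lambda>t. B * T (t / c) + b0) (\<lambda>t. B * u (t / c) / c)"
  by (rule abs_solution_affine[OF assms c A B rhs k' refl l0'])

lemma equilibrium: "F' l0' / F0' = B * (F l0 / F0) + b0"
  using rhs[of l0 "F l0 / F0"] F0 unfolding l0' by (simp add: field_simps)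

lemma shifted:
  "shifted_state F' F0' l0' (A * x + a0, B * y + b0, B * v / c) =
    diag A B (B / c) (shifted_state F F0 l0 (x, y, v))"
  unfolding shifted_state_def diag_def prod.case equilibrium by (simp add: l0' algebra_simps)

lemma limit_cycle_transfer:
  assumes "limit_cycle_from F F0 k l0 \<Delta> (x, y) \<Gamma>"
  shows "limit_cycle_from F' F0' k' l0' (A * \<Delta>) (A * x, B * y) (diag A B (B / c) ` \<Gamma>)"
proof -
  obtain l T u P where sol: "abs_solution F F0 k l0 \<Delta> {0..} l T u"
    and init: "(l 0 - l0, T 0 - F l0 / F0) = (x, y)"
    and P: "P > 0" "\<forall>t\<ge>0. l (t + P) = l t \<and> T (t + P) = T t \<and> u (t + P) = u t"
    and nc: "\<exists>t\<ge>0. (l t, T t) \<noteq> (l 0, T 0)"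
    and \<Gamma>: "\<Gamma> = (\<lambda>t. shifted_state F F0 l0 (l t, T t, u t)) ` {0..}"
    using assms unfolding limit_cycle_from_def by blast
  let ?l = "\<lambda>t. A * l (t / c) + a0" and ?T = "\<lambda>t. B * T (t / c) + b0" and ?u = "\<lambda>t. B * u (t / c) / c"
  have "abs_solution F' F0' k' l0' (A * \<Delta>) {0..} ?l ?T ?u"
    using solution[OF sol] unfolding time_rescale_image(1)[OF c] .
  moreover have "(?l 0 - l0', ?T 0 - F' l0' / F0') = (A * x, B * y)"
  proof -
    have "?T 0 - F' l0' / F0' = B * (T 0 - F l0 / F0)"
      unfolding equilibrium by (simp add: right_diff_distrib)
    moreover have "?l 0 - l0' = A * (l 0 - l0)"
      unfolding l0' by (simp add: right_diff_distrib)
    ultimately show ?thesis using init by simp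
  qed
  moreover have "P * c > 0" using P c by simp
  moreover have "\<forall>t\<ge>0. ?l (t + P * c) = ?l t \<and> ?T (t + P * c) = ?T t \<and> ?u (t + P * c) = ?u t"
  proof (intro allI impI)
    fix t :: real assume t: "t \<ge> 0"
    have "(t + P * c) / c = t / c + P" using c by (simp add: field_simps)
    moreover have "t / c \<ge> 0" using t c by simp
    ultimately show "?l (t + P * c) = ?l t \<and> ?T (t + P * c) = ?T t \<and> ?u (t + P * c) = ?u t"
      using P(2) by simp
  qed
  moreover have "\<exists>t\<ge>0. (?l t, ?T t) \<noteq> (?l 0, ?T 0)"
  proof -
    obtain t where "t \<ge> 0" "(l t, T t) \<noteq> (l 0, T 0)" using nc by blast
    then show ?thesis using c A B by (intro exI[of _ "t * c"]) auto
  qed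
  moreover have "diag A B (B / c) ` \<Gamma> = (\<lambda>t. shifted_state F' F0' l0' (?l t, ?T t, ?u t)) ` {0..}"
  proof -
    have "(\<lambda>t. t / c) ` {0..} = {0..}"
    proof
      show "{0..} \<subseteq> (\<lambda>t. t / c) ` {0..}" using c by (auto intro!: image_eqI[of _ _ "_ * c"])
    qed (use c in auto)
    then have "diag A B (B / c) ` \<Gamma> =
        (\<lambda>t. diag A B (B / c) (shifted_state F F0 l0 (l t, T t, u t))) ` (\<lambda>t. t / c) ` {0..}"
      unfolding \<Gamma> by (simp add: image_image)
    then show ?thesis unfolding shifted image_image .
  qed
  ultimately show ?thesis unfolding limit_cycle_from_def by blast
qed

lemma stability_transfer:
  assumes stable: "orbitally_stable F' F0' k' l0' (A * \<Delta>) (diag A B (B / c) ` \<Gamma>)"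
  shows "orbitally_stable F F0 k l0 \<Delta> \<Gamma>"
  unfolding orbitally_stable_def
proof (intro allI impI)
  let ?S = "diag A B (B / c)"
  fix \<epsilon> :: real assume \<epsilon>: "\<epsilon> > 0"
  define M where "M = \<bar>A\<bar> + \<bar>B\<bar> + \<bar>B / c\<bar>"
  define M' where "M' = \<bar>1 / A\<bar> + \<bar>1 / B\<bar> + \<bar>1 / (B / c)\<bar>"
  have M: "M > 0" "M' > 0" using A B c by (auto simp: M_def M'_def intro!: add_pos_nonneg)
  have up: "infdist (?S p) (?S ` \<Gamma>) \<le> M * infdist p \<Gamma>" for p
    unfolding M_def by (rule infdist_diag_le)
  have down: "infdist p \<Gamma> \<le> M' * infdist (?S p) (?S ` \<Gamma>)" for p
  proof -
    have inv: "diag (1 / A) (1 / B) (1 / (B / c)) (?S q) = q" for q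
      using A B c by (intro diag_inverse) auto
    show ?thesis
      using infdist_diag_le[of "1 / A" "1 / B" "1 / (B / c)" "?S p" "?S ` \<Gamma>"]
      unfolding image_image inv M'_def by simp
  qed
  obtain \<delta>' where \<delta>': "\<delta>' > 0" and st: "\<And>\<tau> l T u t. \<tau> > 0 \<Longrightarrow>
      abs_solution F' F0' k' l0' (A * \<Delta>) {0..\<tau>} l T u \<Longrightarrow>
      relay_consistent k' l0' (A * \<Delta>) (l 0) (u 0) \<Longrightarrow>
      infdist (shifted_state F' F0' l0' (l 0, T 0, u 0)) (?S ` \<Gamma>) < \<delta>' \<Longrightarrow> t \<in> {0..\<tau>} \<Longrightarrow>
      infdist (shifted_state F' F0' l0' (l t, T t, u t)) (?S ` \<Gamma>) < \<epsilon> / M'"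
    using stable \<epsilon> M unfolding orbitally_stable_def by (metis divide_pos_pos)
  have "infdist (shifted_state F F0 l0 (l t, T t, u t)) \<Gamma> < \<epsilon>"
    if \<tau>: "\<tau> > 0" and sol: "abs_solution F F0 k l0 \<Delta> {0..\<tau>} l T u"
      and rc: "relay_consistent k l0 \<Delta> (l 0) (u 0)"
      and near: "infdist (shifted_state F F0 l0 (l 0, T 0, u 0)) \<Gamma> < \<delta>' / M" and t: "t \<in> {0..\<tau>}"
    for \<tau> l T u t
  proof -
    let ?l = "\<lambda>t. A * l (t / c) + a0" and ?T = "\<lambda>t. B * T (t / c) + b0" and ?u = "\<lambda>t. B * u (t / c) / c"
    have 1: "abs_solution F' F0' k' l0' (A * \<Delta>) {0..\<tau> * c} ?l ?T ?u"
      using solution[OF sol] unfolding time_rescale_image(2)[OF c] .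
    have A2: "A\<^sup>2 > 0" using A by simp
    have sq: "(?l 0 - l0') * (A * \<Delta>) = A\<^sup>2 * ((l 0 - l0) * \<Delta>)" "(A * \<Delta>)\<^sup>2 = A\<^sup>2 * \<Delta>\<^sup>2"
      by (simp_all add: l0' power2_eq_square algebra_simps)
    have cancel: "A\<^sup>2 * ((l 0 - l0) * \<Delta>) > A\<^sup>2 * \<Delta>\<^sup>2 \<longleftrightarrow> (l 0 - l0) * \<Delta> > \<Delta>\<^sup>2"
      "A\<^sup>2 * ((l 0 - l0) * \<Delta>) < - (A\<^sup>2 * \<Delta>\<^sup>2) \<longleftrightarrow> (l 0 - l0) * \<Delta> < - \<Delta>\<^sup>2"
      using A2 mult_less_cancel_left_pos[OF A2, of "\<Delta>\<^sup>2"]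
        mult_less_cancel_left_pos[OF A2, of "(l 0 - l0) * \<Delta>" "- \<Delta>\<^sup>2"] by simp_all
    have "B * u 0 / c = - (B * k / c)" if "u 0 = - k" using that by simp
    then have 2: "relay_consistent k' l0' (A * \<Delta>) (?l 0) (?u 0)"
      using rc unfolding relay_consistent_def k' sq cancel by auto
    have "infdist (?S (shifted_state F F0 l0 (l 0, T 0, u 0))) (?S ` \<Gamma>) < \<delta>'"
      using up[of "shifted_state F F0 l0 (l 0, T 0, u 0)"] near M by (simp add: pos_less_divide_eq mult.commute)
    then have 3: "infdist (shifted_state F' F0' l0' (?l 0, ?T 0, ?u 0)) (?S ` \<Gamma>) < \<delta>'"
      unfolding shifted by simp
    have "\<tau> * c > 0" "t * c \<in> {0..\<tau> * c}" using \<tau> c t by auto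
    from st[OF this(1) 1 2 3 this(2)]
    have "infdist (?S (shifted_state F F0 l0 (l t, T t, u t))) (?S ` \<Gamma>) < \<epsilon> / M'"
      unfolding shifted using c by simp
    then show ?thesis
      using down[of "shifted_state F F0 l0 (l t, T t, u t)"] M by (simp add: pos_less_divide_eq mult.commute)
  qed
  then show "\<exists>\<delta>>0. \<forall>\<tau>>0. \<forall>l T u. abs_solution F F0 k l0 \<Delta> {0..\<tau>} l T u \<and>
      relay_consistent k l0 \<Delta> (l 0) (u 0) \<and>
      infdist (shifted_state F F0 l0 (l 0, T 0, u 0)) \<Gamma> < \<delta> \<longrightarrow>
      (\<forall>t\<in>{0..\<tau>}. infdist (shifted_state F F0 l0 (l t, T t, u t)) \<Gamma> < \<epsilon>)"
    using \<delta>' M by (intro exI[of _ "\<delta>' / M"]) auto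
qed

end

section \<open>The normalised system\<close>

lemma local_drag_extends:
  fixes f :: "real \<Rightarrow> real"
  assumes "\<rho> > 0" "f 0 = 0"
    and slope: "\<And>x y. \<bar>x\<bar> \<le> \<rho> \<Longrightarrow> \<bar>y\<bar> \<le> \<rho> \<Longrightarrow> x \<le> y \<Longrightarrow>
      9/10 * (y - x) \<le> f y - f x \<and> f y - f x \<le> 11/10 * (y - x)"
  obtains g where "drag g" "\<And>x. \<bar>x\<bar> \<le> \<rho> \<Longrightarrow> f x = g x"
proof -
  define cl :: "real \<Rightarrow> real" where "cl x = max (- \<rho>) (min \<rho> x)" for x
  define g where "g x = f (cl x) + (x - cl x)" for x
  have id: "cl x = x" if "\<bar>x\<bar> \<le> \<rho>" for x using that by (auto simp: cl_def abs_le_iff)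
  have "drag g"
    unfolding drag_def
  proof (intro conjI allI impI)
    show "g 0 = 0" using assms id[of 0] by (simp add: g_def)
    fix x y :: real assume xy: "x \<le> y"
    have cl: "\<bar>cl x\<bar> \<le> \<rho>" "\<bar>cl y\<bar> \<le> \<rho>" "cl x \<le> cl y" using xy assms(1) by (auto simp: cl_def abs_le_iff)
    have rest: "cl y - cl x \<le> y - x" using xy assms(1) by (auto simp: cl_def max_def min_def)
    show "9/10 * (y - x) \<le> g y - g x" "g y - g x \<le> 11/10 * (y - x)"
      using slope[OF cl] rest unfolding g_def by argo+
  qed
  moreover have "f x = g x" if "\<bar>x\<bar> \<le> \<rho>" for x using id[OF that] by (simp add: g_def)
  ultimately show ?thesis using that by blast
qed

text \<open>
  The choice of \<open>E\<close> keeps arcs inside the interval where \<open>f\<close> has controlled slope and makes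
  \<open>100 D \<le> lo^2\<close> follow from \<open>D = \<mu> lo^3\<close>; the choice of \<open>D0\<close> makes the window of torques long enough to contain the
  fixed point.
\<close>

lemma normalised_limit_cycle:
  fixes f :: "real \<Rightarrow> real"
  assumes \<rho>: "\<rho> > 0" and f0: "f 0 = 0" and \<mu>: "\<mu> \<ge> 1"
    and slope: "\<And>x y. \<bar>x\<bar> \<le> \<rho> \<Longrightarrow> \<bar>y\<bar> \<le> \<rho> \<Longrightarrow> x \<le> y \<Longrightarrow>
      9/10 * (y - x) \<le> f y - f x \<and> f y - f x \<le> 11/10 * (y - x)"
  obtains E D0 Y G where "E > 0" "D0 > 0"
    "\<forall>D. 0 < D \<and> D < D0 \<longrightarrow>
       limit_cycle_from f 1 1 0 D (D, Y D) (G D) \<and>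
       root 3 (D / \<mu>) \<le> Y D \<and> Y D \<le> (1 + 20 * \<mu>) * root 3 (D / \<mu>) \<and>
       orbitally_stable f 1 1 0 D (G D) \<and>
       (\<forall>y \<Gamma>. limit_cycle_from f 1 1 0 D (D, y) \<Gamma> \<and>
          root 3 (D / \<mu>) \<le> \<bar>y\<bar> \<and> 2 * \<bar>y\<bar> \<le> E \<longrightarrow> \<Gamma> = G D)"
proof -
  obtain g where g: "drag g" "\<And>x. \<bar>x\<bar> \<le> \<rho> \<Longrightarrow> f x = g x"
    using local_drag_extends[OF \<rho> f0 slope] by blast
  define E where "E = min (1/100) (min (1 / (100 * \<mu>)) (\<rho> / 2))"
  have E: "E > 0" "E \<le> 1/100" "E \<le> 1 / (100 * \<mu>)" "E \<le> \<rho> / 2" using \<rho> \<mu> by (auto simp: E_def)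
  have "E\<^sup>2 \<le> 1 * E" unfolding power2_eq_square using E by (intro mult_right_mono) auto
  then have E2: "E\<^sup>2 < \<rho>" using E \<rho> by linarith
  define M where "M = 1 + 20 * \<mu>"
  have M: "M \<ge> 1" using \<mu> by (simp add: M_def)
  define D0 where "D0 = \<mu> * (E / M) ^ 3"
  have D0: "D0 > 0" using E M \<mu> by (simp add: D0_def)
  define good where "good D y \<Gamma> \<longleftrightarrow>
      limit_cycle_from f 1 1 0 D (D, y) \<Gamma> \<and> root 3 (D / \<mu>) \<le> y \<and> y \<le> M * root 3 (D / \<mu>) \<and>
      orbitally_stable f 1 1 0 D \<Gamma> \<and>
      (\<forall>y' \<Gamma>'. limit_cycle_from f 1 1 0 D (D, y') \<Gamma>' \<and> root 3 (D / \<mu>) \<le> \<bar>y'\<bar> \<and> 2 * \<bar>y'\<bar> \<le> E \<longrightarrow> \<Gamma>' = \<Gamma>)"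
    for D y \<Gamma>
  have "\<exists>y \<Gamma>. good D y \<Gamma>" if D: "0 < D" "D < D0" for D
  proof -
    define lo where "lo = root 3 (D / \<mu>)"
    have lo: "lo > 0" "lo ^ 3 = D / \<mu>" using D \<mu> by (auto simp: lo_def)
    have D_eq: "D = \<mu> * lo ^ 3" using lo \<mu> by simp
    have "lo ^ 3 < (E / M) ^ 3" using D(2) \<mu> unfolding D0_def D_eq by simp
    then have "lo < E / M" by (rule power_less_imp_less_base) (use E M in auto)
    then have lo_E: "M * lo \<le> E" using M by (simp add: field_simps)
    have "1 * lo \<le> M * lo" using M lo by (intro mult_right_mono) auto
    then have lo_le: "lo \<le> E" using lo_E by simp
    then have "lo \<le> 1 / (100 * \<mu>)" using E by linarith
    then have "100 * \<mu> * lo \<le> 1" using \<mu> by (simp add: field_simps)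
    then have "100 * \<mu> * lo * lo\<^sup>2 \<le> 1 * lo\<^sup>2" by (intro mult_right_mono) auto
    then have DL: "100 * D \<le> lo\<^sup>2" unfolding D_eq by (simp add: power2_eq_square power3_eq_cube mult_ac)
    have "lo \<le> 1/100" using lo_le E(2) by linarith
    then have "operating_range D \<mu> lo E"
      unfolding operating_range_def admissible_def
      by (intro conjI D(1) lo(1) DL D_eq \<mu> lo_E[unfolded M_def] E(2))
    then interpret relay_system f g \<rho> D \<mu> lo E
      by unfold_locales (use g E2 in auto)
    obtain \<sigma> where \<sigma>: "lo < \<sigma>" "\<sigma> < (1 + 20 * \<mu>) * lo" "half_map (mirror g) D (half_map g D \<sigma>) = \<sigma>"
      using full_turn_fixed_point[OF drag drag_mirror[OF drag] range] by blast
    have r: "lo \<le> \<sigma>" "\<sigma> \<le> E" using \<sigma> range_facts by auto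
    have r': "lo \<le> half_map g D \<sigma>" "half_map g D \<sigma> \<le> E" using half_map_range(2,3)[OF drag range r] by auto
    obtain z1 where z1: "half_turn g D \<sigma> z1 (half_map g D \<sigma>)"
      using half_map_turn[OF drag range_admissible[OF r]] by blast
    obtain z2 where z2: "half_turn (mirror g) D (half_map g D \<sigma>) z2 \<sigma>"
      using half_map_turn[OF drag_mirror[OF drag] range_admissible[OF r']] \<sigma>(3) by metis
    interpret relay_cycle_system f g \<rho> D \<mu> lo E \<sigma> "half_map g D \<sigma>" z1 z2
      by unfold_locales (use \<sigma> z1 z2 in auto)
    show ?thesis
      using limit_cycle cycle_stable limit_cycle_unique \<sigma>(1,2) unfolding good_def lo_def[symmetric] M_def
      by (intro exI[of _ \<sigma>] exI[of _ cycle_set]) auto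
  qed
  then obtain Y G where "\<forall>D. 0 < D \<and> D < D0 \<longrightarrow> good D (Y D) (G D)"
    by metis
  then show ?thesis
    unfolding good_def M_def by (rule that[OF E(1) D0])
qed

section \<open>The braking system\<close>

lemma slopes_near_point:
  fixes F :: "real \<Rightarrow> real"
  assumes F: "\<And>x. (F has_real_derivative F' x) (at x)" and cont: "isCont F' x0" and c: "F' x0 = c" "c > 0"
  obtains \<rho> where "\<rho> > 0" "\<And>x y. \<bar>x - x0\<bar> \<le> \<rho> \<Longrightarrow> \<bar>y - x0\<bar> \<le> \<rho> \<Longrightarrow> x \<le> y \<Longrightarrow>
    9/10 * c * (y - x) \<le> F y - F x \<and> F y - F x \<le> 11/10 * c * (y - x)"
proof -
  have "c / 10 > 0" using c by simp
  then obtain d where d: "d > 0" "\<And>x. dist x x0 < d \<Longrightarrow> dist (F' x) (F' x0) < c / 10"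
    using cont unfolding continuous_at_eps_delta by blast
  show ?thesis
  proof (rule that[of "d / 2"])
    fix x y assume xy: "\<bar>x - x0\<bar> \<le> d / 2" "\<bar>y - x0\<bar> \<le> d / 2" "x \<le> y"
    show "9/10 * c * (y - x) \<le> F y - F x \<and> F y - F x \<le> 11/10 * c * (y - x)"
    proof (cases "x = y")
      case False
      then have "x < y" using xy by simp
      then obtain w where w: "x < w" "w < y" "F y - F x = (y - x) * F' w"
        using MVT2[of x y F F'] F by blast
      have "\<bar>w - x0\<bar> < d" using w(1,2) xy d(1) unfolding abs_le_iff abs_less_iff by argo
      then have "\<bar>F' w - c\<bar> < c / 10" using d(2)[of w] c by (simp add: dist_real_def)
      then have Fw: "9/10 * c \<le> F' w" "F' w \<le> 11/10 * c" unfolding abs_less_iff by argo+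
      have "9/10 * c * (y - x) \<le> F' w * (y - x)" "F' w * (y - x) \<le> 11/10 * c * (y - x)"
        using Fw \<open>x < y\<close> by (auto intro!: mult_right_mono)
      then show ?thesis using w(3) by (simp add: mult.commute)
    qed simp
  qed (use d in simp)
qed

lemma slip_drag_C1:
  obtains F' where "\<And>x. (slip_drag \<nu> r J m\<^sub>q F\<^sub>z \<theta>1 \<theta>2 \<theta>3 has_real_derivative F' x) (at x)" "\<And>x. isCont F' x"
proof
  let ?F' = "\<lambda>l. 1 / \<nu> * F\<^sub>z * (- (1 / m\<^sub>q) * (\<theta>1 * (1 - exp (- l * \<theta>2)) - l * \<theta>3) +
    ((1 - l) / m\<^sub>q + r\<^sup>2 / J) * (\<theta>1 * (\<theta>2 * exp (- l * \<theta>2)) - \<theta>3))"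
  show "(slip_drag \<nu> r J m\<^sub>q F\<^sub>z \<theta>1 \<theta>2 \<theta>3 has_real_derivative ?F' x) (at x)" for x
  proof -
    have 1: "((\<lambda>l. (1 - l) / m\<^sub>q + r\<^sup>2 / J) has_real_derivative (- (1 / m\<^sub>q))) (at x)"
      using DERIV_add[OF DERIV_cdivide[OF DERIV_diff[OF DERIV_const DERIV_ident], of 1 "m\<^sub>q"]
          DERIV_const[of "r\<^sup>2 / J"]] by simp
    have 2: "((\<lambda>l. \<theta>1 * (1 - exp (- l * \<theta>2)) - l * \<theta>3) has_real_derivative (\<theta>1 * (\<theta>2 * exp (- x * \<theta>2)) - \<theta>3)) (at x)"
      by (rule derivative_eq_intros refl | simp)+
    from DERIV_cmult[OF DERIV_mult[OF 1 2], of "1 / \<nu> * F\<^sub>z"]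
    show ?thesis unfolding slip_drag_def[abs_def] tyre_friction_def by (simp add: mult_ac add_ac)
  qed
  have "continuous_on UNIV ?F'"
    unfolding divide_inverse by (intro continuous_on_add continuous_on_diff continuous_on_mult
      continuous_on_const continuous_on_id continuous_on_minus continuous_on_exp)
  then show "isCont ?F' x" for x by (simp add: continuous_on_eq_continuous_at)
qed

text \<open>
  With \<open>c = F' l0\<close> as unit of inverse time, the scale factors \<open>\<alpha>\<close> of the slip and \<open>\<beta>\<close> of the torque are determined
  by \<open>k = F0 = 1\<close> in the new coordinates.  Both have the sign of \<open>k\<close>, hence \<open>\<alpha> \<Delta> > 0\<close>.
\<close>

locale braking_system =
  fixes F :: "real \<Rightarrow> real" and F0 k l0 c :: real
  assumes F0: "F0 > 0" and k: "k \<noteq> 0" and c: "c > 0"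
begin

definition \<alpha> :: real where "\<alpha> = c\<^sup>2 / (k * F0)"
definition \<beta> :: real where "\<beta> = c / k"
definition f :: "real \<Rightarrow> real" where "f x = \<alpha> / c * (F (l0 + x / \<alpha>) - F l0)"

lemma scale_nonzero: "\<alpha> \<noteq> 0" "\<beta> \<noteq> 0"
  using F0 k c by (auto simp: \<alpha>_def \<beta>_def)

lemma scale_relation: "\<beta> = \<alpha> * F0 / c"
  using F0 k c by (simp add: \<alpha>_def \<beta>_def power2_eq_square)

lemma normalise: "affine_equivalence F f F0 1 k 1 l0 0 \<alpha> \<beta> c (- \<alpha> * l0) (- \<beta> * (F l0 / F0))"
proof
  fix x y
  have "l0 + (\<alpha> * x + - \<alpha> * l0) / \<alpha> = x" using scale_nonzero by (simp add: field_simps)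
  then have "f (\<alpha> * x + - \<alpha> * l0) = \<alpha> / c * (F x - F l0)" by (simp add: f_def)
  then show "- f (\<alpha> * x + - \<alpha> * l0) + 1 * (\<beta> * y + - \<beta> * (F l0 / F0)) = \<alpha> / c * (- F x + F0 * y)"
    using F0 c unfolding scale_relation by (simp add: field_simps)
  show "1 = \<beta> * k / c" using k c by (simp add: \<beta>_def)
qed (use c F0 scale_nonzero in auto)

lemma denormalise: "affine_equivalence f F 1 F0 1 k 0 l0 (1 / \<alpha>) (1 / \<beta>) (1 / c) l0 (F l0 / F0)"
proof
  fix x y
  have "1 / \<alpha> / (1 / c) * (- f x + 1 * y) = - (F (l0 + x / \<alpha>) - F l0) + c / \<alpha> * y"
    using scale_nonzero c by (simp add: f_def field_simps)
  moreover have "F0 * (1 / \<beta> * y + F l0 / F0) = c / \<alpha> * y + F l0"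
    using scale_nonzero F0 c unfolding scale_relation by (simp add: field_simps)
  ultimately show "- F (1 / \<alpha> * x + l0) + F0 * (1 / \<beta> * y + F l0 / F0) = 1 / \<alpha> / (1 / c) * (- f x + 1 * y)"
    by (simp add: add.commute)
  show "k = 1 / \<beta> * 1 / (1 / c)" using k c by (simp add: \<beta>_def)
qed (use c F0 scale_nonzero in auto)

lemma f_slopes:
  assumes slopes: "\<And>x y. \<bar>x - l0\<bar> \<le> \<rho> \<Longrightarrow> \<bar>y - l0\<bar> \<le> \<rho> \<Longrightarrow> x \<le> y \<Longrightarrow>
      9/10 * c * (y - x) \<le> F y - F x \<and> F y - F x \<le> 11/10 * c * (y - x)"
    and xy: "\<bar>x\<bar> \<le> \<bar>\<alpha>\<bar> * \<rho>" "\<bar>y\<bar> \<le> \<bar>\<alpha>\<bar> * \<rho>" "x \<le> y"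
  shows "9/10 * (y - x) \<le> f y - f x \<and> f y - f x \<le> 11/10 * (y - x)"
proof -
  have diff: "f y - f x = \<alpha> / c * (F (l0 + y / \<alpha>) - F (l0 + x / \<alpha>))"
    by (simp add: f_def right_diff_distrib)
  have b: "\<bar>l0 + v / \<alpha> - l0\<bar> \<le> \<rho>" if "\<bar>v\<bar> \<le> \<bar>\<alpha>\<bar> * \<rho>" for v
    using that scale_nonzero by (simp add: abs_divide pos_divide_le_eq mult.commute)
  have id: "s * c * (v - w) / \<alpha> * (\<alpha> / c) = s * (v - w)" for s v w
    using scale_nonzero c by simp
  show ?thesis
  proof (cases "\<alpha> > 0")
    case True
    have "9/10 * c * (y - x) / \<alpha> \<le> F (l0 + y / \<alpha>) - F (l0 + x / \<alpha>)"
      "F (l0 + y / \<alpha>) - F (l0 + x / \<alpha>) \<le> 11/10 * c * (y - x) / \<alpha>"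
      using slopes[OF b[OF xy(1)] b[OF xy(2)]] True xy(3)
      by (auto simp: divide_right_mono diff_divide_distrib[symmetric])
    from mult_right_mono[OF this(1), of "\<alpha> / c"] mult_right_mono[OF this(2), of "\<alpha> / c"]
    show ?thesis unfolding diff id using True c by (simp add: mult.commute)
  next
    case False
    then have neg: "\<alpha> < 0" using scale_nonzero by simp
    have "F (l0 + x / \<alpha>) - F (l0 + y / \<alpha>) \<ge> 9/10 * c * (x - y) / \<alpha>"
      "F (l0 + x / \<alpha>) - F (l0 + y / \<alpha>) \<le> 11/10 * c * (x - y) / \<alpha>"
      using slopes[OF b[OF xy(2)] b[OF xy(1)]] neg xy(3)
      by (auto simp: divide_right_mono_neg diff_divide_distrib[symmetric])
    from mult_right_mono_neg[OF this(1), of "\<alpha> / c"] mult_right_mono_neg[OF this(2), of "\<alpha> / c"]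
    have "(F (l0 + x / \<alpha>) - F (l0 + y / \<alpha>)) * (\<alpha> / c) \<le> 9/10 * (x - y)"
      "11/10 * (x - y) \<le> (F (l0 + x / \<alpha>) - F (l0 + y / \<alpha>)) * (\<alpha> / c)"
      unfolding id using neg c by (simp_all add: divide_nonpos_pos)
    moreover have "f y - f x = - ((F (l0 + x / \<alpha>) - F (l0 + y / \<alpha>)) * (\<alpha> / c))"
      unfolding diff by (simp add: algebra_simps)
    ultimately show ?thesis by argo
  qed
qed

end

theorem proposition3p2:
  fixes \<nu> r J m\<^sub>q F\<^sub>z \<theta>1 \<theta>2 \<theta>3 k l0 F0 a b m :: real
    and F :: "real \<Rightarrow> real"
  assumes "\<nu> > 0" "r > 0" "J > 0" "m\<^sub>q > 0" "F\<^sub>z > 0" "\<theta>1 > 0" "\<theta>2 > 0" "\<theta>3 > 0"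
    and "F = slip_drag \<nu> r J m\<^sub>q F\<^sub>z \<theta>1 \<theta>2 \<theta>3"
    and "F0 = r / (\<nu> * J)"
    and "F0 * k \<noteq> 0"
    and "a = 4 * (deriv F l0 / k)"
    and "b = - 4 * (k / F0)"
    and "deriv F l0 > 0"
    and "m > \<bar>a\<bar> / \<bar>b\<bar>"
  shows "\<exists>(y :: real \<Rightarrow> real) (\<Gamma> :: real \<Rightarrow> (real \<times> real \<times> real) set).
    (y \<longlongrightarrow> 0) (at 0 within {\<Delta>. \<Delta> * k > 0}) \<and>
    (\<exists>\<epsilon>>0. \<exists>\<delta>>0. \<forall>\<Delta>. \<Delta> * k > 0 \<and> \<bar>\<Delta>\<bar> < \<delta> \<longrightarrow>
       limit_cycle_from F F0 k l0 \<Delta> (\<Delta>, y \<Delta>) (\<Gamma> \<Delta>) \<and>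
       y \<Delta> \<noteq> 0 \<and> \<bar>\<Delta>\<bar> / \<bar>y \<Delta>\<bar> ^ 3 \<le> m \<and>
       orbitally_stable F F0 k l0 \<Delta> (\<Gamma> \<Delta>) \<and>
       (\<forall>y' \<Gamma>'. limit_cycle_from F F0 k l0 \<Delta> (\<Delta>, y') \<Gamma>' \<and>
          \<bar>y'\<bar> < \<epsilon> \<and> y' \<noteq> 0 \<and> \<bar>\<Delta>\<bar> / \<bar>y'\<bar> ^ 3 \<le> m \<longrightarrow> \<Gamma>' = \<Gamma> \<Delta>))"
proof -
  define c where "c = deriv F l0"
  have c: "c > 0" using assms by (simp add: c_def)
  have F0: "F0 > 0" and k: "k \<noteq> 0" using assms by auto
  obtain F' where F': "\<And>x. (F has_real_derivative F' x) (at x)" "\<And>x. isCont F' x"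
    using slip_drag_C1 unfolding assms(9) by blast
  have "F' l0 = c" unfolding c_def using DERIV_imp_deriv[OF F'(1)] by simp
  then obtain \<rho> where \<rho>: "\<rho> > 0"
    and slopes: "\<And>x y. \<bar>x - l0\<bar> \<le> \<rho> \<Longrightarrow> \<bar>y - l0\<bar> \<le> \<rho> \<Longrightarrow> x \<le> y \<Longrightarrow>
      9/10 * c * (y - x) \<le> F y - F x \<and> F y - F x \<le> 11/10 * c * (y - x)"
    using slopes_near_point[OF F'(1) F'(2) _ c] by blast
  interpret braking_system F F0 k l0 c by unfold_locales (use F0 k c in auto)
  interpret N: affine_equivalence F f F0 1 k 1 l0 0 \<alpha> \<beta> c "- \<alpha> * l0" "- \<beta> * (F l0 / F0)"
    by (rule normalise)
  interpret DN: affine_equivalence f F 1 F0 1 k 0 l0 "1 / \<alpha>" "1 / \<beta>" "1 / c" l0 "F l0 / F0"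
    by (rule denormalise)
  note nz = scale_nonzero
  define \<mu> where "\<mu> = m * k\<^sup>2 / (c * F0)"
  have "\<bar>a\<bar> / \<bar>b\<bar> = c * F0 / k\<^sup>2"
    unfolding assms(12,13) c_def[symmetric] using c F0 k
    by (simp add: abs_mult abs_divide power2_eq_square field_simps flip: abs_mult)
  then have m: "m > c * F0 / k\<^sup>2" using assms(15) by simp
  then have \<mu>: "\<mu> \<ge> 1" unfolding \<mu>_def using c F0 k by (simp add: field_simps)
  \<comment> \<open>In the new coordinates the bound \<open>m\<close> on the ratio of relay half-width and cubed torque is \<open>\<mu>\<close>.\<close>
  have ratio: "m * \<bar>\<alpha>\<bar> = \<mu> * \<bar>\<beta>\<bar> ^ 3"
    unfolding \<alpha>_def \<beta>_def \<mu>_def using c F0 k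
    by (simp add: abs_mult abs_divide field_simps power2_eq_square power3_eq_cube)
  have "f 0 = 0" by (simp add: f_def)
  have "\<bar>\<alpha>\<bar> * \<rho> > 0" using nz \<rho> by simp
  then obtain E D0 Y G where E: "E > 0" "D0 > 0"
    and all: "\<forall>D. 0 < D \<and> D < D0 \<longrightarrow>
       limit_cycle_from f 1 1 0 D (D, Y D) (G D) \<and>
       root 3 (D / \<mu>) \<le> Y D \<and> Y D \<le> (1 + 20 * \<mu>) * root 3 (D / \<mu>) \<and>
       orbitally_stable f 1 1 0 D (G D) \<and>
       (\<forall>y \<Gamma>. limit_cycle_from f 1 1 0 D (D, y) \<Gamma> \<and>
          root 3 (D / \<mu>) \<le> \<bar>y\<bar> \<and> 2 * \<bar>y\<bar> \<le> E \<longrightarrow> \<Gamma> = G D)"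
    by (rule normalised_limit_cycle[OF _ \<open>f 0 = 0\<close> \<mu> f_slopes[OF slopes]])
  have cyc: "limit_cycle_from f 1 1 0 D (D, Y D) (G D)"
    and Y: "root 3 (D / \<mu>) \<le> Y D \<and> Y D \<le> (1 + 20 * \<mu>) * root 3 (D / \<mu>)"
    and stable: "orbitally_stable f 1 1 0 D (G D)"
    and unique: "\<And>y \<Gamma>. limit_cycle_from f 1 1 0 D (D, y) \<Gamma> \<Longrightarrow>
       root 3 (D / \<mu>) \<le> \<bar>y\<bar> \<Longrightarrow> 2 * \<bar>y\<bar> \<le> E \<Longrightarrow> \<Gamma> = G D"
    if "0 < D" "D < D0" for D
    using all that by blast+
  define S where "S = diag \<alpha> \<beta> (\<beta> / c)"
  define S' where "S' = diag (1 / \<alpha>) (1 / \<beta>) (1 / \<beta> / (1 / c))"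
  have inv: "S' (S p) = p" "S (S' p) = p" for p
    using nz c by (cases p; simp add: S_def S'_def diag_def)+
  define y where "y \<Delta> = Y (\<alpha> * \<Delta>) / \<beta>" for \<Delta>
  define \<Gamma> where "\<Gamma> \<Delta> = S' ` G (\<alpha> * \<Delta>)" for \<Delta>
  define \<delta> where "\<delta> = D0 / \<bar>\<alpha>\<bar>"
  have \<delta>: "\<delta> > 0" using E nz by (simp add: \<delta>_def)
  have D: "0 < \<alpha> * \<Delta>" "\<alpha> * \<Delta> < D0" "\<alpha> * \<Delta> = \<bar>\<alpha>\<bar> * \<bar>\<Delta>\<bar>" if "\<Delta> * k > 0" "\<bar>\<Delta>\<bar> < \<delta>" for \<Delta>
  proof -
    have "\<alpha> * \<Delta> = (c\<^sup>2 / (k\<^sup>2 * F0)) * (\<Delta> * k)"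
      using k by (simp add: \<alpha>_def power2_eq_square)
    also have "\<dots> > 0"
    proof (rule mult_pos_pos[OF _ that(1)])
      show "c\<^sup>2 / (k\<^sup>2 * F0) > 0" using c k F0 by simp
    qed
    finally show pos: "0 < \<alpha> * \<Delta>" .
    then show eq: "\<alpha> * \<Delta> = \<bar>\<alpha>\<bar> * \<bar>\<Delta>\<bar>" by (simp add: abs_mult[symmetric])
    show "\<alpha> * \<Delta> < D0" unfolding eq using that(2) nz by (simp add: \<delta>_def field_simps)
  qed
  have root_le_iff: "root 3 (\<alpha> * \<Delta> / \<mu>) \<le> \<bar>\<beta> * y'\<bar> \<longleftrightarrow> \<bar>\<Delta>\<bar> / \<bar>y'\<bar> ^ 3 \<le> m"
    if "\<Delta> * k > 0" "\<bar>\<Delta>\<bar> < \<delta>" "y' \<noteq> 0" for \<Delta> y'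
  proof -
    have "root 3 (\<alpha> * \<Delta> / \<mu>) \<le> \<bar>\<beta> * y'\<bar> \<longleftrightarrow> root 3 (\<alpha> * \<Delta> / \<mu>) \<le> root 3 (\<bar>\<beta> * y'\<bar> ^ 3)"
      by (simp add: real_root_power_cancel)
    also have "\<dots> \<longleftrightarrow> \<alpha> * \<Delta> / \<mu> \<le> \<bar>\<beta> * y'\<bar> ^ 3" by (rule real_root_le_iff) simp
    also have "\<dots> \<longleftrightarrow> \<bar>\<alpha>\<bar> * \<bar>\<Delta>\<bar> \<le> \<mu> * \<bar>\<beta>\<bar> ^ 3 * \<bar>y'\<bar> ^ 3"
      unfolding D(3)[OF that(1,2)] using \<mu> by (simp add: abs_mult power_mult_distrib field_simps)
    also have "\<dots> \<longleftrightarrow> \<bar>\<alpha>\<bar> * \<bar>\<Delta>\<bar> \<le> \<bar>\<alpha>\<bar> * (m * \<bar>y'\<bar> ^ 3)"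
      unfolding ratio[symmetric] by (simp only: mult_ac)
    also have "\<dots> \<longleftrightarrow> \<bar>\<Delta>\<bar> \<le> m * \<bar>y'\<bar> ^ 3"
      using nz by (subst mult_le_cancel_left_pos) auto
    also have "\<dots> \<longleftrightarrow> \<bar>\<Delta>\<bar> / \<bar>y'\<bar> ^ 3 \<le> m"
      using that(3) by (simp add: pos_divide_le_eq)
    finally show ?thesis .
  qed
  have \<beta>y: "\<beta> * y \<Delta> = Y (\<alpha> * \<Delta>)" for \<Delta> using nz by (simp add: y_def)
  have Ypos: "Y (\<alpha> * \<Delta>) > 0" if "\<Delta> * k > 0" "\<bar>\<Delta>\<bar> < \<delta>" for \<Delta>
  proof -
    have "root 3 (\<alpha> * \<Delta> / \<mu>) > 0" using D(1)[OF that] \<mu> by simp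
    then show ?thesis using Y[OF D(1,2)[OF that]] by linarith
  qed
  have main: "limit_cycle_from F F0 k l0 \<Delta> (\<Delta>, y \<Delta>) (\<Gamma> \<Delta>) \<and>
       y \<Delta> \<noteq> 0 \<and> \<bar>\<Delta>\<bar> / \<bar>y \<Delta>\<bar> ^ 3 \<le> m \<and>
       orbitally_stable F F0 k l0 \<Delta> (\<Gamma> \<Delta>) \<and>
       (\<forall>y' \<Gamma>'. limit_cycle_from F F0 k l0 \<Delta> (\<Delta>, y') \<Gamma>' \<and>
          \<bar>y'\<bar> < E / (2 * \<bar>\<beta>\<bar>) \<and> y' \<noteq> 0 \<and> \<bar>\<Delta>\<bar> / \<bar>y'\<bar> ^ 3 \<le> m \<longrightarrow> \<Gamma>' = \<Gamma> \<Delta>)"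
    if \<Delta>: "\<Delta> * k > 0" "\<bar>\<Delta>\<bar> < \<delta>" for \<Delta>
  proof (intro conjI allI impI)
    note D\<Delta> = D(1,2)[OF \<Delta>]
    show "limit_cycle_from F F0 k l0 \<Delta> (\<Delta>, y \<Delta>) (\<Gamma> \<Delta>)"
      using DN.limit_cycle_transfer[OF cyc[OF D\<Delta>]] nz by (simp add: y_def \<Gamma>_def S'_def)
    show y0: "y \<Delta> \<noteq> 0" using Ypos[OF \<Delta>] \<beta>y[of \<Delta>] by auto
    show "\<bar>\<Delta>\<bar> / \<bar>y \<Delta>\<bar> ^ 3 \<le> m"
      using Y[OF D\<Delta>] Ypos[OF \<Delta>] root_le_iff[OF \<Delta> y0] unfolding \<beta>y by simp
    have "S ` \<Gamma> \<Delta> = G (\<alpha> * \<Delta>)" unfolding \<Gamma>_def image_image inv by simp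
    then show "orbitally_stable F F0 k l0 \<Delta> (\<Gamma> \<Delta>)"
      using stable[OF D\<Delta>] by (intro N.stability_transfer) (simp add: S_def)
    fix y' \<Gamma>'
    assume *: "limit_cycle_from F F0 k l0 \<Delta> (\<Delta>, y') \<Gamma>' \<and>
          \<bar>y'\<bar> < E / (2 * \<bar>\<beta>\<bar>) \<and> y' \<noteq> 0 \<and> \<bar>\<Delta>\<bar> / \<bar>y'\<bar> ^ 3 \<le> m"
    have "limit_cycle_from f 1 1 0 (\<alpha> * \<Delta>) (\<alpha> * \<Delta>, \<beta> * y') (S ` \<Gamma>')"
      using N.limit_cycle_transfer * unfolding S_def by blast
    moreover have "root 3 (\<alpha> * \<Delta> / \<mu>) \<le> \<bar>\<beta> * y'\<bar>" using root_le_iff[OF \<Delta>] * by blast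
    moreover have "2 * \<bar>\<beta> * y'\<bar> \<le> E"
    proof -
      have "\<bar>y'\<bar> * (2 * \<bar>\<beta>\<bar>) < E" using * nz by (simp add: pos_less_divide_eq)
      then show ?thesis by (simp add: abs_mult mult_ac)
    qed
    ultimately have "S ` \<Gamma>' = G (\<alpha> * \<Delta>)" by (rule unique[OF D\<Delta>])
    then have "S' ` S ` \<Gamma>' = \<Gamma> \<Delta>" by (simp add: \<Gamma>_def)
    then show "\<Gamma>' = \<Gamma> \<Delta>" unfolding image_image inv by simp
  qed
  have lim: "(y \<longlongrightarrow> 0) (at 0 within {\<Delta>. \<Delta> * k > 0})"
  proof (rule Lim_null_comparison)
    let ?h = "\<lambda>\<Delta>. (1 + 20 * \<mu>) * root 3 (\<alpha> * \<Delta> / \<mu>) / \<bar>\<beta>\<bar>"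
    have "(?h \<longlongrightarrow> (1 + 20 * \<mu>) * root 3 (\<alpha> * 0 / \<mu>) / \<bar>\<beta>\<bar>) (at 0 within {\<Delta>. \<Delta> * k > 0})"
      using nz \<mu> by (intro tendsto_intros) auto
    then show "(?h \<longlongrightarrow> 0) (at 0 within {\<Delta>. \<Delta> * k > 0})" by simp
    have "norm (y \<Delta>) \<le> ?h \<Delta>" if "\<Delta> * k > 0" "\<bar>\<Delta>\<bar> < \<delta>" for \<Delta>
    proof -
      have "norm (y \<Delta>) = Y (\<alpha> * \<Delta>) / \<bar>\<beta>\<bar>" using Ypos[OF that] by (simp add: y_def abs_divide)
      also have "\<dots> \<le> ?h \<Delta>" using Y[OF D(1,2)[OF that]] by (intro divide_right_mono) auto
      finally show ?thesis .
    qed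
    then show "\<forall>\<^sub>F \<Delta> in at 0 within {\<Delta>. \<Delta> * k > 0}. norm (y \<Delta>) \<le> ?h \<Delta>"
      unfolding eventually_at using \<delta> by (intro exI[of _ \<delta>]) (auto simp: dist_real_def)
  qed
  have "E / (2 * \<bar>\<beta>\<bar>) > 0" using E nz by simp
  then show ?thesis using lim main \<delta> by blast
qed

end
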